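(* Consider the Gaussian/Poisson product mixture model described in the context, with bounded $\Theta$, and suppose that $g_0\in\mathcal G$ is finitely discrete. Then $$\int\big\|\mathbb E_{\hat g}[\theta\mid x]-\mathbb E_{g_0}[\theta\mid x]\big\|^2 f_{g_0}(x)\,d\mu(x)=O_{\mathbb P}\Big(\frac1n\Big),$$ where $\|\cdot\|$ is the Euclidean norm on $\mathbb R^d$. Moreover, if $b\in\{0,d\}$, then the parametric rate also holds pointwise: for every admissible outcome $x$ (that is, every $x\in\mathbb R^d$ if $b=d$ and every $x\in\mathbb N^d$ if $b=0$), $$\big\|\mathbb E_{\hat g}[\theta\mid x]-\mathbb E_{g_0}[\theta\mid x]\big\|=O_{\mathbb P}\Big(\frac1{\sqrt n}\Big).$$
   Context: Model: let $\mathbb N=\{0,1,2,\dots\}$, $d\ge 1$, fix $b\in\{0,1,\dots,d\}$, and let $\Theta\subseteq\mathbb R^b\times(0,\infty)^{d-b}$ be bounded. For $\theta\in\Theta$ let $p_\theta(x)=\prod_{l=1}^d p_{\theta_l}(x_l)$ for $x\in\mathbb R^b\times\mathbb N^{d-b}$, where $p_{\theta_l}(x_l)=\phi(x_l-\theta_l)$ with $\phi(t)=\frac{1}{\sqrt{2\pi}}e^{-t^2/2}$ for $1\le l\le b$, and $p_{\theta_l}(x_l)=\frac{\theta_l^{x_l}}{x_l!}e^{-\theta_l}$ for $b+1\le l\le d$. The base measure $\mu$ is the product of Lebesgue measure on $\mathbb R^b$ and counting measure on $\mathbb N^{d-b}$. $\mathcal G$ is the set of all probability measures supported on $\Theta$,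 and $f_g(x)=\int_\Theta p_\theta(x)\,dg(\theta)$ for $g\in\mathcal G$. One observes i.i.d. $X_1,\dots,X_n$ with density $f_{g_0}$ with respect to $\mu$, where $g_0\in\mathcal G$ is fixed. With $\ell_n(f)=\sum_{i=1}^n\log f(X_i)$, the NPMLE $\hat g$ is any maximizer of $g\mapsto\ell_n(f_g)$ over $\mathcal G$. "Finitely discrete" means discrete and supported on finitely many points. For $g\in\mathcal G$ the posterior mean is $$\mathbb E_g[\theta\mid x]=\frac{\int_\Theta\theta\,p_\theta(x)\,dg(\theta)}{f_g(x)}.$$ *)

theory Defs
  imports "HOL-Probability.Probability"
begin

text \<open>
  The dimension \<open>d\<close> is \<open>CARD('d)\<close>. The set \<open>B :: 'd set\<close> collects the Gaussian coordinates, so that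
  \<open>card B\<close> is the parameter \<open>b\<close> of the model and the coordinates outside \<open>B\<close> are the
  \<open>d - b\<close> Poisson ones; \<open>B = UNIV\<close> is \<open>b = d\<close> and \<open>B = {}\<close> is \<open>b = 0\<close>.
  Counts are embedded into the reals, so observations and parameters both live in
  \<open>real ^ 'd\<close>.
\<close>

definition param_space :: "'d::finite set \<Rightarrow> (real ^ 'd) set" where
  "param_space B = {\<theta>. \<forall>l. l \<notin> B \<longrightarrow> 0 < \<theta> $ l}"

definition sample_space :: "'d::finite set \<Rightarrow> (real ^ 'd) set" where
  "sample_space B = {x. \<forall>l. l \<notin> B \<longrightarrow> x $ l \<in> \<nat>}"

text \<open>
  The product of Lebesgue measure (on the coordinates in \<open>B\<close>) and counting measure on the
  naturals (on the others), transported from the product space to \<open>real ^ 'd\<close>; it is carried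
  by \<open>sample_space B\<close>.
\<close>

definition base_measure :: "'d::finite set \<Rightarrow> (real ^ 'd) measure" where
  "base_measure B =
     distr (PiM UNIV (\<lambda>l. if l \<in> B then lborel else count_space \<nat>)) borel vec_lambda"

text \<open>
  \<open>lik B \<theta> x\<close> is the density \<open>p\<^sub>\<theta>(x)\<close>. In a Poisson coordinate only natural values of
  \<open>x $ l\<close> matter, and for those \<open>nat \<lfloor>x $ l\<rfloor>\<close> is the count itself.
\<close>

definition lik :: "'d::finite set \<Rightarrow> real ^ 'd \<Rightarrow> real ^ 'd \<Rightarrow> real" where
  "lik B \<theta> x =
     (\<Prod>l\<in>UNIV. if l \<in> B then normal_density (\<theta> $ l) 1 (x $ l)
        else (\<theta> $ l) ^ nat \<lfloor>x $ l\<rfloor> / fact (nat \<lfloor>x $ l\<rfloor>) * exp (- (\<theta> $ l)))"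

text \<open>
  Mixing distributions are the probability measures on \<open>\<Theta>\<close> with its trace Borel sets, so
  \<open>\<Theta>\<close> itself need not be a Borel set and an integral over \<open>g\<close> is an integral over \<open>\<Theta>\<close>.
\<close>

definition mixing_dists :: "(real ^ 'd::finite) set \<Rightarrow> (real ^ 'd) measure set" where
  "mixing_dists \<Theta> = {g. prob_space g \<and> sets g = sets (restrict_space borel \<Theta>)}"

definition finitely_discrete :: "'b measure \<Rightarrow> bool" where
  "finitely_discrete g \<longleftrightarrow> (\<exists>S. finite S \<and> S \<subseteq> space g \<and> (AE \<theta> in g. \<theta> \<in> S))"

definition mix_density :: "'d::finite set \<Rightarrow> (real ^ 'd) measure \<Rightarrow> real ^ 'd \<Rightarrow> real" where
  "mix_density B g x = (\<integral>\<theta>. lik B \<theta> x \<partial>g)"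

definition post_mean :: "'d::finite set \<Rightarrow> (real ^ 'd) measure \<Rightarrow> real ^ 'd \<Rightarrow> real ^ 'd" where
  "post_mean B g x = (\<integral>\<theta>. lik B \<theta> x *\<^sub>R \<theta> \<partial>g) /\<^sub>R mix_density B g x"

definition log_lik :: "nat \<Rightarrow> (nat \<Rightarrow> 'b) \<Rightarrow> ('b \<Rightarrow> real) \<Rightarrow> real" where
  "log_lik n x f = (\<Sum>i=1..n. ln (f (x i)))"

definition is_npmle ::
  "'d::finite set \<Rightarrow> (real ^ 'd) set \<Rightarrow> nat \<Rightarrow> (nat \<Rightarrow> real ^ 'd) \<Rightarrow> (real ^ 'd) measure \<Rightarrow> bool" where
  "is_npmle B \<Theta> n x g \<longleftrightarrow>
     is_arg_max (\<lambda>g. log_lik n x (mix_density B g)) (\<lambda>g. g \<in> mixing_dists \<Theta>) g"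

text \<open>
  \<open>Y\<^sub>n = O\<^sub>P(a\<^sub>n)\<close>. A maximum likelihood estimator is not assumed to be selected measurably, so
  the probability of the exceedance event is an outer probability; for measurable \<open>Y n\<close> it is
  the usual one.
\<close>

definition bigo_in_prob :: "'a measure \<Rightarrow> (nat \<Rightarrow> 'a \<Rightarrow> real) \<Rightarrow> (nat \<Rightarrow> real) \<Rightarrow> bool" where
  "bigo_in_prob M Y a \<longleftrightarrow>
     (\<forall>\<epsilon>>0. \<exists>C>0. \<forall>\<^sub>F n in sequentially.
        \<exists>A\<in>sets M. {\<omega> \<in> space M. C * a n < \<bar>Y n \<omega>\<bar>} \<subseteq> A \<and> measure M A \<le> \<epsilon>)"

end

theory Submission
  imports Defs "HOL-Computational_Algebra.Polynomial"
begin

text \<open>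
  Why the rate is parametric. Write \<open>\<nu> = g - g0\<close> for a candidate mixing distribution \<open>g\<close>.
  Since \<open>g0\<close> has finitely many atoms, \<open>\<nu>\<close> is nonnegative off a finite set \<open>S\<close>, and this makes
  the infinite-dimensional problem finite-dimensional. For each coordinate \<open>l\<close> the polynomial
  \<open>node_poly l t = (\<Prod>s\<in>S. (t - s $ l)\<^sup>2)\<close> is nonnegative and vanishes on the atoms, so its
  integral against \<open>\<nu>\<close> is its integral against \<open>g\<close>, while it is also a combination of finitely many moments of \<open>\<nu>\<close>.
  Division with remainder by \<open>node_poly l\<close> in every coordinate turns each relevant integrand into
  a polynomial of bounded degree plus an error dominated by the sum over \<open>l\<close> of \<open>node_poly l\<close> at
  coordinate \<open>l\<close>. Hence finitely many
  moments of \<open>\<nu>\<close>, whose absolute values add up to \<open>moment_gap g\<close>, control all of their integrals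
  against \<open>\<nu>\<close> (\<open>discrepancy_prod_le\<close>), with constants that grow only geometrically in the degree of the
  integrand.

  The likelihood is an exponential factor times a power series in the parameter whose
  coefficients decay faster than geometrically. Integrating it term by term shows that the relative
  error \<open>h = (f_g - f_g0) / f_g0\<close> and the error of the posterior mean are both at most \<open>moment_gap g\<close>
  times an envelope with moderate growth (\<open>mixture_gap_le\<close>, \<open>post_mean_diff_le\<close>). Both parts of
  the theorem therefore follow once \<open>moment_gap ghat\<close> is of order \<open>1 / sqrt n\<close> in probability.

  That rate has three ingredients. First, the same series expresses the fluctuation of the
  empirical mean of \<open>h\<close>, or of \<open>h\<close> times a fixed statistic, by the fluctuations of countably
  many fixed functions, each weighted by a coefficient that \<open>moment_gap g\<close> controls. So the
  fluctuation is at most \<open>moment_gap g * Z n\<close> simultaneously for all \<open>g\<close>, where \<open>Z n\<close> has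
  expectation \<open>O(1 / sqrt n)\<close> (\<open>uniform_deviation\<close>, \<open>rel_gap_deviation\<close>). Second, maximality gives
  \<open>0 \<le> \<Sum>i. ln (1 + h (X i))\<close>, and as \<open>ln (1 + h) \<le> h - h\<^sup>2 / (4 * (1 + \<bar>h\<bar>))\<close>, the empirical mean
  of \<open>h\<^sup>2 / (1 + \<bar>h\<bar>)\<close> is at most four times that of \<open>h\<close>, hence at most \<open>4 * moment_gap g * Z n\<close>.
  Third, every moment of the mixing distribution has an unbiased estimator \<open>T\<close>
  (\<open>monomial_dual_exists\<close>), so each moment of \<open>\<nu>\<close> is the expectation of \<open>T * h\<close>; up to a
  fluctuation this is an empirical mean, which the Cauchy-Schwarz inequality bounds by the square
  root of the empirical mean of \<open>h\<^sup>2 / (1 + \<bar>h\<bar>)\<close>, up to a factor that is bounded in probability.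
  Summing over the moments gives
  \<open>moment_gap g \<le> C * sqrt (moment_gap g * Z n) + moment_gap g / 2\<close> with high probability
  (\<open>npmle_moment_gap_le\<close>), and therefore \<open>moment_gap g = O(Z n)\<close>.
\<close>

section \<open>Division with remainder by a monic polynomial\<close>

text \<open>
  On \<open>[-R, R]\<close> the function \<open>\<psi>\<close> is a polynomial of degree below \<open>m\<close> plus a multiple of \<open>P\<close>, the
  analogue of division with remainder by a polynomial \<open>P\<close> of degree \<open>m\<close>. A single constant bounds
  the coefficients and the quotient, so that one sequence of constants has to be tracked.
\<close>

definition remainder_bound :: "nat \<Rightarrow> (real \<Rightarrow> real) \<Rightarrow> real \<Rightarrow> (real \<Rightarrow> real) \<Rightarrow> real \<Rightarrow> bool" where
  "remainder_bound m P R \<psi> D \<longleftrightarrow>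
     (\<exists>a. (\<forall>i<m. \<bar>a i\<bar> \<le> D) \<and> (\<forall>t. \<bar>t\<bar> \<le> R \<longrightarrow> \<bar>\<psi> t - (\<Sum>i<m. a i * t ^ i)\<bar> \<le> D * P t))"

text \<open>
  Multiplication by \<open>t\<close> raises the degree of the remainder to at most \<open>m\<close>, and a multiple of the
  monic \<open>P\<close> removes the leading term. The constant grows by a factor that does not depend on \<open>\<psi>\<close>,
  so iteration yields geometric growth.
\<close>

lemma remainder_bound_mult_var:
  assumes P: "\<And>t. P t = t ^ m + (\<Sum>i<m. p i * t ^ i)" "\<And>t. 0 \<le> P t"
    and p: "\<And>i. i < m \<Longrightarrow> \<bar>p i\<bar> \<le> c"
    and "0 \<le> R" "0 \<le> c" "0 \<le> D" "0 < m"
    and psi: "remainder_bound m P R \<psi> D"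
  shows "remainder_bound m P R (\<lambda>t. t * \<psi> t) ((1 + c + R) * D)"
proof -
  obtain a where a: "\<And>i. i < m \<Longrightarrow> \<bar>a i\<bar> \<le> D"
    and err: "\<And>t. \<bar>t\<bar> \<le> R \<Longrightarrow> \<bar>\<psi> t - (\<Sum>i<m. a i * t ^ i)\<bar> \<le> D * P t"
    using psi unfolding remainder_bound_def by auto
  obtain q where m: "m = Suc q" using \<open>0 < m\<close> gr0_conv_Suc by blast
  \<comment> \<open>coefficients of \<open>t * (\<Sum>i<m. a i * t ^ i) - a q * P t\<close>\<close>
  define b where "b i = (if i = 0 then 0 else a (i - 1)) - a q * p i" for i
  have shift: "t * (\<Sum>i<m. a i * t ^ i) - (\<Sum>i<m. b i * t ^ i) = a q * P t" for t
  proof -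
    have "(\<Sum>i<m. b i * t ^ i) = (\<Sum>i<m. (if i = 0 then 0 else a (i - 1)) * t ^ i) - a q * (\<Sum>i<m. p i * t ^ i)"
      by (simp add: b_def left_diff_distrib sum_subtractf sum_distrib_left mult.assoc)
    also have "(\<Sum>i<m. (if i = 0 then 0 else a (i - 1)) * t ^ i) = (\<Sum>i<q. a i * t ^ Suc i)"
      unfolding m by (subst sum.lessThan_Suc_shift) simp
    finally have "(\<Sum>i<m. b i * t ^ i) = (\<Sum>i<q. a i * t ^ Suc i) - a q * (\<Sum>i<m. p i * t ^ i)" .
    moreover have "t * (\<Sum>i<m. a i * t ^ i) = (\<Sum>i<q. a i * t ^ Suc i) + a q * t ^ m"
      unfolding m by (simp add: sum_distrib_left algebra_simps)
    ultimately show ?thesis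
      using P(1)[of t] by (simp add: algebra_simps)
  qed
  have "\<bar>b i\<bar> \<le> (1 + c + R) * D" if "i < m" for i
  proof -
    have "\<bar>a q * p i\<bar> \<le> D * c"
      unfolding abs_mult using a[of q] p[OF that] m by (intro mult_mono) auto
    moreover have "\<bar>if i = 0 then 0 else a (i - 1)\<bar> \<le> D"
      using a[of "i - 1"] that \<open>0 \<le> D\<close> by auto
    ultimately have "\<bar>b i\<bar> \<le> D + D * c"
      unfolding b_def by linarith
    also have "\<dots> \<le> (1 + c + R) * D"
      using \<open>0 \<le> R\<close> \<open>0 \<le> D\<close> by (simp add: algebra_simps)
    finally show ?thesis .
  qed
  moreover have "\<bar>t * \<psi> t - (\<Sum>i<m. b i * t ^ i)\<bar> \<le> (1 + c + R) * D * P t" if "\<bar>t\<bar> \<le> R" for t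
  proof -
    have "t * \<psi> t - (\<Sum>i<m. b i * t ^ i) = t * (\<psi> t - (\<Sum>i<m. a i * t ^ i)) + a q * P t"
      using shift[of t] by (simp add: algebra_simps)
    also have "\<bar>\<dots>\<bar> \<le> R * (D * P t) + D * P t"
      using err[OF that] that a[of q] m P(2)[of t] \<open>0 \<le> D\<close>
      by (intro order.trans[OF abs_triangle_ineq] add_mono)
         (auto simp: abs_mult intro!: mult_mono)
    also have "\<dots> \<le> (1 + c + R) * D * P t"
      using \<open>0 \<le> c\<close> \<open>0 \<le> D\<close> P(2)[of t] by (simp add: algebra_simps)
    finally show ?thesis .
  qed
  ultimately show ?thesis unfolding remainder_bound_def by blast
qed

lemma remainder_bound_times_power:
  assumes P: "\<And>t. P t = t ^ m + (\<Sum>i<m. p i * t ^ i)" "\<And>t. 0 \<le> P t"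
    and p: "\<And>i. i < m \<Longrightarrow> \<bar>p i\<bar> \<le> c"
    and R: "0 \<le> R" "0 \<le> c" "0 \<le> D" "0 < m"
    and psi: "remainder_bound m P R \<psi> D"
  shows "remainder_bound m P R (\<lambda>t. t ^ k * \<psi> t) ((1 + c + R) ^ k * D)"
proof (induction k)
  case 0
  then show ?case using psi by simp
next
  case (Suc k)
  from remainder_bound_mult_var[where m=m and p=p, OF P p R(1,2) _ R(4) Suc.IH] show ?case
    using R by (simp add: mult.assoc)
qed

lemma remainder_bound_sums:
  assumes psi: "\<And>k. remainder_bound m P R (\<psi> k) (D k)"
    and P: "\<And>t. 0 \<le> P t"
    and sums: "\<And>t. \<bar>t\<bar> \<le> R \<Longrightarrow> (\<lambda>k. s k * \<psi> k t) sums \<Psi> t"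
    and D: "(\<lambda>k. \<bar>s k\<bar> * D k) sums E"
  shows "remainder_bound m P R \<Psi> E"
proof -
  obtain a where a: "\<And>k i. i < m \<Longrightarrow> \<bar>a k i\<bar> \<le> D k"
    and err: "\<And>k t. \<bar>t\<bar> \<le> R \<Longrightarrow> \<bar>\<psi> k t - (\<Sum>i<m. a k i * t ^ i)\<bar> \<le> D k * P t"
    using psi unfolding remainder_bound_def by metis
  have sum_a: "summable (\<lambda>k. s k * a k i)" and abs_a: "\<bar>\<Sum>k. s k * a k i\<bar> \<le> E" if "i < m" for i
  proof -
    have le: "norm (s k * a k i) \<le> \<bar>s k\<bar> * D k" for k
      using a[OF that, of k] by (simp add: abs_mult mult_left_mono)
    show "summable (\<lambda>k. s k * a k i)"
      by (rule summable_comparison_test'[OF sums_summable[OF D], of 0]) (rule le)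
    have "norm (\<Sum>k. s k * a k i) \<le> (\<Sum>k. \<bar>s k\<bar> * D k)"
      by (rule norm_suminf_le[OF le sums_summable[OF D]])
    then show "\<bar>\<Sum>k. s k * a k i\<bar> \<le> E"
      using sums_unique[OF D] by simp
  qed
  have "\<bar>\<Psi> t - (\<Sum>i<m. (\<Sum>k. s k * a k i) * t ^ i)\<bar> \<le> E * P t" if "\<bar>t\<bar> \<le> R" for t
  proof -
    have "(\<lambda>k. \<Sum>i<m. s k * a k i * t ^ i) sums (\<Sum>i<m. (\<Sum>k. s k * a k i) * t ^ i)"
      by (intro sums_sum sums_mult2 summable_sums sum_a) auto
    from sums_diff[OF sums[OF that] this]
    have d: "(\<lambda>k. s k * \<psi> k t - (\<Sum>i<m. s k * a k i * t ^ i)) sums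
        (\<Psi> t - (\<Sum>i<m. (\<Sum>k. s k * a k i) * t ^ i))" .
    have "s k * \<psi> k t - (\<Sum>i<m. s k * a k i * t ^ i) = s k * (\<psi> k t - (\<Sum>i<m. a k i * t ^ i))" for k
      by (simp add: right_diff_distrib sum_distrib_left mult.assoc)
    then have le: "norm (s k * \<psi> k t - (\<Sum>i<m. s k * a k i * t ^ i)) \<le> \<bar>s k\<bar> * D k * P t" for k
      using err[OF that, of k] by (simp add: abs_mult mult_left_mono mult.assoc)
    have "norm (\<Sum>k. s k * \<psi> k t - (\<Sum>i<m. s k * a k i * t ^ i)) \<le> (\<Sum>k. \<bar>s k\<bar> * D k * P t)"
      by (rule norm_suminf_le[OF le]) (intro summable_mult2 sums_summable[OF D])
    then show ?thesis
      using sums_unique[OF d] sums_unique[OF sums_mult2[OF D, of "P t"]] by simp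
  qed
  with abs_a show ?thesis
    unfolding remainder_bound_def by (intro exI[of _ "\<lambda>i. \<Sum>k. s k * a k i"]) blast
qed

text \<open>
  The constants of the powers of \<open>t\<close> grow geometrically, so the exponential series of these
  constants still converges. The exponents of interest are \<open>- t\<^sup>2 / 2\<close> and \<open>- t\<close>.
\<close>

lemma remainder_bound_power_exp:
  assumes P: "\<And>t. P t = t ^ m + (\<Sum>i<m. p i * t ^ i)" "\<And>t. 0 \<le> P t"
    and p: "\<And>i. i < m \<Longrightarrow> \<bar>p i\<bar> \<le> c"
    and R: "0 \<le> R" "0 \<le> c" "0 < m"
  shows "remainder_bound m P R (\<lambda>t. t ^ k * exp (s * t ^ q))
           ((1 + c + R) ^ k * exp (\<bar>s\<bar> * (1 + c + R) ^ q))"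
proof (rule remainder_bound_times_power[OF P p R(1,2) _ R(3)])
  let ?A = "1 + c + R"
  have one: "remainder_bound m P R (\<lambda>t. 1) 1"
    unfolding remainder_bound_def using \<open>0 < m\<close> P(2)
    by (intro exI[of _ "\<lambda>i. if i = 0 then 1 else 0"]) (auto simp: if_distrib[of "\<lambda>x. x * _"] cong: if_cong)
  have pow: "remainder_bound m P R (\<lambda>t. t ^ j) (?A ^ j)" for j
    using remainder_bound_times_power[OF P p R(1,2) _ R(3) one] by simp
  show "remainder_bound m P R (\<lambda>t. exp (s * t ^ q)) (exp (\<bar>s\<bar> * ?A ^ q))"
  proof (rule remainder_bound_sums[where \<psi> = "\<lambda>j t. t ^ (q * j)" and s = "\<lambda>j. s ^ j /\<^sub>R fact j"])
    show "(\<lambda>j. (s ^ j /\<^sub>R fact j) * t ^ (q * j)) sums exp (s * t ^ q)" for t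
      using exp_converges[of "s * t ^ q"] by (simp add: power_mult_distrib power_mult mult.assoc)
    show "(\<lambda>j. \<bar>s ^ j /\<^sub>R fact j\<bar> * ?A ^ (q * j)) sums exp (\<bar>s\<bar> * ?A ^ q)"
      using exp_converges[of "\<bar>s\<bar> * ?A ^ q"]
      by (simp add: power_mult_distrib power_mult mult.assoc abs_mult power_abs)
  qed (use pow P in auto)
qed auto

lemma prod_squares_monic_expansion:
  fixes f :: "'b \<Rightarrow> real"
  assumes "finite S"
  shows "\<exists>p. \<forall>t. (\<Prod>s\<in>S. (t - f s)\<^sup>2) = t ^ (2 * card S) + (\<Sum>i<2 * card S. p i * t ^ i)"
proof -
  define Q where "Q = (\<Prod>s\<in>S. [:- f s, 1:]\<^sup>2)"
  have deg: "degree Q = 2 * card S"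
    unfolding Q_def by (subst degree_prod_eq_sum_degree) (auto simp: degree_power_eq)
  have lead: "lead_coeff Q = 1"
    unfolding Q_def by (simp add: lead_coeff_prod lead_coeff_power)
  have "(\<Prod>s\<in>S. (t - f s)\<^sup>2) = poly Q t" for t
    unfolding Q_def by (simp add: poly_prod)
  also have "poly Q t = t ^ (2 * card S) + (\<Sum>i<2 * card S. coeff Q i * t ^ i)" for t
    unfolding poly_altdef deg using lead deg
    by (simp add: lessThan_Suc_atMost[symmetric])
  finally show ?thesis by (intro exI[of _ "coeff Q"]) auto
qed

lemma remainder_bound_mono:
  assumes "remainder_bound m P R \<psi> D" "D \<le> D'" "\<And>t. 0 \<le> P t"
  shows "remainder_bound m P R \<psi> D'"
proof -
  obtain a where a: "\<And>i. i < m \<Longrightarrow> \<bar>a i\<bar> \<le> D"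
    and err: "\<And>t. \<bar>t\<bar> \<le> R \<Longrightarrow> \<bar>\<psi> t - (\<Sum>i<m. a i * t ^ i)\<bar> \<le> D * P t"
    using assms(1) unfolding remainder_bound_def by auto
  have "\<bar>\<psi> t - (\<Sum>i<m. a i * t ^ i)\<bar> \<le> D' * P t" if "\<bar>t\<bar> \<le> R" for t
    using err[OF that] mult_right_mono[OF assms(2,3), of t] by linarith
  moreover have "\<bar>a i\<bar> \<le> D'" if "i < m" for i
    using a[OF that] assms(2) by linarith
  ultimately show ?thesis
    unfolding remainder_bound_def by blast
qed

section \<open>Gaussian and Poisson coordinates\<close>

text \<open>
  The flag \<open>G\<close> distinguishes a Gaussian coordinate from a Poisson coordinate.
\<close>

definition coord_density :: "bool \<Rightarrow> real \<Rightarrow> real \<Rightarrow> real" where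
  "coord_density G t x =
     (if G then normal_density t 1 x else t ^ nat \<lfloor>x\<rfloor> / fact (nat \<lfloor>x\<rfloor>) * exp (- t))"

definition coord_measure :: "bool \<Rightarrow> real measure" where
  "coord_measure G = (if G then lborel else count_space \<nat>)"

text \<open>
  Both families have densities \<open>\<eta> t * (\<Sum>k. t ^ k * c k x)\<close>, with \<open>\<eta> t = exp (- t\<^sup>2 / 2)\<close> in the
  Gaussian and \<open>\<eta> t = exp (- t)\<close> in the Poisson case. This is \<open>\<eta> t * t ^ k\<close>, and \<open>coord_coeff\<close> is
  \<open>c k x\<close>; for a Poisson coordinate only the term \<open>k = x\<close> of the series is present.
\<close>

definition tilted_power :: "bool \<Rightarrow> nat \<Rightarrow> real \<Rightarrow> real" where
  "tilted_power G k t = t ^ k * exp ((if G then - 1 / 2 else - 1) * t ^ (if G then 2 else 1))"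

definition coord_coeff :: "bool \<Rightarrow> nat \<Rightarrow> real \<Rightarrow> real" where
  "coord_coeff G k x =
     (if G then std_normal_density x * x ^ k / fact k
      else if nat \<lfloor>x\<rfloor> = k then 1 / fact k else 0)"

lemma normal_density_tilt: "normal_density t 1 x = std_normal_density x * exp (x * t - t\<^sup>2 / 2)"
proof -
  have "- (x - t)\<^sup>2 / 2 = - x\<^sup>2 / 2 + (x * t - t\<^sup>2 / 2)"
    by (simp add: power2_eq_square field_simps)
  then show ?thesis
    by (simp add: normal_density_def exp_add[symmetric])
qed

lemma power_over_fact_le_exp:
  fixes x :: real assumes "0 \<le> x"
  shows "x ^ k / fact k \<le> exp x"
proof -
  have "(\<Sum>i\<in>{k}. x ^ i /\<^sub>R fact i) \<le> (\<Sum>i. x ^ i /\<^sub>R fact i)"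
    using assms summable_exp_generic[of x] by (intro sum_le_suminf) auto
  then show ?thesis by (simp add: exp_def divide_inverse mult.commute)
qed

lemma coord_expansion:
  "(\<lambda>k. tilted_power G k t * coord_coeff G k x) sums coord_density G t x"
proof (cases G)
  case True
  have "(\<lambda>k. (x * t) ^ k /\<^sub>R fact k) sums exp (x * t)"
    by (rule exp_converges)
  from sums_mult[OF this, of "std_normal_density x * exp (- (t\<^sup>2 / 2))"]
  have *: "(\<lambda>k. std_normal_density x * exp (- (t\<^sup>2 / 2)) * ((x * t) ^ k /\<^sub>R fact k)) sums
      (std_normal_density x * exp (- (t\<^sup>2 / 2)) * exp (x * t))" .
  have "std_normal_density x * exp (- (t\<^sup>2 / 2)) * exp (x * t) = normal_density t 1 x"
    by (simp add: normal_density_tilt[of t] mult.assoc mult_exp_exp)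
  moreover have "std_normal_density x * exp (- (t\<^sup>2 / 2)) * ((x * t) ^ k /\<^sub>R fact k) =
      tilted_power G k t * coord_coeff G k x" for k
    using True by (simp add: tilted_power_def coord_coeff_def power_mult_distrib field_simps)
  ultimately show ?thesis
    using * True by (simp add: coord_density_def)
next
  case False
  then have "(\<lambda>k. tilted_power G k t * coord_coeff G k x) =
      (\<lambda>k. if k = nat \<lfloor>x\<rfloor> then t ^ k * exp (- t) / fact k else 0)"
    by (auto simp: tilted_power_def coord_coeff_def)
  with sums_single[of "nat \<lfloor>x\<rfloor>" "\<lambda>k. t ^ k * exp (- t) / fact k"] False show ?thesis
    by (simp add: coord_density_def)
qed

lemma coord_density_pos: "(\<not> G \<Longrightarrow> 0 < t) \<Longrightarrow> 0 < coord_density G t x"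
  by (auto simp: coord_density_def intro: normal_density_pos)

lemma nat_floor_le_abs: "real (nat \<lfloor>x\<rfloor>) \<le> \<bar>x\<bar>"
  by (cases "0 \<le> x") auto

text \<open>
  Dividing the coefficients by a density of the family costs no more than an exponential factor,
  whatever the geometric weight \<open>A ^ k\<close>. In the Gaussian case \<open>(A * \<bar>x\<bar>) ^ k / fact k \<le> exp (A * \<bar>x\<bar>)\<close>,
  and the two normal densities have ratio \<open>exp (t\<^sup>2 / 2 - x * t)\<close>. In the Poisson case \<open>k\<close> equals
  \<open>x\<close>, so \<open>A ^ k\<close> is itself exponential in \<open>x\<close>.
\<close>

lemma coord_coeff_bound:
  assumes t: "\<not> G \<Longrightarrow> 0 < t" and "0 \<le> A"
  obtains K where "0 \<le> K"
    "\<And>k x. A ^ k * \<bar>coord_coeff G k x\<bar> \<le> K * exp (K * \<bar>x\<bar>) * coord_density G t x"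
proof (cases G)
  case True
  define K where "K = exp (t\<^sup>2 / 2) + A + \<bar>t\<bar>"
  have "A ^ k * \<bar>coord_coeff G k x\<bar> \<le> K * exp (K * \<bar>x\<bar>) * coord_density G t x" for k x
  proof -
    have "A ^ k * \<bar>coord_coeff G k x\<bar> = std_normal_density x * ((A * \<bar>x\<bar>) ^ k / fact k)"
      using True by (simp add: coord_coeff_def abs_mult power_abs power_mult_distrib)
    also have "\<dots> \<le> std_normal_density x * exp (A * \<bar>x\<bar>)"
      using \<open>0 \<le> A\<close> by (intro mult_left_mono power_over_fact_le_exp) auto
    also have "\<dots> = coord_density G t x * (exp (t\<^sup>2 / 2) * (exp (A * \<bar>x\<bar>) * exp (- (x * t))))"
    proof -
      have "exp (x * t - t\<^sup>2 / 2) * (exp (t\<^sup>2 / 2) * (exp (A * \<bar>x\<bar>) * exp (- (x * t)))) = exp (A * \<bar>x\<bar>)"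
        by (simp only: mult_exp_exp) simp
      then show ?thesis
        using True by (simp add: coord_density_def normal_density_tilt[of t] mult.assoc)
    qed
    also have "\<dots> \<le> coord_density G t x * (K * exp (K * \<bar>x\<bar>))"
    proof (intro mult_left_mono mult_mono)
      have "- (x * t) \<le> \<bar>t\<bar> * \<bar>x\<bar>"
        by (metis abs_ge_minus_self abs_mult mult.commute)
      then have "A * \<bar>x\<bar> + - (x * t) \<le> K * \<bar>x\<bar>"
        unfolding K_def by (simp add: ring_distribs add_increasing)
      then show "exp (A * \<bar>x\<bar>) * exp (- (x * t)) \<le> exp (K * \<bar>x\<bar>)"
        by (simp add: exp_add[symmetric])
    qed (use \<open>0 \<le> A\<close> coord_density_pos[of G t x, OF t] in \<open>auto simp: K_def\<close>)
    finally show ?thesis by (simp add: mult_ac)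
  qed
  moreover have "0 \<le> K" using \<open>0 \<le> A\<close> by (simp add: K_def)
  ultimately show ?thesis by (rule that[rotated])
next
  case False
  with t have t: "0 < t" by simp
  define K where "K = exp t + A / t"
  have K: "0 \<le> K" using \<open>0 \<le> A\<close> t by (simp add: K_def)
  have "A ^ k * \<bar>coord_coeff G k x\<bar> \<le> K * exp (K * \<bar>x\<bar>) * coord_density G t x" for k x
  proof (cases "nat \<lfloor>x\<rfloor> = k")
    case True
    have "(A / t) ^ k \<le> exp (A / t) ^ k"
    proof (rule power_mono)
      show "A / t \<le> exp (A / t)"
        using exp_ge_add_one_self[of "A / t"] by linarith
    qed (use \<open>0 \<le> A\<close> t in auto)
    also have "\<dots> = exp (A / t * real k)"
      by (rule exp_of_nat2_mult[symmetric])
    also have "\<dots> \<le> exp (K * \<bar>x\<bar>)"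
    proof -
      have "A / t * real k \<le> K * \<bar>x\<bar>"
        using nat_floor_le_abs[of x] True \<open>0 \<le> A\<close> t K by (intro mult_mono) (auto simp: K_def)
      then show ?thesis by simp
    qed
    finally have "exp t * (A / t) ^ k \<le> K * exp (K * \<bar>x\<bar>)"
      using \<open>0 \<le> A\<close> t K by (intro mult_mono) (auto simp: K_def)
    from mult_right_mono[OF this, of "t ^ k / fact k * exp (- t)"]
    moreover have "A ^ k * \<bar>coord_coeff G k x\<bar> = exp t * (A / t) ^ k * (t ^ k / fact k * exp (- t))"
      using True False t by (simp add: coord_coeff_def exp_minus power_divide)
    ultimately show ?thesis
      using True False t by (simp add: coord_density_def)
  next
    case False2: False
    then show ?thesis
      using False K coord_density_pos[of G t x] t by (simp add: coord_coeff_def less_imp_le)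
  qed
  then show ?thesis using K that by blast
qed

lemma has_bochner_integral_count_space_Nats:
  fixes f :: "real \<Rightarrow> real"
  assumes "(\<lambda>n. f (real n)) sums s" "summable (\<lambda>n. \<bar>f (real n)\<bar>)"
  shows "has_bochner_integral (count_space \<nat>) f s"
proof -
  have bij: "bij_betw real UNIV \<nat>"
    by (auto simp: bij_betw_def Nats_def inj_on_def)
  have int: "integrable (count_space UNIV) (\<lambda>n. f (real n))"
    using assms(2) by (simp add: integrable_count_space_nat_iff)
  have "integrable (count_space \<nat>) f"
    using integrable_bij_count_space[OF bij, of f] int by simp
  moreover have "integral\<^sup>L (count_space \<nat>) f = s"
    using integral_bij_count_space[OF bij, of f] sums_unique2[OF sums_integral_count_space_nat[OF int] assms(1)]
    by simp
  ultimately show ?thesis by (simp add: has_bochner_integral_iff)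
qed

lemma integrable_exp_coord_density:
  assumes t: "\<not> G \<Longrightarrow> 0 < t"
  shows "integrable (coord_measure G) (\<lambda>x. exp (K * \<bar>x\<bar>) * coord_density G t x)"
proof (cases G)
  case True
  \<comment> \<open>exponential tilting of a normal density moves its mean\<close>
  have shift: "exp (c * x) * normal_density t 1 x = exp (c * t + c\<^sup>2 / 2) * normal_density (t + c) 1 x" for c x :: real
    by (simp add: normal_density_tilt[of t] normal_density_tilt[of "t + c"] mult_exp_exp mult.left_commute[of "exp _" "std_normal_density x"]) (simp add: power2_eq_square field_simps)
  have e: "integrable lborel (\<lambda>x. exp (c * x) * normal_density t 1 x)" for c
    unfolding shift by (intro integrable_mult_right integrable_normal_density) auto
  have "integrable lborel (\<lambda>x. exp (K * \<bar>x\<bar>) * normal_density t 1 x)"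
  proof (rule Bochner_Integration.integrable_bound[OF Bochner_Integration.integrable_add[OF e[of K] e[of "- K"]]])
    have "exp (K * \<bar>x\<bar>) * normal_density t 1 x \<le> (exp (K * x) + exp (- K * x)) * normal_density t 1 x" for x
      by (intro mult_right_mono) (auto simp: abs_if)
    then show "AE x in lborel. norm (exp (K * \<bar>x\<bar>) * normal_density t 1 x)
        \<le> norm (exp (K * x) * normal_density t 1 x + exp (- K * x) * normal_density t 1 x)"
      by (intro always_eventually allI) (simp add: abs_mult distrib_right add_nonneg_nonneg)
  qed measurable
  with True show ?thesis by (simp add: coord_measure_def coord_density_def)
next
  case False
  with t have "0 < t" by simp
  have "(\<lambda>n. exp (- t) * ((exp K * t) ^ n /\<^sub>R fact n)) sums (exp (- t) * exp (exp K * t))"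
    by (intro sums_mult exp_converges)
  moreover have eq: "exp (- t) * ((exp K * t) ^ n /\<^sub>R fact n)
      = exp (K * \<bar>real n\<bar>) * coord_density G t (real n)" for n
    using False by (simp add: coord_density_def power_mult_distrib exp_of_nat2_mult divide_inverse mult_ac)
  ultimately have *: "(\<lambda>n. exp (K * \<bar>real n\<bar>) * coord_density G t (real n)) sums (exp (- t) * exp (exp K * t))"
    by simp
  have "has_bochner_integral (count_space \<nat>) (\<lambda>x. exp (K * \<bar>x\<bar>) * coord_density G t x) (exp (- t) * exp (exp K * t))"
  proof (rule has_bochner_integral_count_space_Nats[OF *])
    have "\<bar>exp (K * \<bar>real n\<bar>) * coord_density G t (real n)\<bar> = exp (K * \<bar>real n\<bar>) * coord_density G t (real n)" for n
      using coord_density_pos[OF t, where x="real n"] by (simp add: abs_mult less_imp_le)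
    then show "summable (\<lambda>n. \<bar>exp (K * \<bar>real n\<bar>) * coord_density G t (real n)\<bar>)"
      using sums_summable[OF *] by presburger
  qed
  with False show ?thesis by (simp add: coord_measure_def has_bochner_integral_iff)
qed

lemma coord_density_integral:
  assumes t: "\<not> G \<Longrightarrow> 0 < t"
  shows "has_bochner_integral (coord_measure G) (coord_density G t) 1"
proof (cases G)
  case True
  then have "coord_density G t = normal_density t 1"
    by (simp add: coord_density_def fun_eq_iff)
  with True show ?thesis
    by (simp add: coord_measure_def has_bochner_integral_iff)
next
  case False
  with t have "0 < t" by simp
  have eq: "coord_density G t (real n) = exp (- t) * (t ^ n /\<^sub>R fact n)" for n
    using False by (simp add: coord_density_def divide_inverse mult_ac)
  have sums: "(\<lambda>n. coord_density G t (real n)) sums 1"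
    unfolding eq using sums_mult[OF exp_converges[of t], of "exp (- t)"] by (simp add: mult_exp_exp)
  have "\<bar>coord_density G t (real n)\<bar> = coord_density G t (real n)" for n
    using coord_density_pos[of G t "real n", OF t] by simp
  then have "has_bochner_integral (count_space \<nat>) (coord_density G t) 1"
    using sums sums_summable[OF sums] by (intro has_bochner_integral_count_space_Nats) simp_all
  with False show ?thesis by (simp add: coord_measure_def)
qed

lemma normal_power_moment:
  "has_bochner_integral lborel (\<lambda>x. x ^ k * normal_density t 1 x)
     (\<Sum>j\<le>k. of_nat (k choose j) * (\<integral>y. std_normal_density y * y ^ j \<partial>lborel) * t ^ (k - j))"
proof -
  have "has_bochner_integral lborel
      (\<lambda>y. \<Sum>j\<le>k. of_nat (k choose j) * (std_normal_density y * y ^ j) * t ^ (k - j))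
      (\<Sum>j\<le>k. of_nat (k choose j) * (\<integral>y. std_normal_density y * y ^ j \<partial>lborel) * t ^ (k - j))"
    by (intro has_bochner_integral_sum has_bochner_integral_mult_left has_bochner_integral_mult_right
        has_bochner_integral_integrable integrable_std_normal_moment)
  moreover have "(\<Sum>j\<le>k. of_nat (k choose j) * (std_normal_density y * y ^ j) * t ^ (k - j)) =
      (t + 1 * y) ^ k * normal_density t 1 (t + 1 * y)" for y
  proof -
    have "normal_density t 1 (t + 1 * y) = std_normal_density y"
      by (simp add: normal_density_def)
    then show ?thesis
      unfolding add.commute[of t] binomial_ring by (simp add: sum_distrib_left sum_distrib_right mult_ac)
  qed
  ultimately have "has_bochner_integral lborel (\<lambda>y. (t + 1 * y) ^ k * normal_density t 1 (t + 1 * y))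
      (\<Sum>j\<le>k. of_nat (k choose j) * (\<integral>y. std_normal_density y * y ^ j \<partial>lborel) * t ^ (k - j))"
    by simp
  then show ?thesis
    by (subst lborel_has_bochner_integral_real_affine_iff[where c=1 and t=t]) simp_all
qed

text \<open>
  An unbiased estimator of \<open>t ^ k\<close>. The growth condition keeps it integrable after
  multiplication with the envelopes that occur below.
\<close>

definition power_dual :: "bool \<Rightarrow> nat \<Rightarrow> (real \<Rightarrow> real) \<Rightarrow> bool" where
  "power_dual G k T \<longleftrightarrow> T \<in> borel_measurable borel \<and> (\<exists>K\<ge>0. \<forall>x. \<bar>T x\<bar> \<le> K * exp \<bar>x\<bar>) \<and>
     (\<forall>t. (\<not> G \<longrightarrow> 0 < t) \<longrightarrow>
        has_bochner_integral (coord_measure G) (\<lambda>x. T x * coord_density G t x) (t ^ k))"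

text \<open>
  The \<open>k\<close>-th moment of the normal distribution with mean \<open>t\<close> is a monic polynomial of degree \<open>k\<close>
  in \<open>t\<close>; its lower terms are removed with the estimators of lower degree. The result is the
  Hermite polynomial of degree \<open>k\<close>.
\<close>

lemma power_dual_gaussian: "\<exists>T. power_dual True k T"
proof (induction k rule: less_induct)
  case (less k)
  then obtain T where T: "\<And>j. j < k \<Longrightarrow> power_dual True j (T j)" by metis
  then obtain K where K: "\<And>j x. j < k \<Longrightarrow> 0 \<le> K j \<and> \<bar>T j x\<bar> \<le> K j * exp \<bar>x\<bar>"
    unfolding power_dual_def by metis
  define M where "M j = (\<integral>y. std_normal_density y * y ^ j \<partial>lborel)" for j
  define U where "U x = x ^ k - (\<Sum>j<k. of_nat (k choose j) * M (k - j) * T j x)" for x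
  have M0: "M 0 = 1"
    using integral_std_normal_moment_even[of 0] by (simp add: M_def)
  have "U \<in> borel_measurable borel"
    using T unfolding U_def power_dual_def
    by (intro borel_measurable_diff borel_measurable_sum borel_measurable_times borel_measurable_power) auto
  moreover have "\<exists>C\<ge>0. \<forall>x. \<bar>U x\<bar> \<le> C * exp \<bar>x\<bar>"
  proof (intro exI[of _ "fact k + (\<Sum>j<k. \<bar>of_nat (k choose j) * M (k - j)\<bar> * K j)"] conjI allI)
    show "0 \<le> fact k + (\<Sum>j<k. \<bar>of_nat (k choose j) * M (k - j)\<bar> * K j)"
      using K by (intro add_nonneg_nonneg sum_nonneg mult_nonneg_nonneg) auto
    fix x :: real
    have "\<bar>x ^ k\<bar> \<le> fact k * exp \<bar>x\<bar>"
      using power_over_fact_le_exp[of "\<bar>x\<bar>" k] by (simp add: power_abs field_simps)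
    moreover have "\<bar>\<Sum>j<k. of_nat (k choose j) * M (k - j) * T j x\<bar> \<le>
        (\<Sum>j<k. \<bar>of_nat (k choose j) * M (k - j)\<bar> * (K j * exp \<bar>x\<bar>))"
      by (rule order.trans[OF sum_abs], rule sum_mono, subst abs_mult, rule mult_left_mono) (use K in auto)
    ultimately show "\<bar>U x\<bar> \<le> (fact k + (\<Sum>j<k. \<bar>of_nat (k choose j) * M (k - j)\<bar> * K j)) * exp \<bar>x\<bar>"
      unfolding U_def by (simp add: distrib_right sum_distrib_right mult.assoc)
  qed
  moreover have "has_bochner_integral lborel (\<lambda>x. U x * normal_density t 1 x) (t ^ k)" for t
  proof -
    have "has_bochner_integral lborel (\<lambda>x. x ^ k * normal_density t 1 x -
        (\<Sum>j<k. of_nat (k choose j) * M (k - j) * (T j x * normal_density t 1 x)))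
        ((\<Sum>j\<le>k. of_nat (k choose j) * M j * t ^ (k - j)) - (\<Sum>j<k. of_nat (k choose j) * M (k - j) * t ^ j))"
      using T normal_power_moment[of k t]
      unfolding power_dual_def coord_measure_def coord_density_def M_def
      by (intro has_bochner_integral_diff has_bochner_integral_sum has_bochner_integral_mult_right) auto
    also have "(\<Sum>j\<le>k. of_nat (k choose j) * M j * t ^ (k - j)) =
        (\<Sum>j\<le>k. of_nat (k choose j) * M (k - j) * t ^ j)"
      by (subst sum.nat_diff_reindex[of _ "Suc k", unfolded lessThan_Suc_atMost, symmetric])
         (auto intro!: sum.cong simp: binomial_symmetric[symmetric])
    also have "\<dots> - (\<Sum>j<k. of_nat (k choose j) * M (k - j) * t ^ j) = t ^ k"
      by (simp add: lessThan_Suc_atMost[symmetric] M0)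
    finally show ?thesis
      by (simp add: U_def left_diff_distrib sum_distrib_right mult.assoc)
  qed
  ultimately show ?case
    by (intro exI[of _ U]) (simp add: power_dual_def coord_measure_def coord_density_def)
qed

text \<open>
  The \<open>k\<close>-th factorial moment of a Poisson distribution with mean \<open>t\<close> is \<open>t ^ k\<close>.
\<close>

lemma power_dual_poisson: "\<exists>T. power_dual False k T"
proof -
  define T :: "real \<Rightarrow> real" where "T x = fact k * of_nat (nat \<lfloor>x\<rfloor> choose k)" for x
  have "T \<in> borel_measurable borel"
    unfolding T_def by measurable
  moreover have "\<bar>T x\<bar> \<le> fact k * exp \<bar>x\<bar>" for x
  proof -
    have "real (nat \<lfloor>x\<rfloor> choose k) \<le> 2 ^ nat \<lfloor>x\<rfloor>"
      using binomial_le_pow2[of "nat \<lfloor>x\<rfloor>" k] by (metis of_nat_le_iff of_nat_numeral of_nat_power)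
    also have "\<dots> \<le> exp 1 ^ nat \<lfloor>x\<rfloor>"
      using exp_ge_add_one_self[of "1::real"] by (intro power_mono) auto
    also have "\<dots> = exp (real (nat \<lfloor>x\<rfloor>))"
      by (simp add: exp_of_nat2_mult[symmetric])
    also have "\<dots> \<le> exp \<bar>x\<bar>"
      using nat_floor_le_abs[of x] by simp
    finally show ?thesis by (simp add: T_def abs_mult)
  qed
  moreover have "has_bochner_integral (count_space \<nat>) (\<lambda>x. T x * coord_density False t x) (t ^ k)"
    if "0 < t" for t
  proof -
    let ?f = "\<lambda>n. T (real n) * coord_density False t (real n)"
    have shift: "?f (n + k) = t ^ k * exp (- t) * (t ^ n /\<^sub>R fact n)" for n
    proof -
      have "T (real (n + k)) = fact (n + k) / fact n"
        by (simp only: T_def floor_of_nat nat_int) (simp add: binomial_fact)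
      then show ?thesis
        by (simp add: coord_density_def power_add nat_add_distrib divide_inverse del: of_nat_add)
    qed
    have "(\<lambda>n. ?f (n + k)) sums (t ^ k * exp (- t) * exp t)"
      unfolding shift by (intro sums_mult exp_converges)
    also have "t ^ k * exp (- t) * exp t = t ^ k - (\<Sum>i<k. ?f i)"
      by (auto simp: T_def mult.assoc mult_exp_exp intro!: sum.neutral)
    finally have sums: "?f sums (t ^ k)"
      using sums_iff_shift'[of ?f k "t ^ k"] by metis
    moreover have "\<bar>?f n\<bar> = ?f n" for n
      using coord_density_pos[of False t "real n"] that by (simp add: T_def abs_mult)
    ultimately show ?thesis
      by (intro has_bochner_integral_count_space_Nats) (simp_all add: sums_iff)
  qed
  ultimately show ?thesis
    unfolding power_dual_def coord_measure_def
    by (intro exI[of _ T] conjI exI[of _ "fact k"]) auto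
qed

lemma power_dual_exists: "\<exists>T. power_dual G k T"
  using power_dual_gaussian power_dual_poisson by (cases G) auto

section \<open>The product base measure\<close>

lemma lik_eq_prod: "lik B \<theta> x = (\<Prod>l\<in>UNIV. coord_density (l \<in> B) (\<theta> $ l) (x $ l))"
  unfolding lik_def coord_density_def by (rule prod.cong) auto

lemma lik_pos: "\<theta> \<in> param_space B \<Longrightarrow> 0 < lik B \<theta> x"
  unfolding lik_eq_prod param_space_def by (intro prod_pos ballI coord_density_pos) auto

lemma measurable_coord_measure: "f \<in> borel_measurable borel \<Longrightarrow> f \<in> borel_measurable (coord_measure G)"
  by (simp add: coord_measure_def)

lemma measurable_vec_lambda_coord:
  "vec_lambda \<in> (PiM UNIV (\<lambda>l::'d::finite. coord_measure (l \<in> B))) \<rightarrow>\<^sub>M borel"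
proof (subst borel_measurable_euclidean_space, intro ballI)
  fix b :: "real ^ 'd" assume "b \<in> Basis"
  then obtain l where b: "b = axis l 1" by (auto simp: Basis_vec_def)
  have "(\<lambda>f. f l) \<in> PiM UNIV (\<lambda>l. coord_measure (l \<in> B)) \<rightarrow>\<^sub>M coord_measure (l \<in> B)"
    by (rule measurable_component_singleton) simp
  moreover have "(\<lambda>x. x) \<in> coord_measure (l \<in> B) \<rightarrow>\<^sub>M borel"
    by (rule measurable_coord_measure) simp
  ultimately have "(\<lambda>f. f l) \<in> borel_measurable (PiM UNIV (\<lambda>l. coord_measure (l \<in> B)))"
    by (rule measurable_compose)
  then show "(\<lambda>f. vec_lambda f \<bullet> b) \<in> borel_measurable (PiM UNIV (\<lambda>l. coord_measure (l \<in> B)))"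
    by (simp add: b inner_axis)
qed

lemma base_measure_eq:
  "base_measure B = distr (PiM UNIV (\<lambda>l. coord_measure (l \<in> B))) borel vec_lambda"
  unfolding base_measure_def coord_measure_def ..

lemma sets_base_measure [measurable_cong, simp]: "sets (base_measure B) = sets borel"
  by (simp add: base_measure_def)

lemma product_sigma_finite_coord: "product_sigma_finite (\<lambda>l. coord_measure (l \<in> B))"
proof (rule product_sigma_finite.intro)
  fix l
  show "sigma_finite_measure (coord_measure (l \<in> B))"
    by (auto simp: coord_measure_def Nats_def intro!: sigma_finite_measure_count_space_countable
        lborel.sigma_finite_measure_axioms)
qed

lemma base_measure_integral_prod:
  fixes f :: "'d::finite \<Rightarrow> real \<Rightarrow> real"
  assumes [measurable]: "\<And>l. f l \<in> borel_measurable borel"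
    and int: "\<And>l. integrable (coord_measure (l \<in> B)) (f l)"
  shows "has_bochner_integral (base_measure B) (\<lambda>x. \<Prod>l\<in>UNIV. f l (x $ l))
           (\<Prod>l\<in>UNIV. integral\<^sup>L (coord_measure (l \<in> B)) (f l))"
proof -
  interpret product_sigma_finite "\<lambda>l. coord_measure (l \<in> B)" by (rule product_sigma_finite_coord)
  have [measurable]: "(\<lambda>x::real^'d. \<Prod>l\<in>UNIV. f l (x $ l)) \<in> borel_measurable borel" by measurable
  have "integrable (PiM UNIV (\<lambda>l. coord_measure (l \<in> B))) (\<lambda>x. \<Prod>l\<in>UNIV. f l (x l))"
    by (intro product_integrable_prod int) auto
  moreover have "(\<integral>x. (\<Prod>l\<in>UNIV. f l (x l)) \<partial>(PiM UNIV (\<lambda>l. coord_measure (l \<in> B)))) =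
      (\<Prod>l\<in>UNIV. integral\<^sup>L (coord_measure (l \<in> B)) (f l))"
    by (intro product_integral_prod int) auto
  ultimately show ?thesis
    unfolding has_bochner_integral_iff base_measure_eq
    by (simp add: integrable_distr_eq[OF measurable_vec_lambda_coord]
        integral_distr[OF measurable_vec_lambda_coord])
qed

text \<open>
  Up to constants, all envelopes below are bounded by such weights, which are integrable against
  every density of the model.
\<close>

definition exp_weight :: "real \<Rightarrow> real ^ 'd::finite \<Rightarrow> real" where
  "exp_weight K x = exp (K * (\<Sum>l\<in>UNIV. \<bar>x $ l\<bar>))"

lemma exp_weight_prod: "exp_weight K x = (\<Prod>l\<in>UNIV. exp (K * \<bar>x $ l\<bar>))"
  by (simp add: exp_weight_def exp_sum sum_distrib_left)

lemma measurable_exp_weight [measurable]: "exp_weight K \<in> borel_measurable borel"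
  unfolding exp_weight_def by measurable

lemma measurable_coord_density [measurable]: "coord_density G t \<in> borel_measurable borel"
  unfolding coord_density_def by (cases G) measurable

lemma integrable_exp_weight_lik:
  assumes "\<theta> \<in> param_space B"
  shows "integrable (base_measure B) (\<lambda>x. exp_weight K x * lik B \<theta> x)"
proof -
  have "has_bochner_integral (base_measure B)
      (\<lambda>x. \<Prod>l\<in>UNIV. exp (K * \<bar>x $ l\<bar>) * coord_density (l \<in> B) (\<theta> $ l) (x $ l))
      (\<Prod>l\<in>UNIV. \<integral>x. exp (K * \<bar>x\<bar>) * coord_density (l \<in> B) (\<theta> $ l) x \<partial>coord_measure (l \<in> B))"
    using assms
    by (intro base_measure_integral_prod integrable_exp_coord_density) (auto simp: param_space_def)
  then show ?thesis
    by (simp add: has_bochner_integral_iff exp_weight_prod lik_eq_prod prod.distrib)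
qed

lemma lik_integral:
  assumes "\<theta> \<in> param_space B"
  shows "has_bochner_integral (base_measure B) (lik B \<theta>) 1"
proof -
  have one: "has_bochner_integral (coord_measure (l \<in> B)) (coord_density (l \<in> B) (\<theta> $ l)) 1" for l
    using assms by (intro coord_density_integral) (auto simp: param_space_def)
  have "has_bochner_integral (base_measure B) (\<lambda>x. \<Prod>l\<in>UNIV. coord_density (l \<in> B) (\<theta> $ l) (x $ l))
      (\<Prod>l\<in>UNIV. integral\<^sup>L (coord_measure (l \<in> B)) (coord_density (l \<in> B) (\<theta> $ l)))"
    using one by (intro base_measure_integral_prod) (auto simp: has_bochner_integral_iff)
  then show ?thesis
    using one by (simp add: has_bochner_integral_iff lik_eq_prod[abs_def])
qed

section \<open>Multi-indices and the series of the likelihood\<close>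

text \<open>
  Telescoping of a difference of products, rescaled so that \<open>norm_prod_diff\<close> applies to factors of
  absolute value at most 1.
\<close>

lemma prod_abs_diff_le:
  fixes z w D E :: "'i \<Rightarrow> real"
  assumes "\<And>i. i \<in> I \<Longrightarrow> 0 < D i" "1 \<le> H"
    and "\<And>i. i \<in> I \<Longrightarrow> \<bar>z i\<bar> \<le> D i * H" "\<And>i. i \<in> I \<Longrightarrow> \<bar>w i\<bar> \<le> D i * H"
    and "\<And>i. i \<in> I \<Longrightarrow> \<bar>z i - w i\<bar> \<le> D i * E i"
  shows "\<bar>(\<Prod>i\<in>I. z i) - (\<Prod>i\<in>I. w i)\<bar> \<le> (\<Prod>i\<in>I. D i) * H ^ card I * (\<Sum>i\<in>I. E i)"
proof -
  let ?n = "\<lambda>i. D i * H"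
  have pos: "0 < ?n i" if "i \<in> I" for i using assms(1)[OF that] assms(2) by simp
  have E: "0 \<le> E i" if "i \<in> I" for i
    using assms(5)[OF that] assms(1)[OF that]
    by (metis abs_ge_zero mult_le_cancel_left_pos mult_zero_right order_trans)
  have "norm ((\<Prod>i\<in>I. z i / ?n i) - (\<Prod>i\<in>I. w i / ?n i)) \<le> (\<Sum>i\<in>I. norm (z i / ?n i - w i / ?n i))"
  proof (intro norm_prod_diff)
    show "norm (z i / ?n i) \<le> 1" "norm (w i / ?n i) \<le> 1" if "i \<in> I" for i
      using assms(3,4)[OF that] pos[OF that] by (simp_all only: real_norm_def abs_div_pos[symmetric] divide_le_eq_1_pos)
  qed
  also have "\<dots> \<le> (\<Sum>i\<in>I. E i)"
  proof (rule sum_mono)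
    fix i assume i: "i \<in> I"
    have "norm (z i / ?n i - w i / ?n i) = \<bar>z i - w i\<bar> / ?n i"
      using pos[OF i] by (simp only: real_norm_def diff_divide_distrib[symmetric] abs_div_pos)
    also have "\<dots> \<le> D i * E i / (D i * H)"
      using pos[OF i] assms(5)[OF i] by (intro divide_right_mono) auto
    also have "\<dots> \<le> E i"
      using assms(1)[OF i] assms(2) E[OF i] by (simp add: divide_le_eq mult_le_cancel_left1)
    finally show "norm (z i / ?n i - w i / ?n i) \<le> E i" .
  qed
  finally have le: "\<bar>(\<Prod>i\<in>I. z i / ?n i) - (\<Prod>i\<in>I. w i / ?n i)\<bar> \<le> (\<Sum>i\<in>I. E i)" by simp
  have P: "0 < (\<Prod>i\<in>I. ?n i)" using pos by (intro prod_pos) auto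
  have "(\<Prod>i\<in>I. z i / ?n i) - (\<Prod>i\<in>I. w i / ?n i) = ((\<Prod>i\<in>I. z i) - (\<Prod>i\<in>I. w i)) / (\<Prod>i\<in>I. ?n i)"
    by (simp only: prod_dividef diff_divide_distrib)
  with le have "\<bar>(\<Prod>i\<in>I. z i) - (\<Prod>i\<in>I. w i)\<bar> / (\<Prod>i\<in>I. ?n i) \<le> (\<Sum>i\<in>I. E i)"
    by (simp only: abs_div_pos[OF P])
  with P have "\<bar>(\<Prod>i\<in>I. z i) - (\<Prod>i\<in>I. w i)\<bar> \<le> (\<Prod>i\<in>I. ?n i) * (\<Sum>i\<in>I. E i)"
    by (simp only: pos_divide_le_eq mult.commute)
  then show ?thesis by (simp add: prod.distrib)
qed

definition monomial :: "('d::finite \<Rightarrow> nat) \<Rightarrow> real ^ 'd \<Rightarrow> real" where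
  "monomial \<beta> \<theta> = (\<Prod>l\<in>UNIV. \<theta> $ l ^ \<beta> l)"

text \<open>
  Series over multi-indices are treated as limits of sums over these boxes: a product of partial
  sums over the coordinates is such a sum.
\<close>

definition degree_box :: "nat \<Rightarrow> ('d::finite \<Rightarrow> nat) set" where
  "degree_box N = PiE UNIV (\<lambda>_. {..<N})"

lemma finite_degree_box [simp, intro]: "finite (degree_box N)"
  by (simp add: degree_box_def finite_PiE)

lemma degree_box_iff: "\<beta> \<in> degree_box N \<longleftrightarrow> (\<forall>l. \<beta> l < N)"
  by (auto simp: degree_box_def PiE_def Pi_def)

lemma prod_sum_degree_box:
  fixes f :: "'d::finite \<Rightarrow> nat \<Rightarrow> real"
  shows "(\<Prod>l\<in>UNIV. \<Sum>k<N. f l k) = (\<Sum>\<alpha>\<in>degree_box N. \<Prod>l\<in>UNIV. f l (\<alpha> l))"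
  unfolding degree_box_def by (rule prod_sum_PiE) auto

lemma measurable_monomial [measurable]: "monomial \<beta> \<in> borel_measurable borel"
  unfolding monomial_def by measurable

lemma mixing_dists_prob: "g \<in> mixing_dists \<Theta> \<Longrightarrow> prob_space g"
  by (simp add: mixing_dists_def)

lemma mixing_dists_space: "g \<in> mixing_dists \<Theta> \<Longrightarrow> space g = \<Theta>"
  using sets_eq_imp_space_eq[of g "restrict_space borel \<Theta>"]
  by (simp add: mixing_dists_def space_restrict_space)

lemma mixing_dists_measurable:
  assumes "g \<in> mixing_dists \<Theta>" "f \<in> borel \<rightarrow>\<^sub>M N"
  shows "f \<in> g \<rightarrow>\<^sub>M N"
proof -
  have "f \<in> restrict_space borel \<Theta> \<rightarrow>\<^sub>M N"
    by (rule measurable_restrict_space1) fact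
  moreover have "measurable g N = measurable (restrict_space borel \<Theta>) N"
    using assms(1) by (intro measurable_cong_sets) (simp_all add: mixing_dists_def)
  ultimately show ?thesis by simp
qed

lemma mixing_dists_integrable:
  fixes f :: "real ^ 'd::finite \<Rightarrow> 'b::{banach, second_countable_topology}"
  assumes "g \<in> mixing_dists \<Theta>" "f \<in> borel_measurable borel"
    and "\<And>\<theta>. \<theta> \<in> \<Theta> \<Longrightarrow> norm (f \<theta>) \<le> K"
  shows "integrable g f"
proof -
  interpret prob_space g by (rule mixing_dists_prob[OF assms(1)])
  show ?thesis
  proof (rule integrable_const_bound[where B=K])
    show "AE \<theta> in g. norm (f \<theta>) \<le> K"
      using assms(3) by (intro AE_I2) (simp add: mixing_dists_space[OF assms(1)])
  qed (rule mixing_dists_measurable[OF assms(1,2)])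
qed

text \<open>
  One constant serves as factor and as rate, since both may be enlarged; this makes the class
  visibly closed under sums and products.
\<close>

definition exp_bounded :: "(real ^ 'd::finite \<Rightarrow> real) \<Rightarrow> bool" where
  "exp_bounded f \<longleftrightarrow> (\<exists>K\<ge>0. \<forall>x. \<bar>f x\<bar> \<le> K * exp_weight K x)"

lemma exp_weight_pos: "0 < exp_weight K x"
  by (simp add: exp_weight_def)

lemma exp_weight_mono: "K \<le> L \<Longrightarrow> exp_weight K x \<le> exp_weight L x"
  by (auto simp: exp_weight_def intro!: mult_right_mono sum_nonneg)

lemma exp_weight_mult: "exp_weight K x * exp_weight L x = exp_weight (K + L) x"
  by (simp add: exp_weight_def exp_add[symmetric] distrib_right)

lemma exp_boundedI:
  fixes f :: "real ^ 'd::finite \<Rightarrow> real"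
  assumes "\<And>x. \<bar>f x\<bar> \<le> C * exp_weight K x"
  shows "exp_bounded f"
  unfolding exp_bounded_def
proof (intro exI[of _ "\<bar>C\<bar> + \<bar>K\<bar>"] conjI allI)
  fix x :: "real ^ 'd"
  have "\<bar>f x\<bar> \<le> C * exp_weight K x" by (rule assms)
  also have "C * exp_weight K x \<le> (\<bar>C\<bar> + \<bar>K\<bar>) * exp_weight (\<bar>C\<bar> + \<bar>K\<bar>) x"
    by (intro mult_mono exp_weight_mono) (auto simp: exp_weight_pos less_imp_le)
  finally show "\<bar>f x\<bar> \<le> (\<bar>C\<bar> + \<bar>K\<bar>) * exp_weight (\<bar>C\<bar> + \<bar>K\<bar>) x" .
qed auto

lemma exp_bounded_const: "exp_bounded (\<lambda>_. c)"
  by (rule exp_boundedI[where C = "\<bar>c\<bar>" and K = 0]) (simp add: exp_weight_def)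

lemma exp_bounded_mult:
  assumes "exp_bounded f" "exp_bounded h"
  shows "exp_bounded (\<lambda>x. f x * h x)"
proof -
  obtain K L where "0 \<le> K" "\<And>x. \<bar>f x\<bar> \<le> K * exp_weight K x" "0 \<le> L" "\<And>x. \<bar>h x\<bar> \<le> L * exp_weight L x"
    using assms unfolding exp_bounded_def by blast
  then have "\<bar>f x * h x\<bar> \<le> (K * L) * exp_weight (K + L) x" for x
    unfolding abs_mult exp_weight_mult[symmetric]
    using mult_mono[of "\<bar>f x\<bar>" "K * exp_weight K x" "\<bar>h x\<bar>" "L * exp_weight L x"]
    by (simp add: mult_ac exp_weight_pos less_imp_le)
  then show ?thesis by (rule exp_boundedI)
qed

lemma exp_bounded_add:
  assumes "exp_bounded f" "exp_bounded h"
  shows "exp_bounded (\<lambda>x. f x + h x)"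
proof -
  obtain K L where K: "0 \<le> K" "\<And>x. \<bar>f x\<bar> \<le> K * exp_weight K x"
    and L: "0 \<le> L" "\<And>x. \<bar>h x\<bar> \<le> L * exp_weight L x"
    using assms unfolding exp_bounded_def by blast
  have "\<bar>f x + h x\<bar> \<le> (K + L) * exp_weight (K + L) x" for x
  proof -
    have "\<bar>f x + h x\<bar> \<le> K * exp_weight K x + L * exp_weight L x"
      using K(2)[of x] L(2)[of x] by linarith
    also have "\<dots> \<le> K * exp_weight (K + L) x + L * exp_weight (K + L) x"
      using K(1) L(1) by (intro add_mono mult_left_mono exp_weight_mono) auto
    finally show ?thesis by (simp add: distrib_right)
  qed
  then show ?thesis by (rule exp_boundedI)
qed

lemma exp_bounded_abs: "exp_bounded f \<Longrightarrow> exp_bounded (\<lambda>x. \<bar>f x\<bar>)"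
  by (simp add: exp_bounded_def)

text \<open>
  Products of the one-dimensional unbiased estimators recover the moments of a mixing distribution
  from the mixture density.
\<close>

lemma monomial_dual_exists:
  fixes B :: "'d::finite set"
  shows "\<exists>T. T \<in> borel_measurable borel \<and> exp_bounded T \<and>
    (\<forall>\<theta>\<in>param_space B. has_bochner_integral (base_measure B) (\<lambda>x. T x * lik B \<theta> x) (monomial \<beta> \<theta>))"
proof -
  have "\<forall>l. \<exists>T. power_dual (l \<in> B) (\<beta> l) T" by (intro allI power_dual_exists)
  then obtain T where T: "\<And>l. power_dual (l \<in> B) (\<beta> l) (T l)" by metis
  then obtain K where K: "\<And>l. 0 \<le> K l" "\<And>l x. \<bar>T l x\<bar> \<le> K l * exp \<bar>x\<bar>"
    unfolding power_dual_def by metis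
  have [measurable]: "T l \<in> borel_measurable borel" for l
    using T[of l] by (simp add: power_dual_def)
  define U where "U x = (\<Prod>l\<in>UNIV. T l (x $ l))" for x :: "real ^ 'd"
  have "\<bar>U x\<bar> \<le> (\<Prod>l\<in>UNIV. K l) * exp_weight 1 x" for x
    unfolding U_def abs_prod exp_weight_prod prod.distrib[symmetric]
    by (intro prod_mono) (use K(2) in auto)
  then have "exp_bounded U" by (rule exp_boundedI)
  moreover have "U \<in> borel_measurable borel" unfolding U_def by measurable
  moreover have "has_bochner_integral (base_measure B) (\<lambda>x. U x * lik B \<theta> x) (monomial \<beta> \<theta>)"
    if "\<theta> \<in> param_space B" for \<theta>
  proof -
    have T': "has_bochner_integral (coord_measure (l \<in> B))
        (\<lambda>x. T l x * coord_density (l \<in> B) (\<theta> $ l) x) (\<theta> $ l ^ \<beta> l)" for l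
      using T[of l] that by (simp add: power_dual_def param_space_def)
    have "has_bochner_integral (base_measure B)
        (\<lambda>x. \<Prod>l\<in>UNIV. T l (x $ l) * coord_density (l \<in> B) (\<theta> $ l) (x $ l))
        (\<Prod>l\<in>UNIV. \<integral>x. T l x * coord_density (l \<in> B) (\<theta> $ l) x \<partial>coord_measure (l \<in> B))"
      using T' by (intro base_measure_integral_prod) (auto simp: has_bochner_integral_iff)
    also have "(\<Prod>l\<in>UNIV. \<integral>x. T l x * coord_density (l \<in> B) (\<theta> $ l) x \<partial>coord_measure (l \<in> B)) = monomial \<beta> \<theta>"
      unfolding monomial_def using T' by (intro prod.cong) (auto simp: has_bochner_integral_iff)
    finally show ?thesis by (simp add: U_def lik_eq_prod prod.distrib)
  qed
  ultimately show ?thesis by blast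
qed

definition basis_fun :: "'d::finite set \<Rightarrow> ('d \<Rightarrow> nat) \<Rightarrow> real ^ 'd \<Rightarrow> real" where
  "basis_fun B \<alpha> x = (\<Prod>l\<in>UNIV. coord_coeff (l \<in> B) (\<alpha> l) (x $ l))"

definition tilted_monomial :: "'d::finite set \<Rightarrow> ('d \<Rightarrow> nat) \<Rightarrow> real ^ 'd \<Rightarrow> real" where
  "tilted_monomial B \<alpha> \<theta> = (\<Prod>l\<in>UNIV. tilted_power (l \<in> B) (\<alpha> l) (\<theta> $ l))"

abbreviation total_degree :: "('d::finite \<Rightarrow> nat) \<Rightarrow> nat" where
  "total_degree \<alpha> \<equiv> \<Sum>l\<in>UNIV. \<alpha> l"

lemma measurable_coord_coeff [measurable]: "coord_coeff G k \<in> borel_measurable borel"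
  unfolding coord_coeff_def by (cases G) measurable

lemma measurable_tilted_power [measurable]: "tilted_power G k \<in> borel_measurable borel"
  unfolding tilted_power_def by measurable

lemma measurable_basis_fun [measurable]: "basis_fun B \<alpha> \<in> borel_measurable borel"
  unfolding basis_fun_def by measurable

lemma measurable_tilted_monomial [measurable]: "tilted_monomial B \<alpha> \<in> borel_measurable borel"
  unfolding tilted_monomial_def by measurable

lemma lik_expansion:
  "(\<lambda>N. \<Sum>\<alpha>\<in>degree_box N. tilted_monomial B \<alpha> \<theta> * basis_fun B \<alpha> x) \<longlonglongrightarrow> lik B \<theta> x"
proof -
  have "(\<lambda>N. \<Prod>l\<in>UNIV. \<Sum>k<N. tilted_power (l \<in> B) k (\<theta> $ l) * coord_coeff (l \<in> B) k (x $ l))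
      \<longlonglongrightarrow> lik B \<theta> x"
    unfolding lik_eq_prod by (intro tendsto_prod coord_expansion[unfolded sums_def])
  then show ?thesis
    unfolding prod_sum_degree_box tilted_monomial_def basis_fun_def by (simp add: prod.distrib)
qed

lemma measurable_lik_param [measurable]: "(\<lambda>\<theta>. lik B \<theta> x) \<in> borel_measurable borel"
  by (rule borel_measurable_LIMSEQ_real[OF lik_expansion]) measurable

lemma measurable_lik [measurable]: "lik B \<theta> \<in> borel_measurable borel"
  by (rule borel_measurable_LIMSEQ_real[OF lik_expansion]) measurable

lemma tilted_monomial_shift:
  "tilted_monomial B (\<lambda>l. \<alpha> l + \<sigma> l) \<theta> = monomial \<sigma> \<theta> * tilted_monomial B \<alpha> \<theta>"
  unfolding tilted_monomial_def monomial_def prod.distrib[symmetric]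
  by (rule prod.cong) (auto simp: tilted_power_def power_add)

lemma sum_degree_box_geometric_le: "(\<Sum>\<alpha>\<in>degree_box N. (1 / 2) ^ total_degree (\<alpha> :: 'd::finite \<Rightarrow> nat)) \<le> (2::real) ^ CARD('d)"
proof -
  have "(\<Sum>\<alpha>\<in>degree_box N. (1 / 2) ^ total_degree (\<alpha> :: 'd \<Rightarrow> nat)) = (\<Prod>l\<in>(UNIV::'d set). \<Sum>k<N. (1 / 2 :: real) ^ k)"
    by (simp only: prod_sum_degree_box power_sum)
  also have "\<dots> \<le> (\<Prod>l\<in>(UNIV::'d set). 2)"
    by (intro prod_mono conjI sum_nonneg) (auto simp: geometric_sum)
  finally show ?thesis by simp
qed

section \<open>Finitely many moments control the mixing distribution\<close>

text \<open>
  \<open>S\<close> contains the atoms of \<open>g0\<close>, and \<open>R\<close> bounds the coordinates of all parameters.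
\<close>

locale finite_mixture =
  fixes B :: "'d::finite set" and \<Theta> :: "(real ^ 'd) set" and g0 :: "(real ^ 'd) measure"
    and S :: "(real ^ 'd) set" and R :: real
  assumes param: "\<Theta> \<subseteq> param_space B"
    and radius: "\<And>\<theta> l. \<theta> \<in> \<Theta> \<Longrightarrow> \<bar>\<theta> $ l\<bar> \<le> R"
    and R_ge1: "1 \<le> R"
    and g0: "g0 \<in> mixing_dists \<Theta>"
    and finite_S: "finite S" and S_sub: "S \<subseteq> \<Theta>"
    and AE_S: "AE \<theta> in g0. \<theta> \<in> S"
begin

abbreviation m :: nat where "m \<equiv> 2 * card S"

text \<open>
  Of degree \<open>m\<close> and zero at the atoms. The squares make it nonnegative, so that it can bound the
  error of a division.
\<close>

definition node_poly :: "'d \<Rightarrow> real \<Rightarrow> real" where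
  "node_poly l t = (\<Prod>s\<in>S. (t - s $ l)\<^sup>2)"

text \<open>
  The integral against the signed measure \<open>g - g0\<close>.
\<close>

definition discrepancy :: "(real ^ 'd) measure \<Rightarrow> (real ^ 'd \<Rightarrow> real) \<Rightarrow> real" where
  "discrepancy g f = (\<integral>\<theta>. f \<theta> \<partial>g) - (\<integral>\<theta>. f \<theta> \<partial>g0)"

text \<open>
  The degree \<open>m\<close> is included because the leading term of \<open>node_poly\<close> has it.
\<close>

definition moment_gap :: "(real ^ 'd) measure \<Rightarrow> real" where
  "moment_gap g = (\<Sum>\<beta>\<in>degree_box (Suc m). \<bar>discrepancy g (monomial \<beta>)\<bar>)"

lemma moment_gap_nonneg: "0 \<le> moment_gap g"
  by (simp add: moment_gap_def sum_nonneg)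

lemma discrepancy_monomial_le: "\<beta> \<in> degree_box (Suc m) \<Longrightarrow> \<bar>discrepancy g (monomial \<beta>)\<bar> \<le> moment_gap g"
  unfolding moment_gap_def by (rule member_le_sum) auto

lemma S_nonempty: "S \<noteq> {}"
proof
  assume "S = {}"
  with AE_S have "AE \<theta> in g0. False" by simp
  then show False
    using prob_space.AE_False[OF mixing_dists_prob[OF g0]] by simp
qed

lemma m_pos: "0 < m"
  using S_nonempty finite_S by (simp add: card_gt_0_iff)

lemma node_poly_nonneg: "0 \<le> node_poly l t"
  unfolding node_poly_def by (intro prod_nonneg) auto

lemma node_poly_S: "\<theta> \<in> S \<Longrightarrow> node_poly l (\<theta> $ l) = 0"
  using finite_S by (auto simp: node_poly_def intro!: prod_zero)

lemma measurable_node_poly [measurable]: "node_poly l \<in> borel_measurable borel"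
  unfolding node_poly_def by measurable

lemma node_poly_le:
  assumes "\<bar>t\<bar> \<le> R"
  shows "node_poly l t \<le> ((2 * R)\<^sup>2) ^ card S"
proof -
  have "(t - s $ l)\<^sup>2 \<le> (2 * R)\<^sup>2" if "s \<in> S" for s
  proof -
    have "\<bar>t - s $ l\<bar> \<le> \<bar>2 * R\<bar>"
      using radius[of s l] S_sub that assms R_ge1 by auto
    then show ?thesis by (simp add: abs_le_square_iff)
  qed
  then have "node_poly l t \<le> (\<Prod>s\<in>S. (2 * R)\<^sup>2)"
    unfolding node_poly_def by (intro prod_mono) auto
  then show ?thesis by simp
qed

lemma node_poly_expansion:
  obtains p c where "\<And>l t. node_poly l t = t ^ m + (\<Sum>i<m. p l i * t ^ i)"
    "\<And>l i. i < m \<Longrightarrow> \<bar>p l i\<bar> \<le> c" "0 \<le> c"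
proof -
  have "\<forall>l. \<exists>p. \<forall>t. node_poly l t = t ^ m + (\<Sum>i<m. p i * t ^ i)"
    unfolding node_poly_def by (intro allI prod_squares_monic_expansion[OF finite_S])
  then obtain p where p: "\<And>l t. node_poly l t = t ^ m + (\<Sum>i<m. p l i * t ^ i)" by metis
  show ?thesis
  proof (rule that[OF p, of "\<Sum>l\<in>UNIV. \<Sum>i<m. \<bar>p l i\<bar>"])
    fix l i assume "i < m"
    then have "\<bar>p l i\<bar> \<le> (\<Sum>i<m. \<bar>p l i\<bar>)"
      by (intro member_le_sum[where f = "\<lambda>i. \<bar>p l i\<bar>"]) auto
    also have "\<dots> \<le> (\<Sum>l\<in>UNIV. \<Sum>i<m. \<bar>p l i\<bar>)"
      by (intro member_le_sum[where f = "\<lambda>l. \<Sum>i<m. \<bar>p l i\<bar>"]) (auto intro: sum_nonneg)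
    finally show "\<bar>p l i\<bar> \<le> (\<Sum>l\<in>UNIV. \<Sum>i<m. \<bar>p l i\<bar>)" .
  qed (intro sum_nonneg, auto)
qed

lemma tilted_power_remainder_bound:
  obtains A D where "1 \<le> A" "0 < D"
    "\<And>l k. remainder_bound m (node_poly l) R (tilted_power (l \<in> B) k) (D * A ^ k)"
proof -
  obtain p c where p: "\<And>l t. node_poly l t = t ^ m + (\<Sum>i<m. p l i * t ^ i)"
    "\<And>l i. i < m \<Longrightarrow> \<bar>p l i\<bar> \<le> c" "0 \<le> c" by (rule node_poly_expansion) blast
  define A where "A = 1 + c + R"
  have A: "1 \<le> A" using p(3) R_ge1 by (simp add: A_def)
  have "remainder_bound m (node_poly l) R (tilted_power (l \<in> B) k) (exp (A ^ 2) * A ^ k)" for l k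
  proof (rule remainder_bound_mono[OF _ _ node_poly_nonneg])
    let ?s = "if l \<in> B then - 1 / 2 else - 1 :: real" and ?q = "if l \<in> B then 2 else 1 :: nat"
    show "remainder_bound m (node_poly l) R (tilted_power (l \<in> B) k) (A ^ k * exp (\<bar>?s\<bar> * A ^ ?q))"
      unfolding A_def tilted_power_def
      by (rule remainder_bound_power_exp[OF p(1) node_poly_nonneg p(2)])
         (use R_ge1 p(3) m_pos in auto)
    have "\<bar>?s\<bar> * A ^ ?q \<le> A ^ 2"
      using A by (auto simp: power2_eq_square mult_le_cancel_left1)
    then show "A ^ k * exp (\<bar>?s\<bar> * A ^ ?q) \<le> exp (A ^ 2) * A ^ k"
      using A by simp
  qed
  with A show ?thesis by (intro that[of A "exp (A ^ 2)"]) auto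
qed

lemma discrepancy_sum:
  assumes "g \<in> mixing_dists \<Theta>" "\<And>i. i \<in> I \<Longrightarrow> f i \<in> borel_measurable borel"
    and "\<And>i \<theta>. i \<in> I \<Longrightarrow> \<theta> \<in> \<Theta> \<Longrightarrow> \<bar>f i \<theta>\<bar> \<le> K i"
  shows "discrepancy g (\<lambda>\<theta>. \<Sum>i\<in>I. c i * f i \<theta>) = (\<Sum>i\<in>I. c i * discrepancy g (f i))"
proof -
  have "integrable g' (f i)" if "i \<in> I" "g' \<in> mixing_dists \<Theta>" for g' i
    using assms(2,3) that by (intro mixing_dists_integrable[where K = "K i"]) auto
  then show ?thesis
    using assms(1) g0 unfolding discrepancy_def
    by (simp add: sum_subtractf right_diff_distrib)
qed

lemma monomial_bound: "\<theta> \<in> \<Theta> \<Longrightarrow> \<bar>monomial \<beta> \<theta>\<bar> \<le> (\<Prod>l\<in>UNIV. R ^ \<beta> l)"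
  unfolding monomial_def abs_prod power_abs by (intro prod_mono) (simp add: power_mono radius)

text \<open>
  The integral against \<open>g0\<close> is zero, so the integral against \<open>g\<close> is a combination of moments of
  \<open>g - g0\<close>.
\<close>

lemma integral_node_poly_le:
  obtains C where "0 \<le> C"
    "\<And>g l. g \<in> mixing_dists \<Theta> \<Longrightarrow> (\<integral>\<theta>. node_poly l (\<theta> $ l) \<partial>g) \<le> C * moment_gap g"
proof -
  obtain p c where p: "\<And>l t. node_poly l t = t ^ m + (\<Sum>i<m. p l i * t ^ i)"
    "\<And>l i. i < m \<Longrightarrow> \<bar>p l i\<bar> \<le> c" "0 \<le> c" by (rule node_poly_expansion) blast
  show ?thesis
  proof (rule that[of "(\<Sum>i<Suc m. 1 + c)"])
    fix g l assume g: "g \<in> mixing_dists \<Theta>"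
    define q where "q i = (if i = m then 1 else p l i)" for i
    \<comment> \<open>the exponent of the power \<open>\<theta> $ l ^ i\<close> of a single coordinate\<close>
    define e where "e i = (\<lambda>l'. if l' = l then i else 0 :: nat)" for i
    have mono: "monomial (e i) \<theta> = \<theta> $ l ^ i" for i \<theta>
      unfolding monomial_def e_def by (simp add: if_distrib[of "\<lambda>k. _ ^ k"] cong: if_cong)
    have "(\<integral>\<theta>. node_poly l (\<theta> $ l) \<partial>g0) = (\<integral>\<theta>. 0 \<partial>g0)"
      by (rule integral_cong_AE) (use AE_S in \<open>auto simp: node_poly_S intro: mixing_dists_measurable[OF g0]\<close>)
    then have "(\<integral>\<theta>. node_poly l (\<theta> $ l) \<partial>g) = discrepancy g (\<lambda>\<theta>. node_poly l (\<theta> $ l))"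
      by (simp add: discrepancy_def)
    also have "\<dots> = discrepancy g (\<lambda>\<theta>. \<Sum>i<Suc m. q i * monomial (e i) \<theta>)"
      by (rule arg_cong[where f = "discrepancy g"], rule ext) (simp add: p(1) mono q_def)
    also have "\<dots> = (\<Sum>i<Suc m. q i * discrepancy g (monomial (e i)))"
      by (rule discrepancy_sum[OF g _ monomial_bound]) auto
    also have "\<dots> \<le> (\<Sum>i<Suc m. (1 + c) * moment_gap g)"
    proof (rule sum_mono)
      fix i assume i: "i \<in> {..<Suc m}"
      have "q i * discrepancy g (monomial (e i)) \<le> \<bar>q i\<bar> * \<bar>discrepancy g (monomial (e i))\<bar>"
        by (metis abs_ge_self abs_mult)
      also have "\<dots> \<le> (1 + c) * moment_gap g"
        using i p(2)[of i l] p(3)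
        by (intro mult_mono discrepancy_monomial_le) (auto simp: q_def e_def degree_box_iff)
      finally show "q i * discrepancy g (monomial (e i)) \<le> (1 + c) * moment_gap g" .
    qed
    finally show "(\<integral>\<theta>. node_poly l (\<theta> $ l) \<partial>g) \<le> (\<Sum>i<Suc m. 1 + c) * moment_gap g"
      by (simp only: sum_distrib_right)
  qed (use p(3) in \<open>intro sum_nonneg, auto\<close>)
qed

text \<open>
  Every factor is replaced by its remainder modulo the node polynomial. The product of the
  remainders is a polynomial whose moments enter \<open>moment_gap\<close>. The error is at most a multiple of
  the sum of the node polynomials: it vanishes on the atoms of \<open>g0\<close>, and its integral against \<open>g\<close>
  is bounded by \<open>integral_node_poly_le\<close>.
\<close>

lemma discrepancy_prod_le:
  obtains C where "0 \<le> C"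
    "\<And>g \<psi> D. g \<in> mixing_dists \<Theta> \<Longrightarrow> (\<And>l. \<psi> l \<in> borel_measurable borel) \<Longrightarrow> (\<And>l. 0 < D l) \<Longrightarrow>
       (\<And>l. remainder_bound m (node_poly l) R (\<psi> l) (D l)) \<Longrightarrow>
       \<bar>discrepancy g (\<lambda>\<theta>. \<Prod>l\<in>UNIV. \<psi> l (\<theta> $ l))\<bar> \<le> C * (\<Prod>l\<in>UNIV. D l) * moment_gap g"
proof -
  obtain C where C: "0 \<le> C"
    "\<And>g l. g \<in> mixing_dists \<Theta> \<Longrightarrow> (\<integral>\<theta>. node_poly l (\<theta> $ l) \<partial>g) \<le> C * moment_gap g"
    by (rule integral_node_poly_le) blast
  define K where "K = (\<Sum>i<m. R ^ i)"
  \<comment> \<open>\<open>D l * H\<close> bounds the factor \<open>\<psi> l\<close> as well as its remainder\<close>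
  define H where "H = 1 + K + ((2 * R)\<^sup>2) ^ card S"
  have K: "0 \<le> K" using R_ge1 by (auto simp: K_def intro!: sum_nonneg)
  have H: "1 \<le> H" using K by (simp add: H_def)
  let ?d = "CARD('d)"
  show ?thesis
  proof (rule that[of "1 + H ^ ?d * (real ?d * C)"])
    show "0 \<le> 1 + H ^ ?d * (real ?d * C)" using H C(1) by simp
    fix g \<psi> D
    assume g: "g \<in> mixing_dists \<Theta>" and [measurable]: "\<And>l. \<psi> l \<in> borel_measurable borel"
      and D: "\<And>l. 0 < D l" and rb: "\<And>l. remainder_bound m (node_poly l) R (\<psi> l) (D l)"
    have "\<forall>l. \<exists>a. (\<forall>i<m. \<bar>a i\<bar> \<le> D l) \<and>
        (\<forall>t. \<bar>t\<bar> \<le> R \<longrightarrow> \<bar>\<psi> l t - (\<Sum>i<m. a i * t ^ i)\<bar> \<le> D l * node_poly l t)"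
      using rb unfolding remainder_bound_def by blast
    then obtain a where a: "\<And>l i. i < m \<Longrightarrow> \<bar>a l i\<bar> \<le> D l"
      and err: "\<And>l t. \<bar>t\<bar> \<le> R \<Longrightarrow> \<bar>\<psi> l t - (\<Sum>i<m. a l i * t ^ i)\<bar> \<le> D l * node_poly l t"
      by metis
    define q where "q l t = (\<Sum>i<m. a l i * t ^ i)" for l t
    have [measurable]: "q l \<in> borel_measurable borel" for l unfolding q_def by measurable
    have q_le: "\<bar>q l t\<bar> \<le> D l * K" if "\<bar>t\<bar> \<le> R" for l t
      unfolding q_def K_def sum_distrib_left
    proof (rule order.trans[OF sum_abs], rule sum_mono)
      fix i assume "i \<in> {..<m}"
      then show "\<bar>a l i * t ^ i\<bar> \<le> D l * R ^ i"
        unfolding abs_mult power_abs using a[of i l] D[of l] that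
        by (intro mult_mono power_mono) auto
    qed
    have q_H: "\<bar>q l t\<bar> \<le> D l * H" and psi_H: "\<bar>\<psi> l t\<bar> \<le> D l * H" if "\<bar>t\<bar> \<le> R" for l t
    proof -
      have "D l * K \<le> D l * H" using D[of l] by (simp add: H_def mult_left_mono)
      with q_le[OF that, of l] show "\<bar>q l t\<bar> \<le> D l * H" by linarith
      have "\<bar>\<psi> l t\<bar> \<le> D l * K + D l * node_poly l t"
        using q_le[OF that, of l] err[OF that, of l] unfolding q_def by linarith
      also have "\<dots> \<le> D l * K + D l * ((2 * R)\<^sup>2) ^ card S"
        using node_poly_le[OF that, of l] D[of l] by simp
      also have "\<dots> \<le> D l * H" using D[of l] by (simp add: H_def distrib_left)
      finally show "\<bar>\<psi> l t\<bar> \<le> D l * H" .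
    qed
    let ?\<psi> = "\<lambda>\<theta>. \<Prod>l\<in>UNIV. \<psi> l (\<theta> $ l)" and ?q = "\<lambda>\<theta>. \<Prod>l\<in>UNIV. q l (\<theta> $ l)"
    let ?D = "\<Prod>l\<in>UNIV. D l"
    have D_pos: "0 < ?D" using D by (intro prod_pos) auto
    have diff: "\<bar>?\<psi> \<theta> - ?q \<theta>\<bar> \<le> ?D * H ^ ?d * (\<Sum>l\<in>UNIV. node_poly l (\<theta> $ l))" if "\<theta> \<in> \<Theta>" for \<theta>
      by (rule prod_abs_diff_le) (use D H q_H psi_H err radius[OF that] in \<open>auto simp: q_def\<close>)
    have int: "integrable g' ?\<psi>" "integrable g' ?q" "\<And>l. integrable g' (\<lambda>\<theta>. node_poly l (\<theta> $ l))"
      if "g' \<in> mixing_dists \<Theta>" for g'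
    proof -
      have "norm (?\<psi> \<theta>) \<le> (\<Prod>l\<in>UNIV. D l * H)" "norm (?q \<theta>) \<le> (\<Prod>l\<in>UNIV. D l * H)"
        if "\<theta> \<in> \<Theta>" for \<theta>
        unfolding real_norm_def abs_prod by (intro prod_mono conjI abs_ge_zero psi_H q_H radius that)+
      then show "integrable g' ?\<psi>" "integrable g' ?q"
        by (intro mixing_dists_integrable[OF that]; measurable)+
      show "integrable g' (\<lambda>\<theta>. node_poly l (\<theta> $ l))" for l
        by (rule mixing_dists_integrable[OF that, where K = "((2 * R)\<^sup>2) ^ card S"])
           (use node_poly_le radius node_poly_nonneg in auto)
    qed
    have "(\<integral>\<theta>. ?\<psi> \<theta> - ?q \<theta> \<partial>g0) = (\<integral>\<theta>. 0 \<partial>g0)"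
    proof (rule integral_cong_AE)
      show "AE \<theta> in g0. ?\<psi> \<theta> - ?q \<theta> = 0"
        using AE_S
      proof eventually_elim
        case (elim \<theta>)
        with diff[of \<theta>] S_sub show ?case by (simp add: node_poly_S subset_iff)
      qed
    qed (use int[OF g0] in auto)
    then have "discrepancy g ?\<psi> = discrepancy g ?q + (\<integral>\<theta>. ?\<psi> \<theta> - ?q \<theta> \<partial>g)"
      using int[OF g] int[OF g0] by (simp add: discrepancy_def)
    moreover have "\<bar>\<integral>\<theta>. ?\<psi> \<theta> - ?q \<theta> \<partial>g\<bar> \<le> ?D * H ^ ?d * (real ?d * (C * moment_gap g))"
    proof -
      have "\<bar>\<integral>\<theta>. ?\<psi> \<theta> - ?q \<theta> \<partial>g\<bar> \<le> (\<integral>\<theta>. \<bar>?\<psi> \<theta> - ?q \<theta>\<bar> \<partial>g)"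
        by (rule integral_abs_bound)
      also have "\<dots> \<le> (\<integral>\<theta>. ?D * H ^ ?d * (\<Sum>l\<in>UNIV. node_poly l (\<theta> $ l)) \<partial>g)"
        using int[OF g] diff mixing_dists_space[OF g] by (intro integral_mono) auto
      also have "\<dots> = ?D * H ^ ?d * (\<Sum>l\<in>UNIV. \<integral>\<theta>. node_poly l (\<theta> $ l) \<partial>g)"
        using int[OF g] by simp
      also have "\<dots> \<le> ?D * H ^ ?d * (\<Sum>l::'d\<in>UNIV. C * moment_gap g)"
        using D_pos H C(2)[OF g] by (intro mult_left_mono sum_mono) auto
      finally show ?thesis by simp
    qed
    moreover have "\<bar>discrepancy g ?q\<bar> \<le> ?D * moment_gap g"
    proof -
      have "?q \<theta> = (\<Sum>\<beta>\<in>degree_box m. (\<Prod>l\<in>UNIV. a l (\<beta> l)) * monomial \<beta> \<theta>)" for \<theta>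
        unfolding q_def prod_sum_degree_box monomial_def by (simp add: prod.distrib)
      then have "discrepancy g ?q = (\<Sum>\<beta>\<in>degree_box m. (\<Prod>l\<in>UNIV. a l (\<beta> l)) * discrepancy g (monomial \<beta>))"
        by (simp only:) (rule discrepancy_sum[OF g _ monomial_bound], auto)
      also have "\<bar>\<dots>\<bar> \<le> (\<Sum>\<beta>\<in>degree_box m. ?D * \<bar>discrepancy g (monomial \<beta>)\<bar>)"
      proof (rule order.trans[OF sum_abs], rule sum_mono)
        fix \<beta> :: "'d \<Rightarrow> nat" assume "\<beta> \<in> degree_box m"
        then show "\<bar>(\<Prod>l\<in>UNIV. a l (\<beta> l)) * discrepancy g (monomial \<beta>)\<bar> \<le> ?D * \<bar>discrepancy g (monomial \<beta>)\<bar>"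
          unfolding abs_mult abs_prod using a by (intro mult_right_mono prod_mono) (auto simp: degree_box_iff)
      qed
      also have "\<dots> \<le> (\<Sum>\<beta>\<in>degree_box (Suc m). ?D * \<bar>discrepancy g (monomial \<beta>)\<bar>)"
        using D_pos by (intro sum_mono2) (auto simp: degree_box_iff less_Suc_eq)
      finally show ?thesis by (simp add: moment_gap_def sum_distrib_left)
    qed
    ultimately have "\<bar>discrepancy g ?\<psi>\<bar> \<le> ?D * moment_gap g + ?D * H ^ ?d * (real ?d * (C * moment_gap g))"
      by linarith
    also have "\<dots> = (1 + H ^ ?d * (real ?d * C)) * ?D * moment_gap g"
      by (simp only: ring_distribs mult_1 mult_ac)
    finally show "\<bar>discrepancy g ?\<psi>\<bar> \<le> (1 + H ^ ?d * (real ?d * C)) * ?D * moment_gap g" .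
  qed
qed

abbreviation f0 :: "real ^ 'd \<Rightarrow> real" where "f0 \<equiv> mix_density B g0"

lemma singleton_sets: "s \<in> \<Theta> \<Longrightarrow> {s} \<in> sets g0"
  using g0 by (auto simp: mixing_dists_def sets_restrict_space image_iff intro!: bexI[of _ "{s}"])

lemma integral_g0:
  fixes f :: "real ^ 'd \<Rightarrow> real"
  assumes "f \<in> borel_measurable borel"
  shows "(\<integral>\<theta>. f \<theta> \<partial>g0) = (\<Sum>s\<in>S. measure g0 {s} * f s)"
proof -
  interpret prob_space g0 by (rule mixing_dists_prob[OF g0])
  have s: "{s} \<in> sets g0" if "s \<in> S" for s using singleton_sets S_sub that by auto
  have "(\<integral>\<theta>. f \<theta> \<partial>g0) = (\<integral>\<theta>. (\<Sum>s\<in>S. indicator {s} \<theta> * f s) \<partial>g0)"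
  proof (rule integral_cong_AE)
    show "AE \<theta> in g0. f \<theta> = (\<Sum>s\<in>S. indicator {s} \<theta> * f s)"
      using AE_S
    proof eventually_elim
      case (elim \<theta>)
      have "(\<Sum>s\<in>S. indicator {s} \<theta> * f s) = (\<Sum>s\<in>S. if s = \<theta> then f \<theta> else 0)"
        by (intro sum.cong) (auto simp: indicator_def)
      with elim finite_S show ?case by simp
    qed
  qed (use assms s in \<open>auto intro!: mixing_dists_measurable[OF g0] borel_measurable_sum borel_measurable_times\<close>)
  also have "\<dots> = (\<Sum>s\<in>S. measure g0 {s} * f s)"
    using s by (subst Bochner_Integration.integral_sum) (auto intro!: integrable_real_indicator simp: emeasure_eq_measure)
  finally show ?thesis .
qed

lemma f0_eq: "f0 x = (\<Sum>s\<in>S. measure g0 {s} * lik B s x)"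
  unfolding mix_density_def by (rule integral_g0) measurable

lemma measurable_f0 [measurable]: "f0 \<in> borel_measurable borel"
  unfolding f0_eq by measurable

lemma atom:
  obtains s where "s \<in> S" "0 < measure g0 {s}"
proof -
  have "(\<Sum>s\<in>S. measure g0 {s}) = 1"
    using integral_g0[of "\<lambda>_. 1"] prob_space.prob_space[OF mixing_dists_prob[OF g0]] by simp
  then obtain s where "s \<in> S" "measure g0 {s} \<noteq> 0"
    by (metis sum.neutral zero_neq_one)
  then show ?thesis using that by (simp add: zero_less_measure_iff order_le_neq_trans)
qed

lemma lik_pos_S: "s \<in> S \<Longrightarrow> 0 < lik B s x"
  using S_sub param by (intro lik_pos) auto

lemma f0_ge_atom:
  assumes "s \<in> S"
  shows "measure g0 {s} * lik B s x \<le> f0 x"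
  unfolding f0_eq
  by (rule member_le_sum[OF assms, where f = "\<lambda>s. measure g0 {s} * lik B s x"])
     (auto intro!: mult_nonneg_nonneg less_imp_le[OF lik_pos_S] simp: finite_S)

lemma f0_pos: "0 < f0 x"
proof -
  obtain s where s: "s \<in> S" "0 < measure g0 {s}" by (rule atom)
  then have "0 < measure g0 {s} * lik B s x" using lik_pos_S by simp
  with f0_ge_atom[OF s(1), of x] show ?thesis by linarith
qed

section \<open>The mixture density and the posterior mean\<close>

text \<open>
  The density \<open>f0\<close> dominates the likelihood of any atom of \<open>g0\<close> up to the mass of the atom, and
  this likelihood absorbs the coefficients by \<open>coord_coeff_bound\<close>.
\<close>

lemma basis_fun_bound:
  assumes "0 \<le> A"
  obtains V where "V \<in> borel_measurable borel" "exp_bounded V" "\<And>x. 0 \<le> V x"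
    "\<And>\<alpha> x. A ^ total_degree \<alpha> * \<bar>basis_fun B \<alpha> x\<bar> \<le> V x * f0 x"
proof -
  obtain s where s: "s \<in> S" "0 < measure g0 {s}" by (rule atom)
  have pos: "l \<notin> B \<Longrightarrow> 0 < s $ l" for l
    using s(1) S_sub param by (auto simp: param_space_def)
  have "\<forall>l. \<exists>K\<ge>0. \<forall>k x. A ^ k * \<bar>coord_coeff (l \<in> B) k x\<bar> \<le> K * exp (K * \<bar>x\<bar>) * coord_density (l \<in> B) (s $ l) x"
  proof
    fix l
    show "\<exists>K\<ge>0. \<forall>k x. A ^ k * \<bar>coord_coeff (l \<in> B) k x\<bar> \<le> K * exp (K * \<bar>x\<bar>) * coord_density (l \<in> B) (s $ l) x"
      by (rule coord_coeff_bound[OF pos[of l] assms]) auto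
  qed
  then obtain K where K: "\<And>l. 0 \<le> K l"
    "\<And>l k x. A ^ k * \<bar>coord_coeff (l \<in> B) k x\<bar> \<le> K l * exp (K l * \<bar>x\<bar>) * coord_density (l \<in> B) (s $ l) x"
    by metis
  define L where "L = (\<Sum>l\<in>UNIV. K l)"
  have KL: "K l \<le> L" for l unfolding L_def using K(1) by (intro member_le_sum) auto
  have L: "0 \<le> L" using K(1) by (simp add: L_def sum_nonneg)
  define V where "V x = L ^ CARD('d) / measure g0 {s} * exp_weight L x" for x :: "real ^ 'd"
  have "A ^ total_degree \<alpha> * \<bar>basis_fun B \<alpha> x\<bar> \<le> V x * f0 x" for \<alpha> x
  proof -
    have "A ^ total_degree \<alpha> * \<bar>basis_fun B \<alpha> x\<bar> = (\<Prod>l\<in>UNIV. A ^ \<alpha> l * \<bar>coord_coeff (l \<in> B) (\<alpha> l) (x $ l)\<bar>)"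
      by (simp add: power_sum basis_fun_def abs_prod prod.distrib)
    also have "\<dots> \<le> (\<Prod>l\<in>UNIV. L * exp (L * \<bar>x $ l\<bar>) * coord_density (l \<in> B) (s $ l) (x $ l))"
    proof (intro prod_mono conjI)
      fix l
      show "0 \<le> A ^ \<alpha> l * \<bar>coord_coeff (l \<in> B) (\<alpha> l) (x $ l)\<bar>" using assms by simp
      have "K l * exp (K l * \<bar>x $ l\<bar>) * coord_density (l \<in> B) (s $ l) (x $ l) \<le>
          L * exp (L * \<bar>x $ l\<bar>) * coord_density (l \<in> B) (s $ l) (x $ l)"
        using KL[of l] K(1)[of l] L coord_density_pos[of "l \<in> B" "s $ l" "x $ l"] pos[of l]
        by (intro mult_right_mono mult_mono) (auto simp: less_imp_le mult_right_mono)
      with K(2)[of "\<alpha> l" l "x $ l"]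
      show "A ^ \<alpha> l * \<bar>coord_coeff (l \<in> B) (\<alpha> l) (x $ l)\<bar> \<le>
          L * exp (L * \<bar>x $ l\<bar>) * coord_density (l \<in> B) (s $ l) (x $ l)" by linarith
    qed
    also have "\<dots> = L ^ CARD('d) * exp_weight L x * lik B s x"
      by (simp add: prod.distrib exp_weight_prod lik_eq_prod)
    also have "\<dots> = V x * (measure g0 {s} * lik B s x)"
      using s(2) by (simp add: V_def)
    also have "\<dots> \<le> V x * f0 x"
      using f0_ge_atom[OF s(1)] L
      by (intro mult_left_mono) (auto simp: V_def exp_weight_pos less_imp_le)
    finally show ?thesis .
  qed
  moreover have "exp_bounded V"
    by (rule exp_boundedI[where K = L and C = "L ^ CARD('d) / measure g0 {s}"])
       (use L in \<open>auto simp: V_def abs_mult exp_weight_pos less_imp_le\<close>)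
  moreover have "V \<in> borel_measurable borel" unfolding V_def by measurable
  moreover have "0 \<le> V x" for x using L by (simp add: V_def exp_weight_pos less_imp_le)
  ultimately show ?thesis by (intro that) auto
qed

lemma tilted_monomial_le:
  assumes "\<theta> \<in> \<Theta>"
  shows "\<bar>tilted_monomial B \<alpha> \<theta>\<bar> \<le> R ^ total_degree \<alpha>"
proof -
  have "\<bar>tilted_power (l \<in> B) (\<alpha> l) (\<theta> $ l)\<bar> \<le> R ^ \<alpha> l" for l
  proof -
    have "l \<notin> B \<Longrightarrow> 0 \<le> \<theta> $ l"
      using assms param by (auto simp: param_space_def less_imp_le)
    then have "exp ((if l \<in> B then - 1 / 2 else - 1) * \<theta> $ l ^ (if l \<in> B then 2 else 1)) \<le> (1::real)"
      by auto
    moreover have "\<bar>\<theta> $ l\<bar> ^ \<alpha> l \<le> R ^ \<alpha> l"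
      by (intro power_mono radius assms) auto
    ultimately show ?thesis
      unfolding tilted_power_def abs_mult power_abs
      using mult_mono[of "\<bar>\<theta> $ l\<bar> ^ \<alpha> l" "R ^ \<alpha> l" _ 1] R_ge1 by auto
  qed
  then show ?thesis
    unfolding tilted_monomial_def abs_prod power_sum by (intro prod_mono) auto
qed

text \<open>
  With the coefficient bound at radius \<open>2 * R\<close> the terms of the series decay like \<open>(1 / 2) ^ k\<close>.
\<close>

lemma expansion_envelope:
  obtains V where "V \<in> borel_measurable borel" "exp_bounded V" "\<And>x. 0 \<le> V x"
    "\<And>N \<theta> x. \<theta> \<in> \<Theta> \<Longrightarrow> \<bar>\<Sum>\<alpha>\<in>degree_box N. tilted_monomial B \<alpha> \<theta> * basis_fun B \<alpha> x\<bar> \<le> V x * f0 x"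
    "\<And>\<theta> x. \<theta> \<in> \<Theta> \<Longrightarrow> lik B \<theta> x \<le> V x * f0 x"
proof -
  obtain V where V: "V \<in> borel_measurable borel" "exp_bounded V" "\<And>x. 0 \<le> V x"
    "\<And>\<alpha> x. (2 * R) ^ total_degree \<alpha> * \<bar>basis_fun B \<alpha> x\<bar> \<le> V x * f0 x"
    using R_ge1 by (rule_tac basis_fun_bound[of "2 * R"]) auto
  have *: "\<bar>\<Sum>\<alpha>\<in>degree_box N. tilted_monomial B \<alpha> \<theta> * basis_fun B \<alpha> x\<bar> \<le> 2 ^ CARD('d) * V x * f0 x"
    if "\<theta> \<in> \<Theta>" for N \<theta> x
  proof -
    have "\<bar>\<Sum>\<alpha>\<in>degree_box N. tilted_monomial B \<alpha> \<theta> * basis_fun B \<alpha> x\<bar> \<le>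
        (\<Sum>\<alpha>\<in>(degree_box N :: ('d \<Rightarrow> nat) set). (1 / 2) ^ total_degree \<alpha> * (V x * f0 x))"
    proof (rule order.trans[OF sum_abs], rule sum_mono)
      fix \<alpha> :: "'d \<Rightarrow> nat"
      have "\<bar>tilted_monomial B \<alpha> \<theta> * basis_fun B \<alpha> x\<bar> \<le> R ^ total_degree \<alpha> * \<bar>basis_fun B \<alpha> x\<bar>"
        unfolding abs_mult by (intro mult_right_mono tilted_monomial_le that) auto
      also have "\<dots> = (1 / 2) ^ total_degree \<alpha> * ((2 * R) ^ total_degree \<alpha> * \<bar>basis_fun B \<alpha> x\<bar>)"
        by (simp add: power_mult_distrib power_one_over)
      also have "\<dots> \<le> (1 / 2) ^ total_degree \<alpha> * (V x * f0 x)"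
        by (intro mult_left_mono V) auto
      finally show "\<bar>tilted_monomial B \<alpha> \<theta> * basis_fun B \<alpha> x\<bar> \<le> (1 / 2) ^ total_degree \<alpha> * (V x * f0 x)" .
    qed
    also have "\<dots> \<le> 2 ^ CARD('d) * (V x * f0 x)"
      unfolding sum_distrib_right[symmetric]
      using V(3)[of x] f0_pos[of x] by (intro mult_right_mono sum_degree_box_geometric_le) auto
    finally show ?thesis by (simp add: mult.assoc)
  qed
  have "lik B \<theta> x \<le> 2 ^ CARD('d) * V x * f0 x" if "\<theta> \<in> \<Theta>" for \<theta> x
    using *[OF that] by (intro LIMSEQ_le_const2[OF lik_expansion[of B \<theta> x]]) (auto simp: abs_le_iff)
  moreover have "exp_bounded (\<lambda>x. 2 ^ CARD('d) * V x)"
    by (intro exp_bounded_mult exp_bounded_const V)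
  ultimately show ?thesis
    using V * by (intro that[of "\<lambda>x. 2 ^ CARD('d) * V x"]) auto
qed

lemma tilted_discrepancy_le:
  obtains A C where "1 \<le> A" "0 \<le> C"
    "\<And>g \<alpha>. g \<in> mixing_dists \<Theta> \<Longrightarrow>
       \<bar>discrepancy g (tilted_monomial B (\<lambda>l. \<alpha> l + \<sigma> l))\<bar> \<le> C * A ^ total_degree \<alpha> * moment_gap g"
proof -
  obtain A D where A: "1 \<le> A" and D: "0 < D"
    and rb: "\<And>l k. remainder_bound m (node_poly l) R (tilted_power (l \<in> B) k) (D * A ^ k)"
    by (rule tilted_power_remainder_bound) blast
  obtain C where C: "0 \<le> C"
    "\<And>g \<psi> D. g \<in> mixing_dists \<Theta> \<Longrightarrow> (\<And>l. \<psi> l \<in> borel_measurable borel) \<Longrightarrow> (\<And>l. 0 < D l) \<Longrightarrow>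
       (\<And>l. remainder_bound m (node_poly l) R (\<psi> l) (D l)) \<Longrightarrow>
       \<bar>discrepancy g (\<lambda>\<theta>. \<Prod>l\<in>UNIV. \<psi> l (\<theta> $ l))\<bar> \<le> C * (\<Prod>l\<in>UNIV. D l) * moment_gap g"
    by (rule discrepancy_prod_le) blast
  show ?thesis
  proof (rule that[OF A, of "C * D ^ CARD('d) * A ^ total_degree \<sigma>"])
    show "0 \<le> C * D ^ CARD('d) * A ^ total_degree \<sigma>" using A C(1) D by simp
    fix g \<alpha> assume g: "g \<in> mixing_dists \<Theta>"
    have eq: "(\<Prod>l\<in>UNIV. D * A ^ (\<alpha> l + \<sigma> l)) = D ^ CARD('d) * A ^ total_degree \<sigma> * A ^ total_degree \<alpha>"
      by (simp add: prod.distrib power_add power_sum mult_ac)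
    have "\<bar>discrepancy g (\<lambda>\<theta>. \<Prod>l\<in>UNIV. tilted_power (l \<in> B) (\<alpha> l + \<sigma> l) (\<theta> $ l))\<bar> \<le>
        C * (\<Prod>l\<in>UNIV. D * A ^ (\<alpha> l + \<sigma> l)) * moment_gap g"
      using A D by (intro C(2)[OF g] rb) auto
    then show "\<bar>discrepancy g (tilted_monomial B (\<lambda>l. \<alpha> l + \<sigma> l))\<bar> \<le>
        C * D ^ CARD('d) * A ^ total_degree \<sigma> * A ^ total_degree \<alpha> * moment_gap g"
      by (simp only: tilted_monomial_def[abs_def] eq mult_ac)
  qed
qed

text \<open>
  For \<open>\<sigma> = 0\<close> this is the difference of the mixture densities of \<open>g\<close> and \<open>g0\<close>; for a unit vector
  \<open>\<sigma>\<close> it is the difference of the numerators of one coordinate of the posterior mean.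
\<close>

definition mixture_gap :: "('d \<Rightarrow> nat) \<Rightarrow> (real ^ 'd) measure \<Rightarrow> real ^ 'd \<Rightarrow> real" where
  "mixture_gap \<sigma> g x = discrepancy g (\<lambda>\<theta>. monomial \<sigma> \<theta> * lik B \<theta> x)"

lemma integrable_monomial_lik:
  assumes "g \<in> mixing_dists \<Theta>"
  shows "integrable g (\<lambda>\<theta>. monomial \<sigma> \<theta> * lik B \<theta> x)"
proof -
  obtain V where V: "\<And>\<theta> x. \<theta> \<in> \<Theta> \<Longrightarrow> lik B \<theta> x \<le> V x * f0 x" by (rule expansion_envelope) blast
  show ?thesis
  proof (rule mixing_dists_integrable[OF assms, where K = "(\<Prod>l\<in>UNIV. R ^ \<sigma> l) * (V x * f0 x)"])
    fix \<theta> assume \<theta>: "\<theta> \<in> \<Theta>"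
    with param have "0 < lik B \<theta> x" by (intro lik_pos) auto
    with V[OF \<theta>, of x] monomial_bound[OF \<theta>, of \<sigma>]
    show "norm (monomial \<sigma> \<theta> * lik B \<theta> x) \<le> (\<Prod>l\<in>UNIV. R ^ \<sigma> l) * (V x * f0 x)"
      unfolding real_norm_def abs_mult by (intro mult_mono) auto
  qed measurable
qed

lemma integrable_tilted_monomial:
  assumes "g \<in> mixing_dists \<Theta>"
  shows "integrable g (tilted_monomial B \<alpha>)"
  by (rule mixing_dists_integrable[OF assms, where K = "R ^ total_degree \<alpha>"]) (auto intro: tilted_monomial_le)

lemma mixture_expansion:
  assumes g: "g \<in> mixing_dists \<Theta>"
  shows "(\<lambda>N. \<Sum>\<alpha>\<in>degree_box N. (\<integral>\<theta>. tilted_monomial B (\<lambda>l. \<alpha> l + \<sigma> l) \<theta> \<partial>g) * basis_fun B \<alpha> x)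
    \<longlonglongrightarrow> (\<integral>\<theta>. monomial \<sigma> \<theta> * lik B \<theta> x \<partial>g)"
proof -
  obtain V where V: "\<And>N \<theta> x. \<theta> \<in> \<Theta> \<Longrightarrow>
      \<bar>\<Sum>\<alpha>\<in>degree_box N. tilted_monomial B \<alpha> \<theta> * basis_fun B \<alpha> x\<bar> \<le> V x * f0 x"
    by (rule expansion_envelope) blast
  have "(\<lambda>N. \<integral>\<theta>. monomial \<sigma> \<theta> * (\<Sum>\<alpha>\<in>degree_box N. tilted_monomial B \<alpha> \<theta> * basis_fun B \<alpha> x) \<partial>g)
      \<longlonglongrightarrow> (\<integral>\<theta>. monomial \<sigma> \<theta> * lik B \<theta> x \<partial>g)"
  proof (rule integral_dominated_convergence[where w = "\<lambda>_. (\<Prod>l\<in>UNIV. R ^ \<sigma> l) * (V x * f0 x)"])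
    show "integrable g (\<lambda>_. (\<Prod>l\<in>UNIV. R ^ \<sigma> l) * (V x * f0 x))"
      by (rule mixing_dists_integrable[OF g]) auto
    show "AE \<theta> in g. (\<lambda>N. monomial \<sigma> \<theta> * (\<Sum>\<alpha>\<in>degree_box N. tilted_monomial B \<alpha> \<theta> * basis_fun B \<alpha> x))
        \<longlonglongrightarrow> monomial \<sigma> \<theta> * lik B \<theta> x"
      by (intro always_eventually allI tendsto_mult_left lik_expansion)
    fix N
    show "AE \<theta> in g. norm (monomial \<sigma> \<theta> * (\<Sum>\<alpha>\<in>degree_box N. tilted_monomial B \<alpha> \<theta> * basis_fun B \<alpha> x))
        \<le> (\<Prod>l\<in>UNIV. R ^ \<sigma> l) * (V x * f0 x)"
    proof (rule AE_I2)
      fix \<theta> assume "\<theta> \<in> space g"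
      then have \<theta>: "\<theta> \<in> \<Theta>" by (simp add: mixing_dists_space[OF g])
      show "norm (monomial \<sigma> \<theta> * (\<Sum>\<alpha>\<in>degree_box N. tilted_monomial B \<alpha> \<theta> * basis_fun B \<alpha> x))
          \<le> (\<Prod>l\<in>UNIV. R ^ \<sigma> l) * (V x * f0 x)"
        unfolding real_norm_def abs_mult
        by (intro mult_mono monomial_bound V \<theta> prod_nonneg) (use R_ge1 in auto)
    qed
  qed (rule mixing_dists_measurable[OF g], measurable)+
  also have "(\<lambda>N. \<integral>\<theta>. monomial \<sigma> \<theta> * (\<Sum>\<alpha>\<in>degree_box N. tilted_monomial B \<alpha> \<theta> * basis_fun B \<alpha> x) \<partial>g) =
      (\<lambda>N. \<Sum>\<alpha>\<in>degree_box N. (\<integral>\<theta>. tilted_monomial B (\<lambda>l. \<alpha> l + \<sigma> l) \<theta> \<partial>g) * basis_fun B \<alpha> x)"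
  proof
    fix N
    have "monomial \<sigma> \<theta> * (\<Sum>\<alpha>\<in>degree_box N. tilted_monomial B \<alpha> \<theta> * basis_fun B \<alpha> x) =
        (\<Sum>\<alpha>\<in>degree_box N. tilted_monomial B (\<lambda>l. \<alpha> l + \<sigma> l) \<theta> * basis_fun B \<alpha> x)" for \<theta>
      by (simp only: tilted_monomial_shift sum_distrib_left mult.assoc)
    then show "(\<integral>\<theta>. monomial \<sigma> \<theta> * (\<Sum>\<alpha>\<in>degree_box N. tilted_monomial B \<alpha> \<theta> * basis_fun B \<alpha> x) \<partial>g) =
        (\<Sum>\<alpha>\<in>degree_box N. (\<integral>\<theta>. tilted_monomial B (\<lambda>l. \<alpha> l + \<sigma> l) \<theta> \<partial>g) * basis_fun B \<alpha> x)"
      by (simp add: integrable_tilted_monomial[OF g])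
  qed
  finally show ?thesis .
qed

lemma mixture_gap_expansion:
  assumes "g \<in> mixing_dists \<Theta>"
  shows "(\<lambda>N. \<Sum>\<alpha>\<in>degree_box N. discrepancy g (tilted_monomial B (\<lambda>l. \<alpha> l + \<sigma> l)) * basis_fun B \<alpha> x)
    \<longlonglongrightarrow> mixture_gap \<sigma> g x"
  using tendsto_diff[OF mixture_expansion[OF assms] mixture_expansion[OF g0], of \<sigma> x \<sigma> x]
  unfolding mixture_gap_def discrepancy_def by (simp add: left_diff_distrib sum_subtractf)

text \<open>
  The integral of each term of the likelihood series against \<open>g - g0\<close> is of size \<open>moment_gap g\<close>, up
  to a geometric factor that the coefficients absorb.
\<close>

lemma mixture_gap_le:
  obtains V where "V \<in> borel_measurable borel" "exp_bounded V" "\<And>x. 0 \<le> V x"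
    "\<And>g x. g \<in> mixing_dists \<Theta> \<Longrightarrow> \<bar>mixture_gap \<sigma> g x\<bar> \<le> V x * f0 x * moment_gap g"
proof -
  obtain A C where A: "1 \<le> A" and C: "0 \<le> C"
    and AC: "\<And>g \<alpha>. g \<in> mixing_dists \<Theta> \<Longrightarrow>
       \<bar>discrepancy g (tilted_monomial B (\<lambda>l. \<alpha> l + \<sigma> l))\<bar> \<le> C * A ^ total_degree \<alpha> * moment_gap g"
    by (rule tilted_discrepancy_le[of \<sigma>]) blast
  have "0 \<le> 2 * A" using A by simp
  then obtain V where V: "V \<in> borel_measurable borel" "exp_bounded V" "\<And>x. 0 \<le> V x"
    "\<And>\<alpha> x. (2 * A) ^ total_degree \<alpha> * \<bar>basis_fun B \<alpha> x\<bar> \<le> V x * f0 x"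
    by (rule basis_fun_bound) blast
  have le: "\<bar>mixture_gap \<sigma> g x\<bar> \<le> (C * 2 ^ CARD('d)) * V x * f0 x * moment_gap g"
    if g: "g \<in> mixing_dists \<Theta>" for g x
  proof (rule LIMSEQ_le_const2[OF tendsto_rabs[OF mixture_gap_expansion[OF g]]], intro exI allI impI)
    fix N
    let ?c = "\<lambda>\<alpha>. discrepancy g (tilted_monomial B (\<lambda>l. \<alpha> l + \<sigma> l))"
    have "\<bar>\<Sum>\<alpha>\<in>degree_box N. ?c \<alpha> * basis_fun B \<alpha> x\<bar> \<le>
        (\<Sum>\<alpha>\<in>(degree_box N :: ('d \<Rightarrow> nat) set). (1 / 2) ^ total_degree \<alpha> * (C * V x * f0 x * moment_gap g))"
    proof (rule order.trans[OF sum_abs], rule sum_mono)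
      fix \<alpha> :: "'d \<Rightarrow> nat"
      have "\<bar>?c \<alpha> * basis_fun B \<alpha> x\<bar> \<le> (C * A ^ total_degree \<alpha> * moment_gap g) * \<bar>basis_fun B \<alpha> x\<bar>"
        unfolding abs_mult by (intro mult_right_mono AC g) auto
      also have "\<dots> = (1 / 2) ^ total_degree \<alpha> * (C * moment_gap g * ((2 * A) ^ total_degree \<alpha> * \<bar>basis_fun B \<alpha> x\<bar>))"
        by (simp add: power_mult_distrib power_one_over)
      also have "\<dots> \<le> (1 / 2) ^ total_degree \<alpha> * (C * moment_gap g * (V x * f0 x))"
        using C moment_gap_nonneg[of g] by (intro mult_left_mono V) auto
      finally show "\<bar>?c \<alpha> * basis_fun B \<alpha> x\<bar> \<le> (1 / 2) ^ total_degree \<alpha> * (C * V x * f0 x * moment_gap g)"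
        by (simp add: mult_ac)
    qed
    also have "\<dots> \<le> 2 ^ CARD('d) * (C * V x * f0 x * moment_gap g)"
      unfolding sum_distrib_right[symmetric]
      using C moment_gap_nonneg[of g] V(3)[of x] f0_pos[of x]
      by (intro mult_right_mono sum_degree_box_geometric_le) auto
    finally show "\<bar>\<Sum>\<alpha>\<in>degree_box N. ?c \<alpha> * basis_fun B \<alpha> x\<bar> \<le> (C * 2 ^ CARD('d)) * V x * f0 x * moment_gap g"
      by (simp add: mult_ac)
  qed
  show ?thesis
  proof (rule that[of "\<lambda>x. (C * 2 ^ CARD('d)) * V x"])
    show "exp_bounded (\<lambda>x. (C * 2 ^ CARD('d)) * V x)"
      by (intro exp_bounded_mult exp_bounded_const V)
    show "(\<lambda>x. (C * 2 ^ CARD('d)) * V x) \<in> borel_measurable borel"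
      using V(1) by measurable
    show "0 \<le> (C * 2 ^ CARD('d)) * V x" for x
      using C V(3)[of x] by simp
  qed (rule le)
qed

lemma monomial_0 [simp]: "monomial (\<lambda>_. 0) \<theta> = 1"
  by (simp add: monomial_def)

lemma mix_density_eq: "mix_density B g x = f0 x + mixture_gap (\<lambda>_. 0) g x"
  by (simp add: mixture_gap_def discrepancy_def mix_density_def)

lemma mix_density_pos:
  assumes g: "g \<in> mixing_dists \<Theta>"
  shows "0 < mix_density B g x"
proof -
  interpret prob_space g by (rule mixing_dists_prob[OF g])
  have "(\<integral>\<theta>. 0 \<partial>g) < (\<integral>\<theta>. lik B \<theta> x \<partial>g)"
    using integrable_monomial_lik[OF g, of "\<lambda>_. 0" x] lik_pos param mixing_dists_space[OF g]
    by (intro integral_less_AE_space) (auto simp: emeasure_space_1 subset_iff intro!: AE_I2)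
  then show ?thesis by (simp add: mix_density_def)
qed

lemma post_mean_nth:
  assumes g: "g \<in> mixing_dists \<Theta>"
  shows "post_mean B g x $ l = (\<integral>\<theta>. \<theta> $ l * lik B \<theta> x \<partial>g) / mix_density B g x"
proof -
  have "integrable g (\<lambda>\<theta>. lik B \<theta> x *\<^sub>R \<theta>)"
  proof -
    obtain V where V: "\<And>\<theta> x. \<theta> \<in> \<Theta> \<Longrightarrow> lik B \<theta> x \<le> V x * f0 x" by (rule expansion_envelope) blast
    show ?thesis
    proof (rule mixing_dists_integrable[OF g, where K = "(V x * f0 x) * (\<Sum>l::'d\<in>UNIV. R)"])
      fix \<theta> assume \<theta>: "\<theta> \<in> \<Theta>"
      with param have "0 < lik B \<theta> x" by (intro lik_pos) auto
      moreover have "norm \<theta> \<le> (\<Sum>l::'d\<in>UNIV. R)"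
        by (rule order.trans[OF norm_le_l1_cart]) (intro sum_mono radius \<theta>)
      ultimately show "norm (lik B \<theta> x *\<^sub>R \<theta>) \<le> (V x * f0 x) * (\<Sum>l::'d\<in>UNIV. R)"
        unfolding norm_scaleR using V[OF \<theta>, of x] by (intro mult_mono) auto
    qed measurable
  qed
  from integral_bounded_linear[OF bounded_linear_vec_nth this, of l]
  show ?thesis by (simp add: post_mean_def mult.commute divide_inverse_commute)
qed

text \<open>
  Let \<open>p\<close> be a coordinate of the posterior mean under \<open>g\<close>. Its numerator is \<open>p\<close> times the mixture
  density of \<open>g\<close>, so that \<open>mix_density_eq\<close> gives
  \<open>(p - post_mean B g0 x $ l) * f0 x = mixture_gap (unit l) g x - p * mixture_gap 0 g x\<close>. As
  \<open>\<bar>p\<bar> \<le> R\<close>, only the fixed density \<open>f0\<close> is ever divided by.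
\<close>

lemma post_mean_diff_le:
  obtains V where "V \<in> borel_measurable borel" "exp_bounded V" "\<And>x. 0 \<le> V x"
    "\<And>g x. g \<in> mixing_dists \<Theta> \<Longrightarrow> norm (post_mean B g x - post_mean B g0 x) \<le> V x * moment_gap g"
proof -
  define e where "e l = (\<lambda>l'. if l' = l then 1 else 0 :: nat)" for l :: 'd
  have mono: "monomial (e l) \<theta> = \<theta> $ l" for l \<theta>
    unfolding monomial_def e_def by (simp add: if_distrib[of "\<lambda>k. _ ^ k"] cong: if_cong)
  obtain V0 where V0: "V0 \<in> borel_measurable borel" "exp_bounded V0" "\<And>x. 0 \<le> V0 x"
    "\<And>g x. g \<in> mixing_dists \<Theta> \<Longrightarrow> \<bar>mixture_gap (\<lambda>_. 0) g x\<bar> \<le> V0 x * f0 x * moment_gap g"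
    by (rule mixture_gap_le) blast
  have "\<forall>l. \<exists>V. V \<in> borel_measurable borel \<and> exp_bounded V \<and> (\<forall>x. 0 \<le> V x) \<and>
    (\<forall>g x. g \<in> mixing_dists \<Theta> \<longrightarrow> \<bar>mixture_gap (e l) g x\<bar> \<le> V x * f0 x * moment_gap g)"
  proof
    fix l
    show "\<exists>V. V \<in> borel_measurable borel \<and> exp_bounded V \<and> (\<forall>x. 0 \<le> V x) \<and>
      (\<forall>g x. g \<in> mixing_dists \<Theta> \<longrightarrow> \<bar>mixture_gap (e l) g x\<bar> \<le> V x * f0 x * moment_gap g)"
      by (rule mixture_gap_le[of "e l"]) blast
  qed
  then obtain V where V: "\<And>l. V l \<in> borel_measurable borel" "\<And>l. exp_bounded (V l)" "\<And>l x. 0 \<le> V l x"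
    "\<And>l g x. g \<in> mixing_dists \<Theta> \<Longrightarrow> \<bar>mixture_gap (e l) g x\<bar> \<le> V l x * f0 x * moment_gap g"
    by metis
  note [measurable] = V0(1) V(1)
  define W where "W x = (\<Sum>l\<in>UNIV. V l x + R * V0 x)" for x
  have "norm (post_mean B g x - post_mean B g0 x) \<le> W x * moment_gap g" if g: "g \<in> mixing_dists \<Theta>" for g x
  proof -
    have "\<bar>(post_mean B g x - post_mean B g0 x) $ l\<bar> \<le> (V l x + R * V0 x) * moment_gap g" for l
    proof -
      define p where "p = post_mean B g x $ l"
      have fg: "0 < mix_density B g x" by (rule mix_density_pos[OF g])
      have num: "(\<integral>\<theta>. \<theta> $ l * lik B \<theta> x \<partial>g) = p * mix_density B g x"
        using fg by (simp add: p_def post_mean_nth[OF g])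
      have p: "\<bar>p\<bar> \<le> R"
      proof -
        have int: "integrable g (\<lambda>\<theta>. \<theta> $ l * lik B \<theta> x)" "integrable g (\<lambda>\<theta>. lik B \<theta> x)"
          using integrable_monomial_lik[OF g, of "e l" x] integrable_monomial_lik[OF g, of "\<lambda>_. 0" x]
          by (simp_all add: mono)
        have "\<bar>\<integral>\<theta>. \<theta> $ l * lik B \<theta> x \<partial>g\<bar> \<le> (\<integral>\<theta>. \<bar>\<theta> $ l * lik B \<theta> x\<bar> \<partial>g)"
          by (rule integral_abs_bound)
        also have "\<dots> \<le> (\<integral>\<theta>. R * lik B \<theta> x \<partial>g)"
        proof (rule integral_mono)
          fix \<theta> assume "\<theta> \<in> space g"
          then have \<theta>: "\<theta> \<in> \<Theta>" by (simp add: mixing_dists_space[OF g])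
          with param have "0 < lik B \<theta> x" by (intro lik_pos) auto
          then show "\<bar>\<theta> $ l * lik B \<theta> x\<bar> \<le> R * lik B \<theta> x"
            using radius[OF \<theta>, of l] by (simp add: abs_mult mult_right_mono)
        qed (use int in auto)
        also have "\<dots> = R * mix_density B g x" by (simp add: mix_density_def)
        finally have "\<bar>p\<bar> * mix_density B g x \<le> R * mix_density B g x"
          using fg by (simp add: num abs_mult)
        then show ?thesis using fg by simp
      qed
      have "mixture_gap (e l) g x = p * mix_density B g x - post_mean B g0 x $ l * f0 x"
        using f0_pos[of x] by (simp add: mixture_gap_def discrepancy_def mono num post_mean_nth[OF g0])
      then have "(p - post_mean B g0 x $ l) * f0 x = mixture_gap (e l) g x - p * mixture_gap (\<lambda>_. 0) g x"
        unfolding mix_density_eq[of g x] by (simp add: algebra_simps)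
      then have "\<bar>p - post_mean B g0 x $ l\<bar> * f0 x = \<bar>mixture_gap (e l) g x - p * mixture_gap (\<lambda>_. 0) g x\<bar>"
        using f0_pos[of x] by (metis abs_mult abs_of_pos)
      also have "\<dots> \<le> \<bar>mixture_gap (e l) g x\<bar> + \<bar>p\<bar> * \<bar>mixture_gap (\<lambda>_. 0) g x\<bar>"
        by (metis abs_mult abs_triangle_ineq4)
      also have "\<dots> \<le> V l x * f0 x * moment_gap g + R * (V0 x * f0 x * moment_gap g)"
        using p by (intro add_mono mult_mono V(4) V0(4) g) auto
      also have "\<dots> = (V l x + R * V0 x) * moment_gap g * f0 x"
        by (simp add: algebra_simps)
      finally show ?thesis using f0_pos[of x] by (simp add: p_def)
    qed
    then have "(\<Sum>l\<in>UNIV. \<bar>(post_mean B g x - post_mean B g0 x) $ l\<bar>) \<le> W x * moment_gap g"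
      unfolding W_def sum_distrib_right by (intro sum_mono)
    with norm_le_l1_cart show ?thesis by (rule order.trans)
  qed
  moreover have "exp_bounded W"
  proof -
    have "exp_bounded (\<lambda>x. \<Sum>l\<in>I. V l x + R * V0 x)" if "finite I" for I
      using that by (induction I rule: finite_induct)
        (auto intro!: exp_bounded_add exp_bounded_mult exp_bounded_const V V0)
    then show ?thesis by (simp add: W_def[abs_def])
  qed
  moreover have "0 \<le> W x" for x using V(3) V0(3) R_ge1 by (auto simp: W_def intro!: sum_nonneg)
  moreover have "W \<in> borel_measurable borel" unfolding W_def by measurable
  ultimately show ?thesis by (intro that[of W])
qed

lemma integrable_exp_bounded_f0:
  assumes [measurable]: "f \<in> borel_measurable borel" and f: "exp_bounded f"
  shows "integrable (base_measure B) (\<lambda>x. f x * f0 x)"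
proof -
  obtain K where K: "0 \<le> K" "\<And>x. \<bar>f x\<bar> \<le> K * exp_weight K x"
    using f unfolding exp_bounded_def by blast
  have "integrable (base_measure B) (\<lambda>x. \<Sum>s\<in>S. K * measure g0 {s} * (exp_weight K x * lik B s x))"
    using S_sub param
    by (intro Bochner_Integration.integrable_sum integrable_mult_right integrable_exp_weight_lik) auto
  then have "integrable (base_measure B) (\<lambda>x. K * exp_weight K x * f0 x)"
    by (simp add: f0_eq sum_distrib_left mult_ac)
  then show ?thesis
  proof (rule Bochner_Integration.integrable_bound)
    have "norm (f x * f0 x) \<le> norm (K * exp_weight K x * f0 x)" for x
      using mult_right_mono[OF K(2), of "f0 x" x] f0_pos[of x] K(1)
      by (simp add: abs_mult exp_weight_pos less_imp_le)
    then show "AE x in base_measure B. norm (f x * f0 x) \<le> norm (K * exp_weight K x * f0 x)" by simp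
  qed measurable
qed

text \<open>
  Integrating an unbiased estimator against the mixture density amounts to exchanging the integrals
  over \<open>x\<close> and \<open>\<theta>\<close>. For the finite partial sums of the likelihood series the exchange is trivial, and
  dominated convergence passes to the limit in either order.
\<close>

lemma integral_dual_mixture:
  assumes g: "g \<in> mixing_dists \<Theta>"
    and [measurable]: "T \<in> borel_measurable borel" and T: "exp_bounded T"
    and dual: "\<And>\<theta>. \<theta> \<in> \<Theta> \<Longrightarrow> has_bochner_integral (base_measure B) (\<lambda>x. T x * lik B \<theta> x) (\<phi> \<theta>)"
    and [measurable]: "\<phi> \<in> borel_measurable borel"
  shows "has_bochner_integral (base_measure B) (\<lambda>x. T x * mix_density B g x) (\<integral>\<theta>. \<phi> \<theta> \<partial>g)"
proof -
  obtain V where [measurable]: "V \<in> borel_measurable borel" and V: "exp_bounded V" "\<And>x. 0 \<le> V x"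
    "\<And>N \<theta> x. \<theta> \<in> \<Theta> \<Longrightarrow> \<bar>\<Sum>\<alpha>\<in>degree_box N. tilted_monomial B \<alpha> \<theta> * basis_fun B \<alpha> x\<bar> \<le> V x * f0 x"
    by (rule expansion_envelope) blast
  obtain V' where [measurable]: "V' \<in> borel_measurable borel" and V': "exp_bounded V'" "\<And>x. 0 \<le> V' x"
    "\<And>\<alpha> x. 1 ^ total_degree \<alpha> * \<bar>basis_fun B \<alpha> x\<bar> \<le> V' x * f0 x"
    by (rule basis_fun_bound[of 1]) auto
  let ?t = "\<lambda>\<alpha>. \<integral>\<theta>. tilted_monomial B \<alpha> \<theta> \<partial>g"
  define b where "b \<alpha> = (\<integral>x. T x * basis_fun B \<alpha> x \<partial>base_measure B)" for \<alpha>
  have dom: "integrable (base_measure B) (\<lambda>x. \<bar>T x\<bar> * (V x * f0 x))"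
    using integrable_exp_bounded_f0[OF _ exp_bounded_mult[OF exp_bounded_abs[OF T] V(1)]] by (simp add: mult.assoc)
  have int_b: "integrable (base_measure B) (\<lambda>x. T x * basis_fun B \<alpha> x)" for \<alpha>
  proof (rule Bochner_Integration.integrable_bound)
    show "integrable (base_measure B) (\<lambda>x. T x * V' x * f0 x)"
      by (intro integrable_exp_bounded_f0 exp_bounded_mult T V') measurable
    have "norm (T x * basis_fun B \<alpha> x) \<le> norm (T x * V' x * f0 x)" for x
      using V'(3)[of \<alpha> x] V'(2)[of x] f0_pos[of x] by (simp add: abs_mult mult.assoc mult_left_mono)
    then show "AE x in base_measure B. norm (T x * basis_fun B \<alpha> x) \<le> norm (T x * V' x * f0 x)" by simp
  qed measurable
  have int_sum: "(\<integral>x. T x * (\<Sum>\<alpha>\<in>degree_box N. c \<alpha> * basis_fun B \<alpha> x) \<partial>base_measure B) = (\<Sum>\<alpha>\<in>degree_box N. c \<alpha> * b \<alpha>)"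
    for c N
  proof -
    have "T x * (\<Sum>\<alpha>\<in>degree_box N. c \<alpha> * basis_fun B \<alpha> x) = (\<Sum>\<alpha>\<in>degree_box N. c \<alpha> * (T x * basis_fun B \<alpha> x))" for x
      by (simp add: sum_distrib_left mult_ac)
    then show ?thesis by (simp add: int_b b_def)
  qed
  have lim: "integrable (base_measure B) (\<lambda>x. T x * F x)"
    "(\<lambda>N. \<Sum>\<alpha>\<in>degree_box N. c \<alpha> * b \<alpha>) \<longlonglongrightarrow> (\<integral>x. T x * F x \<partial>base_measure B)"
    "\<And>N. \<bar>\<Sum>\<alpha>\<in>degree_box N. c \<alpha> * b \<alpha>\<bar> \<le> (\<integral>x. \<bar>T x\<bar> * (V x * f0 x) \<partial>base_measure B)"
    if "\<And>x. (\<lambda>N. \<Sum>\<alpha>\<in>degree_box N. c \<alpha> * basis_fun B \<alpha> x) \<longlonglongrightarrow> F x"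
      and bound: "\<And>N x. \<bar>\<Sum>\<alpha>\<in>degree_box N. c \<alpha> * basis_fun B \<alpha> x\<bar> \<le> V x * f0 x" for c F
  proof -
    have [measurable]: "F \<in> borel_measurable borel"
      by (rule borel_measurable_LIMSEQ_real[OF that(1)]) measurable
    have le: "norm (T x * (\<Sum>\<alpha>\<in>degree_box N. c \<alpha> * basis_fun B \<alpha> x)) \<le> \<bar>T x\<bar> * (V x * f0 x)" for N x
      unfolding real_norm_def abs_mult by (intro mult_left_mono bound) auto
    show "integrable (base_measure B) (\<lambda>x. T x * F x)"
      by (rule integrable_dominated_convergence[where w = "\<lambda>x. \<bar>T x\<bar> * (V x * f0 x)"
        and s = "\<lambda>N x. T x * (\<Sum>\<alpha>\<in>degree_box N. c \<alpha> * basis_fun B \<alpha> x)"])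
         (use dom le that(1) in \<open>auto intro!: tendsto_mult_left\<close>)
    have "(\<lambda>N. \<integral>x. T x * (\<Sum>\<alpha>\<in>degree_box N. c \<alpha> * basis_fun B \<alpha> x) \<partial>base_measure B)
        \<longlonglongrightarrow> (\<integral>x. T x * F x \<partial>base_measure B)"
      by (rule integral_dominated_convergence[where w = "\<lambda>x. \<bar>T x\<bar> * (V x * f0 x)"])
         (use dom le that(1) in \<open>auto intro!: tendsto_mult_left\<close>)
    then show "(\<lambda>N. \<Sum>\<alpha>\<in>degree_box N. c \<alpha> * b \<alpha>) \<longlonglongrightarrow> (\<integral>x. T x * F x \<partial>base_measure B)"
      by (simp only: int_sum)
    show "\<bar>\<Sum>\<alpha>\<in>degree_box N. c \<alpha> * b \<alpha>\<bar> \<le> (\<integral>x. \<bar>T x\<bar> * (V x * f0 x) \<partial>base_measure B)" for N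
    proof -
      have "integrable (base_measure B) (\<lambda>x. T x * (\<Sum>\<alpha>\<in>degree_box N. c \<alpha> * basis_fun B \<alpha> x))"
      proof (rule Bochner_Integration.integrable_bound[OF dom])
        show "AE x in base_measure B. norm (T x * (\<Sum>\<alpha>\<in>degree_box N. c \<alpha> * basis_fun B \<alpha> x))
            \<le> norm (\<bar>T x\<bar> * (V x * f0 x))"
          unfolding real_norm_def by (intro always_eventually allI order.trans[OF le[unfolded real_norm_def] abs_ge_self])
      qed measurable
      from Bochner_Integration.integral_norm_bound_integral[OF this dom le]
      show ?thesis by (simp only: int_sum real_norm_def)
    qed
  qed
  have mix: "(\<lambda>N. \<Sum>\<alpha>\<in>degree_box N. ?t \<alpha> * basis_fun B \<alpha> x) \<longlonglongrightarrow> mix_density B g x" for x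
    using mixture_expansion[OF g, of "\<lambda>_. 0" x] by (simp add: mix_density_def)
  have mix_bound: "\<bar>\<Sum>\<alpha>\<in>degree_box N. ?t \<alpha> * basis_fun B \<alpha> x\<bar> \<le> V x * f0 x" for N x
  proof -
    interpret prob_space g by (rule mixing_dists_prob[OF g])
    have "(\<Sum>\<alpha>\<in>degree_box N. ?t \<alpha> * basis_fun B \<alpha> x) =
        (\<integral>\<theta>. (\<Sum>\<alpha>\<in>degree_box N. tilted_monomial B \<alpha> \<theta> * basis_fun B \<alpha> x) \<partial>g)"
      by (simp add: integrable_tilted_monomial[OF g])
    also have "norm \<dots> \<le> (\<integral>\<theta>. V x * f0 x \<partial>g)"
      using V(3) mixing_dists_space[OF g]
      by (intro Bochner_Integration.integral_norm_bound_integral) (auto intro!: integrable_tilted_monomial[OF g])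
    finally show ?thesis by (simp add: prob_space)
  qed
  note limx = lim[OF mix mix_bound]
  have "(\<lambda>N. \<integral>\<theta>. (\<Sum>\<alpha>\<in>degree_box N. tilted_monomial B \<alpha> \<theta> * b \<alpha>) \<partial>g) \<longlonglongrightarrow> (\<integral>\<theta>. \<phi> \<theta> \<partial>g)"
  proof (rule integral_dominated_convergence[where w = "\<lambda>_. \<integral>x. \<bar>T x\<bar> * (V x * f0 x) \<partial>base_measure B"])
    show "integrable g (\<lambda>_. \<integral>x. \<bar>T x\<bar> * (V x * f0 x) \<partial>base_measure B)"
      by (rule mixing_dists_integrable[OF g]) auto
    show "AE \<theta> in g. (\<lambda>N. \<Sum>\<alpha>\<in>degree_box N. tilted_monomial B \<alpha> \<theta> * b \<alpha>) \<longlonglongrightarrow> \<phi> \<theta>"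
    proof (rule AE_I2)
      fix \<theta> assume "\<theta> \<in> space g"
      then have \<theta>: "\<theta> \<in> \<Theta>" by (simp add: mixing_dists_space[OF g])
      have "(\<lambda>N. \<Sum>\<alpha>\<in>degree_box N. tilted_monomial B \<alpha> \<theta> * b \<alpha>) \<longlonglongrightarrow> (\<integral>x. T x * lik B \<theta> x \<partial>base_measure B)"
        by (rule lim(2)[OF lik_expansion V(3)[OF \<theta>]])
      then show "(\<lambda>N. \<Sum>\<alpha>\<in>degree_box N. tilted_monomial B \<alpha> \<theta> * b \<alpha>) \<longlonglongrightarrow> \<phi> \<theta>"
        using dual[OF \<theta>] by (simp add: has_bochner_integral_iff)
    qed
    show "AE \<theta> in g. norm (\<Sum>\<alpha>\<in>degree_box N. tilted_monomial B \<alpha> \<theta> * b \<alpha>) \<le>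
        (\<integral>x. \<bar>T x\<bar> * (V x * f0 x) \<partial>base_measure B)" for N
    proof (rule AE_I2)
      fix \<theta> assume "\<theta> \<in> space g"
      then have \<theta>: "\<theta> \<in> \<Theta>" by (simp add: mixing_dists_space[OF g])
      show "norm (\<Sum>\<alpha>\<in>degree_box N. tilted_monomial B \<alpha> \<theta> * b \<alpha>) \<le>
        (\<integral>x. \<bar>T x\<bar> * (V x * f0 x) \<partial>base_measure B)"
        using lim(3)[OF lik_expansion V(3)[OF \<theta>], of N] by simp
    qed
  qed (rule mixing_dists_measurable[OF g], measurable)+
  then have "(\<lambda>N. \<Sum>\<alpha>\<in>degree_box N. ?t \<alpha> * b \<alpha>) \<longlonglongrightarrow> (\<integral>\<theta>. \<phi> \<theta> \<partial>g)"
    by (simp add: integrable_tilted_monomial[OF g])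
  with limx show ?thesis
    unfolding has_bochner_integral_iff using LIMSEQ_unique by blast
qed

end

section \<open>Empirical means\<close>

text \<open>
  With \<open>r = sqrt (1 + h)\<close> this is \<open>ln (1 + h) = 2 * ln r \<le> 2 * (r - 1) = h - (r - 1)\<^sup>2\<close>, combined with
  \<open>h = (r - 1) * (r + 1)\<close>.
\<close>

lemma ln_one_plus_le:
  fixes h :: real
  assumes "-1 < h"
  shows "ln (1 + h) \<le> h - h\<^sup>2 / (4 * (1 + \<bar>h\<bar>))"
proof -
  define r where "r = sqrt (1 + h)"
  have r: "0 < r" "r\<^sup>2 = 1 + h" using assms by (simp_all add: r_def)
  have "ln (1 + h) = 2 * ln r"
    using r by (metis ln_realpow of_nat_numeral)
  also have "\<dots> \<le> 2 * (r - 1)"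
    using ln_le_minus_one[OF r(1)] by simp
  also have "\<dots> = h - (r - 1)\<^sup>2"
    using r(2) by (simp add: power2_eq_square algebra_simps)
  finally have "ln (1 + h) \<le> h - (r - 1)\<^sup>2" .
  moreover have "h\<^sup>2 / (4 * (1 + \<bar>h\<bar>)) \<le> (r - 1)\<^sup>2"
  proof -
    have "(r + 1)\<^sup>2 \<le> 2 * (r\<^sup>2 + 1)"
      using zero_le_power2[of "r - 1"] by (simp add: power2_eq_square algebra_simps)
    also have "\<dots> \<le> 4 * (1 + \<bar>h\<bar>)" unfolding r(2) by simp
    finally have le: "(r + 1)\<^sup>2 \<le> 4 * (1 + \<bar>h\<bar>)" .
    have "h = (r - 1) * (r + 1)" using r(2) by (simp add: power2_eq_square algebra_simps)
    then have "h\<^sup>2 = (r - 1)\<^sup>2 * (r + 1)\<^sup>2" by (simp only: power_mult_distrib)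
    also have "\<dots> \<le> (r - 1)\<^sup>2 * (4 * (1 + \<bar>h\<bar>))" by (rule mult_left_mono[OF le]) simp
    finally show ?thesis by (simp add: divide_le_eq)
  qed
  ultimately show ?thesis by linarith
qed

context prob_space
begin

lemma expectation_square_sum_indep:
  fixes Y :: "nat \<Rightarrow> 'a \<Rightarrow> real"
  assumes indep: "indep_vars (\<lambda>_. borel) Y I" and "finite I"
    and sq: "\<And>i. i \<in> I \<Longrightarrow> integrable M (\<lambda>\<omega>. (Y i \<omega>)\<^sup>2)"
    and zero: "\<And>i. i \<in> I \<Longrightarrow> expectation (Y i) = 0"
  shows "integrable M (\<lambda>\<omega>. (\<Sum>i\<in>I. Y i \<omega>)\<^sup>2)"
    and "expectation (\<lambda>\<omega>. (\<Sum>i\<in>I. Y i \<omega>)\<^sup>2) = (\<Sum>i\<in>I. expectation (\<lambda>\<omega>. (Y i \<omega>)\<^sup>2))"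
proof -
  have meas: "Y i \<in> borel_measurable M" if "i \<in> I" for i
    using indep that by (auto simp: indep_vars_def)
  have int: "integrable M (Y i)" if "i \<in> I" for i
    using square_integrable_imp_integrable[OF meas[OF that] sq[OF that]] .
  have prod: "integrable M (\<lambda>\<omega>. Y i \<omega> * Y j \<omega>)"
    "expectation (\<lambda>\<omega>. Y i \<omega> * Y j \<omega>) = (if i = j then expectation (\<lambda>\<omega>. (Y i \<omega>)\<^sup>2) else 0)"
    if "i \<in> I" "j \<in> I" for i j
  proof -
    have "integrable M (\<lambda>\<omega>. Y i \<omega> * Y j \<omega>) \<and> expectation (\<lambda>\<omega>. Y i \<omega> * Y j \<omega>) = 0" if "i \<noteq> j"
    proof -
      have "indep_var borel (Y i) borel (Y j)"
        using indep_vars_sum[of "{j}" i Y] indep_vars_subset[OF indep, of "{i, j}"] that \<open>i \<in> I\<close> \<open>j \<in> I\<close>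
        by simp
      then show ?thesis
        using indep_var_lebesgue_integral[of "Y i" "Y j"] indep_var_integrable[of "Y i" "Y j"] int zero
          \<open>i \<in> I\<close> \<open>j \<in> I\<close> by simp
    qed
    with sq[OF \<open>i \<in> I\<close>] show "integrable M (\<lambda>\<omega>. Y i \<omega> * Y j \<omega>)"
      "expectation (\<lambda>\<omega>. Y i \<omega> * Y j \<omega>) = (if i = j then expectation (\<lambda>\<omega>. (Y i \<omega>)\<^sup>2) else 0)"
      by (cases "i = j"; simp add: power2_eq_square)+
  qed
  have eq: "(\<Sum>i\<in>I. Y i \<omega>)\<^sup>2 = (\<Sum>i\<in>I. \<Sum>j\<in>I. Y i \<omega> * Y j \<omega>)" for \<omega>
    by (simp add: power2_eq_square sum_product)
  show "integrable M (\<lambda>\<omega>. (\<Sum>i\<in>I. Y i \<omega>)\<^sup>2)"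
    unfolding eq by (intro Bochner_Integration.integrable_sum prod)
  show "expectation (\<lambda>\<omega>. (\<Sum>i\<in>I. Y i \<omega>)\<^sup>2) = (\<Sum>i\<in>I. expectation (\<lambda>\<omega>. (Y i \<omega>)\<^sup>2))"
    unfolding eq using \<open>finite I\<close> by (simp add: prod)
qed

lemma expectation_abs_le_sqrt:
  fixes Y :: "'a \<Rightarrow> real"
  assumes [measurable]: "Y \<in> borel_measurable M" and sq: "integrable M (\<lambda>\<omega>. (Y \<omega>)\<^sup>2)"
  shows "expectation (\<lambda>\<omega>. \<bar>Y \<omega>\<bar>) \<le> sqrt (expectation (\<lambda>\<omega>. (Y \<omega>)\<^sup>2))"
proof (rule real_le_rsqrt)
  have int: "integrable M Y"
    by (rule square_integrable_imp_integrable) (use sq in auto)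
  have "0 \<le> variance (\<lambda>\<omega>. \<bar>Y \<omega>\<bar>)" by (rule variance_positive)
  also have "\<dots> = expectation (\<lambda>\<omega>. \<bar>Y \<omega>\<bar>\<^sup>2) - (expectation (\<lambda>\<omega>. \<bar>Y \<omega>\<bar>))\<^sup>2"
    using int sq by (intro variance_eq) auto
  finally show "(expectation (\<lambda>\<omega>. \<bar>Y \<omega>\<bar>))\<^sup>2 \<le> expectation (\<lambda>\<omega>. (Y \<omega>)\<^sup>2)" by simp
qed

text \<open>
  The variance of a mean of \<open>n\<close> independent copies is the variance of one copy divided by \<open>n\<close>, and
  the mean absolute deviation is at most the standard deviation.
\<close>

lemma mean_deviation_le:
  fixes X :: "nat \<Rightarrow> 'a \<Rightarrow> 'b::topological_space" and u :: "'b \<Rightarrow> real"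
  assumes indep: "indep_vars (\<lambda>_. borel) X {1..}"
    and law: "\<And>i. i \<ge> 1 \<Longrightarrow> distr M borel (X i) = P"
    and [measurable]: "u \<in> borel_measurable borel" and sq: "integrable P (\<lambda>x. (u x)\<^sup>2)"
    and n: "1 \<le> n"
  shows "(\<integral>\<^sup>+\<omega>. ennreal \<bar>(\<Sum>i=1..n. u (X i \<omega>)) / n - (\<integral>x. u x \<partial>P)\<bar> \<partial>M) \<le>
    ennreal (sqrt (\<integral>x. (u x)\<^sup>2 \<partial>P) / sqrt n)"
proof -
  define \<mu> where "\<mu> = (\<integral>x. u x \<partial>P)"
  define Y where "Y i \<omega> = u (X i \<omega>) - \<mu>" for i \<omega>
  have X [measurable]: "X i \<in> M \<rightarrow>\<^sub>M borel" if "1 \<le> i" for i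
    using indep that by (auto simp: indep_vars_def)
  have u: "integrable M (\<lambda>\<omega>. (u (X i \<omega>))\<^sup>2)" "expectation (\<lambda>\<omega>. (u (X i \<omega>))\<^sup>2) = (\<integral>x. (u x)\<^sup>2 \<partial>P)"
    "expectation (\<lambda>\<omega>. u (X i \<omega>)) = \<mu>" if "1 \<le> i" for i
    using sq unfolding law[OF that, symmetric] \<mu>_def
    using X[OF that] by (simp_all add: integrable_distr_eq integral_distr)
  have u1: "integrable M (\<lambda>\<omega>. u (X i \<omega>))" if "1 \<le> i" for i
    by (rule square_integrable_imp_integrable) (use X[OF that] u(1)[OF that] in auto)
  have Y: "integrable M (\<lambda>\<omega>. (Y i \<omega>)\<^sup>2)" "expectation (Y i) = 0"
    "expectation (\<lambda>\<omega>. (Y i \<omega>)\<^sup>2) \<le> (\<integral>x. (u x)\<^sup>2 \<partial>P)" if "i \<in> {1..n}" for i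
  proof -
    have i: "1 \<le> i" using that by simp
    have eq: "(Y i \<omega>)\<^sup>2 = (u (X i \<omega>))\<^sup>2 - 2 * \<mu> * u (X i \<omega>) + \<mu>\<^sup>2" for \<omega>
      by (simp add: Y_def power2_diff)
    show "integrable M (\<lambda>\<omega>. (Y i \<omega>)\<^sup>2)"
      unfolding eq using u(1)[OF i] u1[OF i] by simp
    show "expectation (Y i) = 0"
      unfolding Y_def using u(3)[OF i] u1[OF i] by (simp add: prob_space)
    show "expectation (\<lambda>\<omega>. (Y i \<omega>)\<^sup>2) \<le> (\<integral>x. (u x)\<^sup>2 \<partial>P)"
      unfolding eq using u(1)[OF i] u1[OF i] u(2,3)[OF i] by (simp add: prob_space power2_eq_square)
  qed
  have indep': "indep_vars (\<lambda>_. borel) Y {1..n}"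
    unfolding Y_def
    by (rule indep_vars_compose2[OF indep_vars_subset[OF indep]]) auto
  note S = expectation_square_sum_indep[OF indep' finite_atLeastAtMost Y(1,2)]
  have Ymeas: "(\<lambda>\<omega>. \<Sum>i=1..n. Y i \<omega>) \<in> borel_measurable M"
    unfolding Y_def using X by (auto intro!: borel_measurable_sum)
  have dev: "\<bar>(\<Sum>i=1..n. u (X i \<omega>)) / n - \<mu>\<bar> = \<bar>\<Sum>i=1..n. Y i \<omega>\<bar> / n" for \<omega>
  proof -
    have "(\<Sum>i=1..n. u (X i \<omega>)) / n - \<mu> = (\<Sum>i=1..n. Y i \<omega>) / n"
      using n by (simp add: Y_def sum_subtractf field_simps)
    then show ?thesis using n by (simp add: abs_divide)
  qed
  have int: "integrable M (\<lambda>\<omega>. \<bar>\<Sum>i=1..n. Y i \<omega>\<bar> / n)"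
    using square_integrable_imp_integrable[OF Ymeas S(1)] by simp
  have "expectation (\<lambda>\<omega>. \<bar>\<Sum>i=1..n. Y i \<omega>\<bar>) \<le> sqrt (\<Sum>i=1..n. expectation (\<lambda>\<omega>. (Y i \<omega>)\<^sup>2))"
    using expectation_abs_le_sqrt[OF Ymeas S(1)] S(2) by simp
  also have "\<dots> \<le> sqrt (\<Sum>i=1..n. \<integral>x. (u x)\<^sup>2 \<partial>P)"
    by (intro real_sqrt_le_mono sum_mono Y)
  also have "\<dots> = sqrt n * sqrt (\<integral>x. (u x)\<^sup>2 \<partial>P)"
    by (simp add: real_sqrt_mult)
  finally have "expectation (\<lambda>\<omega>. \<bar>\<Sum>i=1..n. Y i \<omega>\<bar>) / n \<le> sqrt n * sqrt (\<integral>x. (u x)\<^sup>2 \<partial>P) / n"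
    by (rule divide_right_mono) simp
  also have "\<dots> = sqrt (\<integral>x. (u x)\<^sup>2 \<partial>P) / sqrt n"
  proof -
    have "real n = sqrt n * sqrt n" by simp
    then show ?thesis using n by (metis mult.commute mult_divide_mult_cancel_left_if of_nat_0_less_iff
        real_sqrt_gt_0_iff less_irrefl less_le_trans zero_less_one)
  qed
  finally have "expectation (\<lambda>\<omega>. \<bar>\<Sum>i=1..n. Y i \<omega>\<bar> / n) \<le> sqrt (\<integral>x. (u x)\<^sup>2 \<partial>P) / sqrt n"
    by simp
  then show ?thesis
    unfolding \<mu>_def[symmetric] dev
    by (subst nn_integral_eq_integral[OF int]) (auto intro: ennreal_leI)
qed

text \<open>
  A bound for the deviation of empirical means that is uniform over all functions
  \<open>h = (\<Sum>\<alpha>. c \<alpha> * u \<alpha>)\<close> with \<open>\<bar>c \<alpha>\<bar> \<le> D \<alpha> * t\<close>. Only the coefficients depend on \<open>h\<close>, so the triangle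
  inequality bounds the deviation of \<open>h\<close> by \<open>t\<close> times the \<open>D\<close>-weighted sum \<open>Z n\<close> of the deviations
  of the fixed functions \<open>u \<alpha>\<close>; the expectation of \<open>Z n\<close> is a convergent sum of one-function bounds.
\<close>

lemma uniform_deviation:
  fixes X :: "nat \<Rightarrow> 'a \<Rightarrow> 'b::topological_space"
    and u :: "'i \<Rightarrow> 'b \<Rightarrow> real" and F :: "nat \<Rightarrow> 'i set" and D r :: "'i \<Rightarrow> real"
  assumes indep: "indep_vars (\<lambda>_. borel) X {1..}"
    and law: "\<And>i. i \<ge> 1 \<Longrightarrow> distr M borel (X i) = P"
    and F: "\<And>N. finite (F N)" "incseq F"
    and u [measurable]: "\<And>\<alpha>. u \<alpha> \<in> borel_measurable borel"
    and V [measurable]: "V \<in> borel_measurable borel" and V0: "\<And>x. 0 \<le> V x"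
    and V2: "integrable P (\<lambda>x. (V x)\<^sup>2)"
    and D: "\<And>\<alpha>. 0 \<le> D \<alpha>" and r: "\<And>\<alpha>. 0 \<le> r \<alpha>" "\<And>N. (\<Sum>\<alpha>\<in>F N. r \<alpha>) \<le> K"
    and bound: "\<And>\<alpha> x. D \<alpha> * \<bar>u \<alpha> x\<bar> \<le> r \<alpha> * V x"
  obtains Z :: "nat \<Rightarrow> 'a \<Rightarrow> ennreal" where
    "\<And>n. 1 \<le> n \<Longrightarrow> Z n \<in> borel_measurable M"
    "\<And>n. 1 \<le> n \<Longrightarrow> (\<integral>\<^sup>+\<omega>. Z n \<omega> \<partial>M) \<le> ennreal (K * sqrt (\<integral>x. (V x)\<^sup>2 \<partial>P) / sqrt n)"
    "\<And>n \<omega> c t h. 1 \<le> n \<Longrightarrow> 0 \<le> t \<Longrightarrow> (\<And>\<alpha>. \<bar>c \<alpha>\<bar> \<le> D \<alpha> * t) \<Longrightarrow>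
       (\<And>x. (\<lambda>N. \<Sum>\<alpha>\<in>F N. c \<alpha> * u \<alpha> x) \<longlonglongrightarrow> h x) \<Longrightarrow>
       ennreal \<bar>(\<Sum>i=1..n. h (X i \<omega>)) / n - (\<integral>x. h x \<partial>P)\<bar> \<le> ennreal t * Z n \<omega>"
proof -
  have X [measurable]: "X i \<in> M \<rightarrow>\<^sub>M borel" if "1 \<le> i" for i
    using indep that by (auto simp: indep_vars_def)
  have P: "prob_space P" and sets_P [measurable_cong]: "sets P = sets borel"
    using prob_space_distr[OF X[of 1]] law[of 1] by auto
  interpret P: prob_space P by (rule P)
  have V1: "integrable P V"
    by (rule P.square_integrable_imp_integrable) (use V2 in auto)
  define w where "w \<alpha> x = D \<alpha> * u \<alpha> x" for \<alpha> x
  have w [measurable]: "w \<alpha> \<in> borel_measurable borel" for \<alpha> unfolding w_def by measurable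
  have w_le: "\<bar>w \<alpha> x\<bar> \<le> r \<alpha> * V x" for \<alpha> x
    using bound[of \<alpha> x] D[of \<alpha>] by (simp add: w_def abs_mult)
  have w2_le: "(w \<alpha> x)\<^sup>2 \<le> (r \<alpha>)\<^sup>2 * (V x)\<^sup>2" for \<alpha> x
    using power_mono[OF w_le[of \<alpha> x], of 2] by (simp add: power_mult_distrib)
  have w2: "integrable P (\<lambda>x. (w \<alpha> x)\<^sup>2)" for \<alpha>
    by (rule Bochner_Integration.integrable_bound[OF integrable_mult_right[OF V2, of "(r \<alpha>)\<^sup>2"]])
       (use w2_le in auto)
  define dev where "dev \<alpha> n \<omega> = \<bar>(\<Sum>i=1..n. w \<alpha> (X i \<omega>)) / n - (\<integral>x. w \<alpha> x \<partial>P)\<bar>"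
    for \<alpha> n \<omega>
  have dev_meas [measurable]: "dev \<alpha> n \<in> borel_measurable M" for \<alpha> n
  proof -
    have "(\<lambda>\<omega>. \<Sum>i=1..n. w \<alpha> (X i \<omega>)) \<in> borel_measurable M"
      by (intro borel_measurable_sum measurable_compose[OF X w]) auto
    then show ?thesis unfolding dev_def by measurable
  qed
  \<comment> \<open>the full series as a supremum of partial sums, possibly infinite on a null set\<close>
  define Z where "Z n \<omega> = (SUP N. \<Sum>\<alpha>\<in>F N. ennreal (dev \<alpha> n \<omega>))" for n \<omega>
  have Z_meas: "Z n \<in> borel_measurable M" for n
    unfolding Z_def by measurable
  have Z_int: "(\<integral>\<^sup>+\<omega>. Z n \<omega> \<partial>M) \<le> ennreal (K * sqrt (\<integral>x. (V x)\<^sup>2 \<partial>P) / sqrt n)" if n: "1 \<le> n" for n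
  proof -
    define \<sigma> where "\<sigma> = sqrt (\<integral>x. (V x)\<^sup>2 \<partial>P)"
    have \<sigma>: "0 \<le> \<sigma>" by (simp add: \<sigma>_def)
    have one: "(\<integral>\<^sup>+\<omega>. ennreal (dev \<alpha> n \<omega>) \<partial>M) \<le> ennreal (r \<alpha> * \<sigma> / sqrt n)" for \<alpha>
    proof -
      have "(\<integral>\<^sup>+\<omega>. ennreal (dev \<alpha> n \<omega>) \<partial>M) \<le> ennreal (sqrt (\<integral>x. (w \<alpha> x)\<^sup>2 \<partial>P) / sqrt n)"
        unfolding dev_def by (rule mean_deviation_le[OF indep law w w2 n])
      also have "\<dots> \<le> ennreal (r \<alpha> * \<sigma> / sqrt n)"
      proof (intro ennreal_leI divide_right_mono)
        have "(\<integral>x. (w \<alpha> x)\<^sup>2 \<partial>P) \<le> (\<integral>x. (r \<alpha>)\<^sup>2 * (V x)\<^sup>2 \<partial>P)"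
          using w2 V2 w2_le by (intro integral_mono) auto
        then have "sqrt (\<integral>x. (w \<alpha> x)\<^sup>2 \<partial>P) \<le> sqrt ((r \<alpha>)\<^sup>2 * (\<integral>x. (V x)\<^sup>2 \<partial>P))" by simp
        then show "sqrt (\<integral>x. (w \<alpha> x)\<^sup>2 \<partial>P) \<le> r \<alpha> * \<sigma>"
          using r(1)[of \<alpha>] by (simp add: real_sqrt_mult \<sigma>_def)
      qed auto
      finally show ?thesis .
    qed
    have "(\<integral>\<^sup>+\<omega>. Z n \<omega> \<partial>M) = (SUP N. \<integral>\<^sup>+\<omega>. (\<Sum>\<alpha>\<in>F N. ennreal (dev \<alpha> n \<omega>)) \<partial>M)"
      unfolding Z_def
      by (rule nn_integral_monotone_convergence_SUP)
         (use F in \<open>auto simp: incseq_def le_fun_def intro!: sum_mono2\<close>)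
    also have "\<dots> \<le> ennreal (K * \<sigma> / sqrt n)"
    proof (rule SUP_least)
      fix N
      have "(\<integral>\<^sup>+\<omega>. (\<Sum>\<alpha>\<in>F N. ennreal (dev \<alpha> n \<omega>)) \<partial>M) \<le> (\<Sum>\<alpha>\<in>F N. ennreal (r \<alpha> * \<sigma> / sqrt n))"
        by (subst nn_integral_sum) (auto intro!: sum_mono one)
      also have "\<dots> = ennreal ((\<Sum>\<alpha>\<in>F N. r \<alpha>) * \<sigma> / sqrt n)"
        using r(1) \<sigma> by (subst sum_ennreal) (auto simp: sum_distrib_right sum_divide_distrib)
      also have "\<dots> \<le> ennreal (K * \<sigma> / sqrt n)"
        using r(2) \<sigma> by (intro ennreal_leI divide_right_mono mult_right_mono) auto
      finally show "(\<integral>\<^sup>+\<omega>. (\<Sum>\<alpha>\<in>F N. ennreal (dev \<alpha> n \<omega>)) \<partial>M) \<le> ennreal (K * \<sigma> / sqrt n)" .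
    qed
    finally show ?thesis by (simp add: \<sigma>_def)
  qed
  have Z_dev: "ennreal \<bar>(\<Sum>i=1..n. h (X i \<omega>)) / n - (\<integral>x. h x \<partial>P)\<bar> \<le> ennreal t * Z n \<omega>"
    if n: "1 \<le> n" and t: "0 \<le> t" and c: "\<And>\<alpha>. \<bar>c \<alpha>\<bar> \<le> D \<alpha> * t"
      and h: "\<And>x. (\<lambda>N. \<Sum>\<alpha>\<in>F N. c \<alpha> * u \<alpha> x) \<longlonglongrightarrow> h x" for n \<omega> c t h
  proof -
    have cu: "\<bar>c \<alpha> * u \<alpha> x\<bar> \<le> t * (r \<alpha> * V x)" for \<alpha> x
    proof -
      have "\<bar>c \<alpha> * u \<alpha> x\<bar> \<le> D \<alpha> * t * \<bar>u \<alpha> x\<bar>"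
        unfolding abs_mult by (intro mult_right_mono c) auto
      also have "\<dots> = t * (D \<alpha> * \<bar>u \<alpha> x\<bar>)" by simp
      also have "\<dots> \<le> t * (r \<alpha> * V x)" by (intro mult_left_mono bound t)
      finally show ?thesis .
    qed
    have int_cu: "integrable P (\<lambda>x. c \<alpha> * u \<alpha> x)" for \<alpha>
      by (rule Bochner_Integration.integrable_bound[OF integrable_mult_right[OF V1, of "t * r \<alpha>"]])
         (use cu V0 r(1) t in \<open>auto simp: mult.assoc intro!: AE_I2 order.trans[OF cu]\<close>)
    have "(\<lambda>N. \<integral>x. (\<Sum>\<alpha>\<in>F N. c \<alpha> * u \<alpha> x) \<partial>P) \<longlonglongrightarrow> (\<integral>x. h x \<partial>P)"
    proof (rule integral_dominated_convergence[where w = "\<lambda>x. t * K * V x"])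
      show "integrable P (\<lambda>x. t * K * V x)" using V1 by simp
      show "AE x in P. norm (\<Sum>\<alpha>\<in>F N. c \<alpha> * u \<alpha> x) \<le> t * K * V x" for N
      proof (rule AE_I2)
        fix x
        have "norm (\<Sum>\<alpha>\<in>F N. c \<alpha> * u \<alpha> x) \<le> (\<Sum>\<alpha>\<in>F N. t * (r \<alpha> * V x))"
          unfolding real_norm_def by (rule order.trans[OF sum_abs], rule sum_mono, rule cu)
        also have "\<dots> = t * V x * (\<Sum>\<alpha>\<in>F N. r \<alpha>)" by (simp add: sum_distrib_left mult_ac)
        also have "\<dots> \<le> t * V x * K" using t V0 r(2) by (intro mult_left_mono) auto
        finally show "norm (\<Sum>\<alpha>\<in>F N. c \<alpha> * u \<alpha> x) \<le> t * K * V x" by (simp add: mult_ac)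
      qed
      show "h \<in> borel_measurable P"
        by (rule borel_measurable_LIMSEQ_real[OF h]) measurable
    qed (use h in auto)
    then have Eh: "(\<lambda>N. \<Sum>\<alpha>\<in>F N. c \<alpha> * (\<integral>x. u \<alpha> x \<partial>P)) \<longlonglongrightarrow> (\<integral>x. h x \<partial>P)"
      using int_cu by simp
    have "(\<lambda>N. (\<Sum>i=1..n. (\<Sum>\<alpha>\<in>F N. c \<alpha> * u \<alpha> (X i \<omega>))) / n - (\<Sum>\<alpha>\<in>F N. c \<alpha> * (\<integral>x. u \<alpha> x \<partial>P)))
        \<longlonglongrightarrow> (\<Sum>i=1..n. h (X i \<omega>)) / n - (\<integral>x. h x \<partial>P)"
      using n by (intro tendsto_diff tendsto_divide tendsto_sum h tendsto_const Eh) auto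
    then have "(\<lambda>N. ennreal \<bar>(\<Sum>i=1..n. (\<Sum>\<alpha>\<in>F N. c \<alpha> * u \<alpha> (X i \<omega>))) / n - (\<Sum>\<alpha>\<in>F N. c \<alpha> * (\<integral>x. u \<alpha> x \<partial>P))\<bar>)
        \<longlonglongrightarrow> ennreal \<bar>(\<Sum>i=1..n. h (X i \<omega>)) / n - (\<integral>x. h x \<partial>P)\<bar>"
      by (intro tendsto_ennrealI tendsto_rabs)
    then show ?thesis
    proof (rule LIMSEQ_le_const2, intro exI allI impI)
      fix N
      let ?d = "\<lambda>\<alpha>. (\<Sum>i=1..n. u \<alpha> (X i \<omega>)) / n - (\<integral>x. u \<alpha> x \<partial>P)"
      have "(\<Sum>i=1..n. (\<Sum>\<alpha>\<in>F N. c \<alpha> * u \<alpha> (X i \<omega>))) / n - (\<Sum>\<alpha>\<in>F N. c \<alpha> * (\<integral>x. u \<alpha> x \<partial>P)) =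
          (\<Sum>\<alpha>\<in>F N. c \<alpha> * ?d \<alpha>)"
        by (subst sum.swap) (simp add: sum_divide_distrib right_diff_distrib sum_subtractf sum_distrib_left)
      also have "\<bar>\<dots>\<bar> \<le> (\<Sum>\<alpha>\<in>F N. t * dev \<alpha> n \<omega>)"
      proof (rule order.trans[OF sum_abs], rule sum_mono)
        fix \<alpha>
        have "\<bar>c \<alpha> * ?d \<alpha>\<bar> \<le> D \<alpha> * t * \<bar>?d \<alpha>\<bar>"
          unfolding abs_mult by (intro mult_right_mono c) auto
        also have "\<dots> = t * \<bar>D \<alpha> * ?d \<alpha>\<bar>" using D[of \<alpha>] by (simp add: abs_mult)
        also have "D \<alpha> * ?d \<alpha> = (\<Sum>i=1..n. w \<alpha> (X i \<omega>)) / n - (\<integral>x. w \<alpha> x \<partial>P)"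
          by (simp add: w_def right_diff_distrib sum_distrib_left)
        finally show "\<bar>c \<alpha> * ?d \<alpha>\<bar> \<le> t * dev \<alpha> n \<omega>" by (simp add: dev_def)
      qed
      finally have "ennreal \<bar>(\<Sum>i=1..n. (\<Sum>\<alpha>\<in>F N. c \<alpha> * u \<alpha> (X i \<omega>))) / n - (\<Sum>\<alpha>\<in>F N. c \<alpha> * (\<integral>x. u \<alpha> x \<partial>P))\<bar>
          \<le> ennreal (\<Sum>\<alpha>\<in>F N. t * dev \<alpha> n \<omega>)" by (rule ennreal_leI)
      also have "\<dots> = ennreal t * (\<Sum>\<alpha>\<in>F N. ennreal (dev \<alpha> n \<omega>))"
        using t by (subst sum_ennreal) (auto simp: dev_def sum_distrib_left[symmetric] ennreal_mult sum_nonneg)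
      also have "\<dots> \<le> ennreal t * Z n \<omega>"
        unfolding Z_def by (intro mult_left_mono SUP_upper) auto
      finally show "ennreal \<bar>(\<Sum>i=1..n. (\<Sum>\<alpha>\<in>F N. c \<alpha> * u \<alpha> (X i \<omega>))) / n - (\<Sum>\<alpha>\<in>F N. c \<alpha> * (\<integral>x. u \<alpha> x \<partial>P))\<bar>
          \<le> ennreal t * Z n \<omega>" .
    qed
  qed
  show ?thesis by (rule that[OF Z_meas Z_int Z_dev])
qed

end

lemma (in prob_space) bigo_in_prob_transfer:
  assumes Y: "bigo_in_prob M Y a" and a: "\<And>n. 0 \<le> a n" and c: "0 \<le> c"
    and le: "\<And>n. n \<ge> 1 \<Longrightarrow> AE \<omega> in M. \<bar>Y' n \<omega>\<bar> \<le> c * \<bar>Y n \<omega>\<bar> ^ q"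
  shows "bigo_in_prob M Y' (\<lambda>n. a n ^ q)"
  unfolding bigo_in_prob_def
proof (intro allI impI)
  fix \<epsilon> :: real assume "0 < \<epsilon>"
  then obtain C where C: "0 < C" and
    ev: "\<forall>\<^sub>F n in sequentially. \<exists>A\<in>sets M. {\<omega> \<in> space M. C * a n < \<bar>Y n \<omega>\<bar>} \<subseteq> A \<and> measure M A \<le> \<epsilon>"
    using Y unfolding bigo_in_prob_def by blast
  show "\<exists>C>0. \<forall>\<^sub>F n in sequentially.
      \<exists>A\<in>sets M. {\<omega> \<in> space M. C * a n ^ q < \<bar>Y' n \<omega>\<bar>} \<subseteq> A \<and> measure M A \<le> \<epsilon>"
  proof (intro exI[of _ "c * C ^ q + 1"] conjI)
    show "0 < c * C ^ q + 1" using c C by (intro add_nonneg_pos) auto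
    show "\<forall>\<^sub>F n in sequentially.
      \<exists>A\<in>sets M. {\<omega> \<in> space M. (c * C ^ q + 1) * a n ^ q < \<bar>Y' n \<omega>\<bar>} \<subseteq> A \<and> measure M A \<le> \<epsilon>"
      using ev eventually_ge_at_top[of 1]
    proof eventually_elim
      case (elim n)
      then obtain A where A: "A \<in> sets M" "{\<omega> \<in> space M. C * a n < \<bar>Y n \<omega>\<bar>} \<subseteq> A" "measure M A \<le> \<epsilon>"
        by blast
      obtain N where N: "{\<omega> \<in> space M. \<not> \<bar>Y' n \<omega>\<bar> \<le> c * \<bar>Y n \<omega>\<bar> ^ q} \<subseteq> N" "emeasure M N = 0" "N \<in> sets M"
        using AE_E[OF le[OF elim(2)]] by blast
      have "{\<omega> \<in> space M. (c * C ^ q + 1) * a n ^ q < \<bar>Y' n \<omega>\<bar>} \<subseteq> A \<union> N"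
      proof (intro subsetI, rule ccontr)
        fix \<omega> assume \<omega>: "\<omega> \<in> {\<omega> \<in> space M. (c * C ^ q + 1) * a n ^ q < \<bar>Y' n \<omega>\<bar>}" "\<omega> \<notin> A \<union> N"
        have "\<bar>Y n \<omega>\<bar> \<le> C * a n" using \<omega> A(2) by (auto simp: not_less)
        then have "\<bar>Y n \<omega>\<bar> ^ q \<le> (C * a n) ^ q" by (intro power_mono) auto
        then have "c * \<bar>Y n \<omega>\<bar> ^ q \<le> c * (C * a n) ^ q" using c by (rule mult_left_mono)
        moreover have "\<bar>Y' n \<omega>\<bar> \<le> c * \<bar>Y n \<omega>\<bar> ^ q" using \<omega> N(1) by auto
        moreover have "c * (C * a n) ^ q \<le> (c * C ^ q + 1) * a n ^ q"
          using a[of n] by (simp add: power_mult_distrib distrib_right)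
        ultimately show False using \<omega>(1) by simp
      qed
      moreover have "measure M (A \<union> N) \<le> \<epsilon>"
        using measure_Un_le[OF A(1) N(3)] A(3) N(2) by (simp add: measure_def)
      ultimately show ?case using A(1) N(3) by blast
    qed
  qed
qed

lemma (in prob_space) prob_gt_le:
  assumes [measurable]: "Z \<in> borel_measurable M" and int: "(\<integral>\<^sup>+\<omega>. Z \<omega> \<partial>M) \<le> ennreal k" and "0 < a" "0 \<le> k"
  shows "prob {\<omega> \<in> space M. ennreal a < Z \<omega>} \<le> k / a"
proof -
  have "emeasure M {\<omega> \<in> space M. ennreal a < Z \<omega>} \<le> emeasure M {\<omega> \<in> space M. 1 \<le> ennreal (1 / a) * Z \<omega>}"
  proof (rule emeasure_mono)
    show "{\<omega> \<in> space M. ennreal a < Z \<omega>} \<subseteq> {\<omega> \<in> space M. 1 \<le> ennreal (1 / a) * Z \<omega>}"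
    proof safe
      fix \<omega> assume "ennreal a < Z \<omega>"
      then have "ennreal (1 / a) * ennreal a \<le> ennreal (1 / a) * Z \<omega>"
        by (intro mult_left_mono) auto
      then show "1 \<le> ennreal (1 / a) * Z \<omega>"
        using \<open>0 < a\<close> by (simp add: ennreal_mult[symmetric])
    qed
  qed measurable
  also have "\<dots> \<le> ennreal (1 / a) * (\<integral>\<^sup>+\<omega>. Z \<omega> * indicator (space M) \<omega> \<partial>M)"
    by (rule nn_integral_Markov_inequality) auto
  also have "(\<integral>\<^sup>+\<omega>. Z \<omega> * indicator (space M) \<omega> \<partial>M) = (\<integral>\<^sup>+\<omega>. Z \<omega> \<partial>M)"
    by (rule nn_integral_cong) simp
  also have "ennreal (1 / a) * (\<integral>\<^sup>+\<omega>. Z \<omega> \<partial>M) \<le> ennreal (1 / a) * ennreal k"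
    by (intro mult_left_mono int) auto
  also have "\<dots> = ennreal (k / a)"
    using \<open>0 < a\<close> \<open>0 \<le> k\<close> by (simp add: ennreal_mult[symmetric])
  finally show ?thesis
    using \<open>0 < a\<close> \<open>0 \<le> k\<close> by (simp add: emeasure_eq_measure)
qed

section \<open>The rate of the moment gap\<close>

locale npmle_sample = finite_mixture B \<Theta> g0 S R + prob_space M
  for B :: "'d::finite set" and \<Theta> g0 S R and M :: "'a measure" +
  fixes X :: "nat \<Rightarrow> 'a \<Rightarrow> real ^ 'd"
  assumes indep: "indep_vars (\<lambda>_. borel) X {1..}"
    and law: "\<And>i. i \<ge> 1 \<Longrightarrow> distr M borel (X i) = density (base_measure B) (\<lambda>x. ennreal (mix_density B g0 x))"
begin

abbreviation P :: "(real ^ 'd) measure" where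
  "P \<equiv> density (base_measure B) (\<lambda>x. ennreal (f0 x))"

definition emp_mean :: "nat \<Rightarrow> 'a \<Rightarrow> (real ^ 'd \<Rightarrow> real) \<Rightarrow> real" where
  "emp_mean n \<omega> f = (\<Sum>i=1..n. f (X i \<omega>)) / n"

text \<open>
  The relative error of the mixture density of \<open>g\<close>.
\<close>

definition rel_gap :: "(real ^ 'd) measure \<Rightarrow> real ^ 'd \<Rightarrow> real" where
  "rel_gap g x = mixture_gap (\<lambda>_. 0) g x / f0 x"

lemma integral_P:
  assumes "f \<in> borel_measurable borel"
  shows "(\<integral>x. f x \<partial>P) = (\<integral>x. f x * f0 x \<partial>base_measure B)"
  using assms f0_pos by (subst integral_density) (auto simp: less_imp_le mult.commute cong: measurable_cong_sets)

lemma integrable_P: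
  assumes "f \<in> borel_measurable borel" "exp_bounded f"
  shows "integrable P f"
  using integrable_exp_bounded_f0[OF assms] assms(1) f0_pos
  by (subst integrable_density) (auto simp: less_imp_le mult.commute cong: measurable_cong_sets)

lemma one_plus_rel_gap: "1 + rel_gap g x = mix_density B g x / f0 x"
  using f0_pos[of x] unfolding rel_gap_def mix_density_eq[of g x] by (simp add: add_divide_distrib)

lemma measurable_rel_gap [measurable]:
  assumes "g \<in> mixing_dists \<Theta>" shows "rel_gap g \<in> borel_measurable borel"
proof -
  have "mixture_gap (\<lambda>_. 0) g \<in> borel_measurable borel"
    by (rule borel_measurable_LIMSEQ_real[OF mixture_gap_expansion[OF assms]]) measurable
  then show ?thesis unfolding rel_gap_def by measurable
qed

text \<open>
  The expansion of \<open>mixture_gap\<close> has the form required by \<open>uniform_deviation\<close>: the fixed functions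
  are \<open>T * basis_fun B \<alpha> / f0\<close>, and the coefficients are integrals against \<open>g - g0\<close>, controlled by
  \<open>moment_gap g\<close>.
\<close>

lemma rel_gap_deviation:
  assumes [measurable]: "T \<in> borel_measurable borel" and T: "exp_bounded T"
  obtains Z :: "nat \<Rightarrow> 'a \<Rightarrow> ennreal" and K :: real where "0 \<le> K" "\<And>n. 1 \<le> n \<Longrightarrow> Z n \<in> borel_measurable M"
    "\<And>n. 1 \<le> n \<Longrightarrow> (\<integral>\<^sup>+\<omega>. Z n \<omega> \<partial>M) \<le> ennreal (K / sqrt n)"
    "\<And>n \<omega> g. 1 \<le> n \<Longrightarrow> g \<in> mixing_dists \<Theta> \<Longrightarrow>
       ennreal \<bar>emp_mean n \<omega> (\<lambda>x. T x * rel_gap g x) - (\<integral>x. T x * mixture_gap (\<lambda>_. 0) g x \<partial>base_measure B)\<bar>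
         \<le> ennreal (moment_gap g) * Z n \<omega>"
proof -
  obtain A C where A: "1 \<le> A" and C: "0 \<le> C"
    and AC: "\<And>g \<alpha>. g \<in> mixing_dists \<Theta> \<Longrightarrow>
       \<bar>discrepancy g (tilted_monomial B (\<lambda>l. \<alpha> l + 0))\<bar> \<le> C * A ^ total_degree \<alpha> * moment_gap g"
    by (rule tilted_discrepancy_le[of "\<lambda>_. 0"]) blast
  have "0 \<le> 2 * A" using A by simp
  then obtain V where [measurable]: "V \<in> borel_measurable borel" and V: "exp_bounded V" "\<And>x. 0 \<le> V x"
    "\<And>\<alpha> x. (2 * A) ^ total_degree \<alpha> * \<bar>basis_fun B \<alpha> x\<bar> \<le> V x * f0 x"
    by (rule basis_fun_bound) blast
  let ?V = "\<lambda>x. C * \<bar>T x\<bar> * V x"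
  let ?u = "\<lambda>\<alpha> x. T x * basis_fun B \<alpha> x / f0 x"
  have bnd: "C * A ^ total_degree \<alpha> * \<bar>?u \<alpha> x\<bar> \<le> (1 / 2) ^ total_degree \<alpha> * ?V x" for \<alpha> x
  proof -
    have "C * A ^ total_degree \<alpha> * \<bar>?u \<alpha> x\<bar> =
        (1 / 2) ^ total_degree \<alpha> * (C * \<bar>T x\<bar> * (((2 * A) ^ total_degree \<alpha> * \<bar>basis_fun B \<alpha> x\<bar>) / f0 x))"
      using f0_pos[of x] by (simp add: power_mult_distrib power_one_over abs_mult)
    also have "\<dots> \<le> (1 / 2) ^ total_degree \<alpha> * (C * \<bar>T x\<bar> * V x)"
      using V(3)[of \<alpha> x] f0_pos[of x] C by (intro mult_left_mono) (auto simp: pos_divide_le_eq)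
    finally show ?thesis by simp
  qed
  have V2: "integrable P (\<lambda>x. (?V x)\<^sup>2)"
    unfolding power2_eq_square
    by (intro integrable_P exp_bounded_mult exp_bounded_const exp_bounded_abs T V) measurable
  obtain Z :: "nat \<Rightarrow> 'a \<Rightarrow> ennreal" where Z: "\<And>n. 1 \<le> n \<Longrightarrow> Z n \<in> borel_measurable M"
    "\<And>n. 1 \<le> n \<Longrightarrow> (\<integral>\<^sup>+\<omega>. Z n \<omega> \<partial>M) \<le> ennreal (2 ^ CARD('d) * sqrt (\<integral>x. (?V x)\<^sup>2 \<partial>P) / sqrt n)"
    "\<And>n \<omega> c t h. 1 \<le> n \<Longrightarrow> 0 \<le> t \<Longrightarrow> (\<And>\<alpha>. \<bar>c \<alpha>\<bar> \<le> C * A ^ total_degree \<alpha> * t) \<Longrightarrow>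
       (\<And>x. (\<lambda>N. \<Sum>\<alpha>\<in>degree_box N. c \<alpha> * ?u \<alpha> x) \<longlonglongrightarrow> h x) \<Longrightarrow>
       ennreal \<bar>(\<Sum>i=1..n. h (X i \<omega>)) / n - (\<integral>x. h x \<partial>P)\<bar> \<le> ennreal t * Z n \<omega>"
  proof (rule uniform_deviation[OF indep law, where F = degree_box and u = ?u and V = ?V
        and D = "\<lambda>\<alpha>. C * A ^ total_degree \<alpha>" and r = "\<lambda>\<alpha>. (1 / 2) ^ total_degree \<alpha>" and K = "2 ^ CARD('d)"])
    show "incseq (degree_box :: nat \<Rightarrow> ('d \<Rightarrow> nat) set)"
      unfolding incseq_def le_fun_def subset_iff degree_box_iff by (meson less_le_trans)
    show "?V \<in> borel_measurable borel" by measurable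
    show "?u \<alpha> \<in> borel_measurable borel" for \<alpha> by measurable
  qed (use A C V(2) V2 bnd sum_degree_box_geometric_le in auto)
  show ?thesis
  proof (rule that[of "2 ^ CARD('d) * sqrt (\<integral>x. (?V x)\<^sup>2 \<partial>P)" Z])
    fix n \<omega> g assume n: "(1::nat) \<le> n" and g: "g \<in> mixing_dists \<Theta>"
    let ?c = "\<lambda>\<alpha>. discrepancy g (tilted_monomial B (\<lambda>l. \<alpha> l + 0))"
    have [measurable]: "rel_gap g \<in> borel_measurable borel" by (rule measurable_rel_gap[OF g])
    have "(\<lambda>N. \<Sum>\<alpha>\<in>degree_box N. ?c \<alpha> * ?u \<alpha> x) \<longlonglongrightarrow> T x * rel_gap g x" for x
    proof -
      have "(\<lambda>N. T x / f0 x * (\<Sum>\<alpha>\<in>degree_box N. ?c \<alpha> * basis_fun B \<alpha> x)) \<longlonglongrightarrow> T x / f0 x * mixture_gap (\<lambda>_. 0) g x"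
        by (intro tendsto_mult_left mixture_gap_expansion g)
      then show ?thesis by (simp add: rel_gap_def sum_distrib_left mult_ac)
    qed
    from Z(3)[OF n moment_gap_nonneg AC[OF g] this]
    have "ennreal \<bar>emp_mean n \<omega> (\<lambda>x. T x * rel_gap g x) - (\<integral>x. T x * rel_gap g x \<partial>P)\<bar> \<le> ennreal (moment_gap g) * Z n \<omega>"
      by (simp add: emp_mean_def)
    also have "(\<integral>x. T x * rel_gap g x \<partial>P) = (\<integral>x. T x * mixture_gap (\<lambda>_. 0) g x \<partial>base_measure B)"
    proof (subst integral_P)
      show "(\<integral>x. T x * rel_gap g x * f0 x \<partial>base_measure B) = (\<integral>x. T x * mixture_gap (\<lambda>_. 0) g x \<partial>base_measure B)"
        by (rule Bochner_Integration.integral_cong[OF refl]) (simp add: rel_gap_def less_imp_neq[OF f0_pos, symmetric])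
    qed measurable
    finally show "ennreal \<bar>emp_mean n \<omega> (\<lambda>x. T x * rel_gap g x) - (\<integral>x. T x * mixture_gap (\<lambda>_. 0) g x \<partial>base_measure B)\<bar>
         \<le> ennreal (moment_gap g) * Z n \<omega>" .
  qed (use Z in auto)
qed

lemma integral_mixture_gap_dual:
  assumes g: "g \<in> mixing_dists \<Theta>"
    and T: "T \<in> borel_measurable borel" "exp_bounded T"
    and dual: "\<And>\<theta>. \<theta> \<in> param_space B \<Longrightarrow> has_bochner_integral (base_measure B) (\<lambda>x. T x * lik B \<theta> x) (monomial \<beta> \<theta>)"
  shows "(\<integral>x. T x * mixture_gap (\<lambda>_. 0) g x \<partial>base_measure B) = discrepancy g (monomial \<beta>)"
proof -
  have "has_bochner_integral (base_measure B) (\<lambda>x. T x * mix_density B g' x) (\<integral>\<theta>. monomial \<beta> \<theta> \<partial>g')"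
    if "g' \<in> mixing_dists \<Theta>" for g'
    using param by (intro integral_dual_mixture that T dual) auto
  from has_bochner_integral_diff[OF this[OF g] this[OF g0]]
  show ?thesis
    unfolding discrepancy_def mix_density_eq[of g] by (simp add: has_bochner_integral_iff algebra_simps)
qed

text \<open>
  Write \<open>h\<close> for \<open>rel_gap g\<close>. The likelihood comparison and \<open>ln_one_plus_le\<close> bound the empirical mean
  \<open>Q\<close> of \<open>h\<^sup>2 / (1 + \<bar>h\<bar>)\<close> by four times the empirical mean of \<open>h\<close>. The Cauchy-Schwarz inequality
  transfers this to the means of \<open>T \<beta> * h\<close>, which equal the moments of \<open>g - g0\<close> up to fluctuations.
  The resulting inequality for \<open>moment_gap g\<close> has the square root of \<open>moment_gap g\<close> on its right-hand
  side, because \<open>h\<close> itself has a mean of order \<open>moment_gap g * z\<close>; solving it gives the linear bound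
  in \<open>z\<close>.
\<close>

lemma npmle_moment_gap_le:
  assumes g: "g \<in> mixing_dists \<Theta>" and n: "1 \<le> n"
    and lik: "log_lik n (\<lambda>i. X i \<omega>) f0 \<le> log_lik n (\<lambda>i. X i \<omega>) (mix_density B g)"
    and z: "emp_mean n \<omega> (rel_gap g) \<le> moment_gap g * z" "0 \<le> z"
    and y: "\<And>\<beta>. \<beta> \<in> degree_box (Suc m) \<Longrightarrow>
        \<bar>discrepancy g (monomial \<beta>) - emp_mean n \<omega> (\<lambda>x. T \<beta> x * rel_gap g x)\<bar> \<le> moment_gap g * y \<beta>"
      "(\<Sum>\<beta>\<in>degree_box (Suc m). y \<beta>) \<le> 1 / 2"
    and w: "\<And>\<beta>. \<beta> \<in> degree_box (Suc m) \<Longrightarrow> emp_mean n \<omega> (\<lambda>x. (T \<beta> x)\<^sup>2 * (1 + \<bar>rel_gap g x\<bar>)) \<le> w" "0 \<le> w"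
  shows "moment_gap g \<le> 16 * (real (card (degree_box (Suc m) :: ('d \<Rightarrow> nat) set)))\<^sup>2 * z * w"
proof -
  let ?h = "\<lambda>i. rel_gap g (X i \<omega>)" and ?N = "moment_gap g"
  let ?I = "degree_box (Suc m) :: ('d \<Rightarrow> nat) set"
  define Q where "Q = (\<Sum>i=1..n. (?h i)\<^sup>2 / (1 + \<bar>?h i\<bar>)) / n"
  have h: "-1 < rel_gap g x" for x
    using one_plus_rel_gap[of g x] mix_density_pos[OF g, of x] f0_pos[of x]
    by (smt (verit) divide_pos_pos)
  have "0 \<le> (\<Sum>i=1..n. ln (mix_density B g (X i \<omega>)) - ln (f0 (X i \<omega>)))"
    using lik by (simp add: log_lik_def sum_subtractf)
  also have "\<dots> = (\<Sum>i=1..n. ln (1 + ?h i))"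
  proof (rule sum.cong[OF refl])
    fix i
    show "ln (mix_density B g (X i \<omega>)) - ln (f0 (X i \<omega>)) = ln (1 + ?h i)"
      using mix_density_pos[OF g, of "X i \<omega>"] f0_pos[of "X i \<omega>"] by (simp add: one_plus_rel_gap ln_div)
  qed
  also have "\<dots> \<le> (\<Sum>i=1..n. ?h i - (?h i)\<^sup>2 / (4 * (1 + \<bar>?h i\<bar>)))"
    by (intro sum_mono ln_one_plus_le h)
  also have "\<dots> = (\<Sum>i=1..n. ?h i) - (\<Sum>i=1..n. (?h i)\<^sup>2 / (1 + \<bar>?h i\<bar>)) / 4"
    by (simp add: sum_subtractf sum_divide_distrib mult.commute)
  finally have "(\<Sum>i=1..n. (?h i)\<^sup>2 / (1 + \<bar>?h i\<bar>)) \<le> 4 * (\<Sum>i=1..n. ?h i)" by simp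
  then have "Q \<le> 4 * (\<Sum>i=1..n. ?h i) / n"
    unfolding Q_def by (intro divide_right_mono) auto
  also have "\<dots> \<le> 4 * (?N * z)"
    using z(1) by (simp add: emp_mean_def)
  finally have Q: "Q \<le> 4 * (?N * z)" .
  \<comment> \<open>Cauchy-Schwarz for the factors \<open>h / sqrt (1 + \<bar>h\<bar>)\<close> and \<open>T \<beta> * sqrt (1 + \<bar>h\<bar>)\<close>\<close>
  have mean: "\<bar>emp_mean n \<omega> (\<lambda>x. T \<beta> x * rel_gap g x)\<bar> \<le> sqrt (4 * (?N * z) * w)" if "\<beta> \<in> ?I" for \<beta>
  proof (rule real_le_rsqrt)
    let ?W = "\<Sum>i=1..n. (T \<beta> (X i \<omega>))\<^sup>2 * (1 + \<bar>?h i\<bar>)"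
    have "(\<Sum>i=1..n. T \<beta> (X i \<omega>) * ?h i)\<^sup>2 =
        (\<Sum>i=1..n. (?h i / sqrt (1 + \<bar>?h i\<bar>)) * (T \<beta> (X i \<omega>) * sqrt (1 + \<bar>?h i\<bar>)))\<^sup>2"
    proof -
      have "sqrt (1 + \<bar>?h i\<bar>) \<noteq> 0" for i by (simp add: add_nonneg_eq_0_iff)
      then show ?thesis by (simp add: mult.commute)
    qed
    also have "\<dots> \<le> (\<Sum>i=1..n. (?h i / sqrt (1 + \<bar>?h i\<bar>))\<^sup>2) * (\<Sum>i=1..n. (T \<beta> (X i \<omega>) * sqrt (1 + \<bar>?h i\<bar>))\<^sup>2)"
      by (rule Cauchy_Schwarz_ineq_sum)
    also have "\<dots> = (\<Sum>i=1..n. (?h i)\<^sup>2 / (1 + \<bar>?h i\<bar>)) * ?W"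
      by (simp add: power_divide power_mult_distrib)
    finally have "(\<Sum>i=1..n. T \<beta> (X i \<omega>) * ?h i)\<^sup>2 / (real n)\<^sup>2 \<le> (\<Sum>i=1..n. (?h i)\<^sup>2 / (1 + \<bar>?h i\<bar>)) * ?W / (real n)\<^sup>2"
      by (rule divide_right_mono) simp
    then have "\<bar>emp_mean n \<omega> (\<lambda>x. T \<beta> x * rel_gap g x)\<bar>\<^sup>2 \<le> Q * (?W / n)"
      by (simp add: emp_mean_def Q_def power_divide power2_eq_square)
    also have "\<dots> \<le> 4 * (?N * z) * w"
      using w(1)[OF that] w(2) Q moment_gap_nonneg[of g] z(2)
      by (intro mult_mono) (auto simp: emp_mean_def intro!: divide_nonneg_nonneg sum_nonneg mult_nonneg_nonneg)
    finally show "\<bar>emp_mean n \<omega> (\<lambda>x. T \<beta> x * rel_gap g x)\<bar>\<^sup>2 \<le> 4 * (?N * z) * w" .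
  qed
  have "?N = (\<Sum>\<beta>\<in>?I. \<bar>discrepancy g (monomial \<beta>)\<bar>)" by (simp add: moment_gap_def)
  also have "\<dots> \<le> (\<Sum>\<beta>\<in>?I. ?N * y \<beta> + sqrt (4 * (?N * z) * w))"
  proof (rule sum_mono)
    fix \<beta> assume \<beta>: "\<beta> \<in> ?I"
    show "\<bar>discrepancy g (monomial \<beta>)\<bar> \<le> ?N * y \<beta> + sqrt (4 * (?N * z) * w)"
      using y(1)[OF \<beta>] mean[OF \<beta>] by linarith
  qed
  also have "\<dots> = ?N * (\<Sum>\<beta>\<in>?I. y \<beta>) + card ?I * sqrt (4 * (?N * z) * w)"
    by (simp add: sum.distrib sum_distrib_left)
  also have "\<dots> \<le> ?N * (1 / 2) + card ?I * sqrt (4 * (?N * z) * w)"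
    by (intro add_right_mono mult_left_mono y(2) moment_gap_nonneg)
  finally have "?N \<le> 2 * (card ?I * sqrt (4 * (?N * z) * w))" by simp
  then have "?N\<^sup>2 \<le> (2 * (card ?I * sqrt (4 * (?N * z) * w)))\<^sup>2"
    by (intro power_mono moment_gap_nonneg)
  also have "\<dots> = 16 * (real (card ?I))\<^sup>2 * z * w * ?N"
    using moment_gap_nonneg[of g] z(2) w(2) by (simp add: power_mult_distrib)
  finally have "?N * ?N \<le> (16 * (real (card ?I))\<^sup>2 * z * w) * ?N" by (simp add: power2_eq_square)
  then show ?thesis
    using moment_gap_nonneg[of g] z(2) w(2) by (cases "?N = 0") (auto simp: mult_le_cancel_right)
qed

lemma measurable_X [measurable]: "1 \<le> i \<Longrightarrow> X i \<in> M \<rightarrow>\<^sub>M borel"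
  using indep by (auto simp: indep_vars_def)

lemma measurable_emp_mean [measurable]:
  assumes "f \<in> borel_measurable borel"
  shows "(\<lambda>\<omega>. emp_mean n \<omega> f) \<in> borel_measurable M"
  unfolding emp_mean_def using assms
  by (intro borel_measurable_divide borel_measurable_sum measurable_compose[OF measurable_X]) auto

lemma expectation_emp_mean:
  assumes [measurable]: "f \<in> borel_measurable borel" and f: "exp_bounded f" "\<And>x. 0 \<le> f x" and n: "1 \<le> n"
  shows "(\<integral>\<^sup>+\<omega>. ennreal (emp_mean n \<omega> f) \<partial>M) = ennreal (\<integral>x. f x \<partial>P)"
proof -
  have int: "integrable M (\<lambda>\<omega>. f (X i \<omega>))" "expectation (\<lambda>\<omega>. f (X i \<omega>)) = (\<integral>x. f x \<partial>P)" if "i \<in> {1..n}" for i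
  proof -
    have i: "1 \<le> i" using that by simp
    have "integrable (distr M borel (X i)) f"
      unfolding law[OF i] by (rule integrable_P[OF assms(1) f(1)])
    then show "integrable M (\<lambda>\<omega>. f (X i \<omega>))"
      using measurable_X[OF i] by (simp add: integrable_distr_eq)
    show "expectation (\<lambda>\<omega>. f (X i \<omega>)) = (\<integral>x. f x \<partial>P)"
      unfolding law[OF i, symmetric] using measurable_X[OF i] by (simp add: integral_distr)
  qed
  have "(\<integral>\<^sup>+\<omega>. ennreal (emp_mean n \<omega> f) \<partial>M) = ennreal (expectation (\<lambda>\<omega>. emp_mean n \<omega> f))"
  proof (rule nn_integral_eq_integral)
    show "integrable M (\<lambda>\<omega>. emp_mean n \<omega> f)"
      unfolding emp_mean_def
      by (intro Bochner_Integration.integrable_divide Bochner_Integration.integrable_sum int)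
    show "AE \<omega> in M. 0 \<le> emp_mean n \<omega> f"
      unfolding emp_mean_def by (intro AE_I2 divide_nonneg_nonneg sum_nonneg f) auto
  qed
  also have "expectation (\<lambda>\<omega>. emp_mean n \<omega> f) = (\<integral>x. f x \<partial>P)"
    unfolding emp_mean_def using int n by simp
  finally show ?thesis .
qed

lemma moment_gap_bounded:
  obtains L where "\<And>g. g \<in> mixing_dists \<Theta> \<Longrightarrow> moment_gap g \<le> L"
proof (rule that[of "\<Sum>\<beta>\<in>(degree_box (Suc m) :: ('d \<Rightarrow> nat) set). 2 * (\<Prod>l\<in>UNIV. R ^ \<beta> l)"])
  fix g assume g: "g \<in> mixing_dists \<Theta>"
  have int: "\<bar>\<integral>\<theta>. monomial \<beta> \<theta> \<partial>g'\<bar> \<le> (\<Prod>l\<in>UNIV. R ^ \<beta> l)" if g': "g' \<in> mixing_dists \<Theta>" for g' \<beta>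
  proof -
    interpret g': prob_space g' by (rule mixing_dists_prob[OF g'])
    have "norm (\<integral>\<theta>. monomial \<beta> \<theta> \<partial>g') \<le> (\<integral>\<theta>. (\<Prod>l\<in>UNIV. R ^ \<beta> l) \<partial>g')"
    proof (rule Bochner_Integration.integral_norm_bound_integral)
      show "integrable g' (monomial \<beta>)"
        by (rule mixing_dists_integrable[OF g', where K = "\<Prod>l\<in>UNIV. R ^ \<beta> l"]) (auto simp: monomial_bound)
    qed (simp_all add: monomial_bound mixing_dists_space[OF g'])
    then show ?thesis by (simp add: g'.prob_space)
  qed
  show "moment_gap g \<le> (\<Sum>\<beta>\<in>(degree_box (Suc m) :: ('d \<Rightarrow> nat) set). 2 * (\<Prod>l\<in>UNIV. R ^ \<beta> l))"
    unfolding moment_gap_def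
  proof (rule sum_mono)
    fix \<beta> :: "'d \<Rightarrow> nat"
    show "\<bar>discrepancy g (monomial \<beta>)\<bar> \<le> 2 * (\<Prod>l\<in>UNIV. R ^ \<beta> l)"
      using int[OF g, of \<beta>] int[OF g0, of \<beta>] by (simp add: discrepancy_def)
  qed
qed

text \<open>
  Off three events of probability at most \<open>\<epsilon> / 3\<close>, each bounded by the Markov inequality, the
  hypotheses of \<open>npmle_moment_gap_le\<close> hold with \<open>z\<close> of order \<open>1 / sqrt n\<close> and with \<open>w\<close> not depending on
  \<open>n\<close>.
\<close>

lemma moment_gap_bigo:
  assumes ghat: "\<And>n. n \<ge> 1 \<Longrightarrow> AE \<omega> in M. is_npmle B \<Theta> n (\<lambda>i. X i \<omega>) (ghat n \<omega>)"
  shows "bigo_in_prob M (\<lambda>n \<omega>. moment_gap (ghat n \<omega>)) (\<lambda>n. 1 / sqrt (real n))"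
proof -
  let ?I = "degree_box (Suc m) :: ('d \<Rightarrow> nat) set"
  have "\<forall>\<beta>. \<exists>T. T \<in> borel_measurable borel \<and> exp_bounded T \<and>
    (\<forall>\<theta>\<in>param_space B. has_bochner_integral (base_measure B) (\<lambda>x. T x * lik B \<theta> x) (monomial \<beta> \<theta>))"
    by (intro allI monomial_dual_exists)
  then obtain T where T: "\<And>\<beta>. T \<beta> \<in> borel_measurable borel" "\<And>\<beta>. exp_bounded (T \<beta>)"
    "\<And>\<beta> \<theta>. \<theta> \<in> param_space B \<Longrightarrow> has_bochner_integral (base_measure B) (\<lambda>x. T \<beta> x * lik B \<theta> x) (monomial \<beta> \<theta>)"
    by metis
  note [measurable] = T(1)
  \<comment> \<open>\<open>T = 1\<close>, whose product with \<open>rel_gap g\<close> has mean zero: both mixtures integrate to one\<close>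
  obtain Z1 :: "nat \<Rightarrow> 'a \<Rightarrow> ennreal" and K1 where K1: "0 \<le> K1"
    and Z1_meas: "\<And>n. 1 \<le> n \<Longrightarrow> Z1 n \<in> borel_measurable M"
    and Z1_int: "\<And>n. 1 \<le> n \<Longrightarrow> (\<integral>\<^sup>+\<omega>. Z1 n \<omega> \<partial>M) \<le> ennreal (K1 / sqrt n)"
    and Z1': "\<And>n \<omega> g. 1 \<le> n \<Longrightarrow> g \<in> mixing_dists \<Theta> \<Longrightarrow>
       ennreal \<bar>emp_mean n \<omega> (\<lambda>x. 1 * rel_gap g x) - (\<integral>x. 1 * mixture_gap (\<lambda>_. 0) g x \<partial>base_measure B)\<bar>
         \<le> ennreal (moment_gap g) * Z1 n \<omega>"
    by (rule rel_gap_deviation[of "\<lambda>_. 1"]) (auto intro: exp_bounded_const)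
  have Z1_zero: "(\<integral>x. 1 * mixture_gap (\<lambda>_. 0) g x \<partial>base_measure B) = 0" if g: "g \<in> mixing_dists \<Theta>" for g
  proof -
    have "(\<integral>x. 1 * mixture_gap (\<lambda>_. 0) g x \<partial>base_measure B) = discrepancy g (monomial (\<lambda>_. 0))"
      by (rule integral_mixture_gap_dual[OF g]) (auto intro: exp_bounded_const lik_integral)
    then show ?thesis
      using mixing_dists_prob[OF g] mixing_dists_prob[OF g0]
      by (simp add: discrepancy_def prob_space.prob_space)
  qed
  have Z1_dev: "ennreal \<bar>emp_mean n \<omega> (rel_gap g)\<bar> \<le> ennreal (moment_gap g) * Z1 n \<omega>"
    if "1 \<le> n" "g \<in> mixing_dists \<Theta>" for n \<omega> g
    using Z1'[OF that, of \<omega>] unfolding Z1_zero[OF that(2)] by simp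
  define controls where "controls \<beta> Z K \<longleftrightarrow> 0 \<le> K \<and> (\<forall>n\<ge>1. Z n \<in> borel_measurable M) \<and>
    (\<forall>n\<ge>1. (\<integral>\<^sup>+\<omega>. Z n \<omega> \<partial>M) \<le> ennreal (K / sqrt n)) \<and>
    (\<forall>n\<ge>1. \<forall>\<omega>. \<forall>g\<in>mixing_dists \<Theta>.
       ennreal \<bar>emp_mean n \<omega> (\<lambda>x. T \<beta> x * rel_gap g x) - discrepancy g (monomial \<beta>)\<bar>
         \<le> ennreal (moment_gap g) * Z n \<omega>)" for \<beta> and Z :: "nat \<Rightarrow> 'a \<Rightarrow> ennreal" and K :: real
  have "\<forall>\<beta>. \<exists>Z K. controls \<beta> Z K"
  proof
    fix \<beta>
    obtain Z :: "nat \<Rightarrow> 'a \<Rightarrow> ennreal" and K where Z: "0 \<le> K" "\<And>n. 1 \<le> n \<Longrightarrow> Z n \<in> borel_measurable M"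
      "\<And>n. 1 \<le> n \<Longrightarrow> (\<integral>\<^sup>+\<omega>. Z n \<omega> \<partial>M) \<le> ennreal (K / sqrt n)"
      "\<And>n \<omega> g. 1 \<le> n \<Longrightarrow> g \<in> mixing_dists \<Theta> \<Longrightarrow>
         ennreal \<bar>emp_mean n \<omega> (\<lambda>x. T \<beta> x * rel_gap g x) - (\<integral>x. T \<beta> x * mixture_gap (\<lambda>_. 0) g x \<partial>base_measure B)\<bar>
           \<le> ennreal (moment_gap g) * Z n \<omega>"
      by (rule rel_gap_deviation[OF T(1,2)[of \<beta>]]) blast
    have "ennreal \<bar>emp_mean n \<omega> (\<lambda>x. T \<beta> x * rel_gap g x) - discrepancy g (monomial \<beta>)\<bar>
        \<le> ennreal (moment_gap g) * Z n \<omega>" if "1 \<le> n" and g: "g \<in> mixing_dists \<Theta>" for n \<omega> g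
      using Z(4)[OF that, of \<omega>] integral_mixture_gap_dual[OF g T(1,2) T(3)[of _ \<beta>]] by simp
    with Z(1-3) have "controls \<beta> Z K" unfolding controls_def by simp
    then show "\<exists>Z K. controls \<beta> Z K" by blast
  qed
  then obtain Z K where ZK: "\<And>\<beta>. controls \<beta> (Z \<beta>) (K \<beta>)" by metis
  have K: "0 \<le> K \<beta>" for \<beta>
    using ZK[of \<beta>] by (simp add: controls_def)
  have Z_meas: "Z \<beta> n \<in> borel_measurable M" and Z_int: "(\<integral>\<^sup>+\<omega>. Z \<beta> n \<omega> \<partial>M) \<le> ennreal (K \<beta> / sqrt n)"
    if "1 \<le> n" for \<beta> n
    using ZK[of \<beta>] that by (simp_all add: controls_def)
  have Z_dev: "ennreal \<bar>emp_mean n \<omega> (\<lambda>x. T \<beta> x * rel_gap g x) - discrepancy g (monomial \<beta>)\<bar>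
      \<le> ennreal (moment_gap g) * Z \<beta> n \<omega>" if "1 \<le> n" "g \<in> mixing_dists \<Theta>" for \<beta> n \<omega> g
    using ZK[of \<beta>] that by (simp add: controls_def)
  obtain V where [measurable]: "V \<in> borel_measurable borel" and V: "exp_bounded V" "\<And>x. 0 \<le> V x"
    "\<And>g x. g \<in> mixing_dists \<Theta> \<Longrightarrow> \<bar>mixture_gap (\<lambda>_. 0) g x\<bar> \<le> V x * f0 x * moment_gap g"
    by (rule mixture_gap_le) blast
  obtain L where L: "\<And>g. g \<in> mixing_dists \<Theta> \<Longrightarrow> moment_gap g \<le> L"
    by (rule moment_gap_bounded) blast
  have L0: "0 \<le> L" using L[OF g0] moment_gap_nonneg[of g0] by linarith
  have rel_le: "\<bar>rel_gap g x\<bar> \<le> V x * L" if g: "g \<in> mixing_dists \<Theta>" for g x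
  proof -
    have "\<bar>rel_gap g x\<bar> \<le> V x * moment_gap g"
      using V(3)[OF g, of x] f0_pos[of x] by (simp add: rel_gap_def abs_divide pos_divide_le_eq mult_ac)
    also have "\<dots> \<le> V x * L" by (intro mult_left_mono L g V)
    finally show ?thesis .
  qed
  \<comment> \<open>dominates every statistic \<open>(T \<beta>)\<^sup>2 * (1 + \<bar>rel_gap g\<bar>)\<close>, uniformly in \<open>g\<close>\<close>
  define G where "G x = (\<Sum>\<beta>\<in>?I. (T \<beta> x)\<^sup>2 * (1 + V x * L))" for x
  have G_meas [measurable]: "G \<in> borel_measurable borel" unfolding G_def by measurable
  have G0: "0 \<le> G x" for x
    unfolding G_def using V(2) L0 by (intro sum_nonneg mult_nonneg_nonneg add_nonneg_nonneg) auto
  have G_exp: "exp_bounded G"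
  proof -
    have "exp_bounded (\<lambda>x. \<Sum>\<beta>\<in>J. (T \<beta> x)\<^sup>2 * (1 + V x * L))" if "finite J" for J
      using that unfolding power2_eq_square by (induction J rule: finite_induct)
        (auto intro!: exp_bounded_add exp_bounded_mult exp_bounded_const V T)
    then show ?thesis by (simp add: G_def[abs_def])
  qed
  define KG where "KG = (\<integral>x. G x \<partial>P)"
  have KG: "0 \<le> KG" unfolding KG_def by (intro integral_nonneg_AE) (simp add: G0)
  define KS where "KS = (\<Sum>\<beta>\<in>?I. K \<beta>)"
  have KS: "0 \<le> KS" unfolding KS_def by (intro sum_nonneg K)
  show ?thesis
    unfolding bigo_in_prob_def
  proof (intro allI impI)
    fix \<epsilon> :: real assume \<epsilon>: "0 < \<epsilon>"
    define \<delta> where "\<delta> = \<epsilon> / 3"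
    have \<delta>: "0 < \<delta>" using \<epsilon> by (simp add: \<delta>_def)
    define w where "w = (KG + 1) / \<delta>"
    have w: "0 < w" using KG \<delta> by (simp add: w_def)
    define C where "C = 16 * (real (card ?I))\<^sup>2 * ((K1 + 1) / \<delta>) * w"
    have C: "0 \<le> C" using K1 \<delta> w by (simp add: C_def)
    \<comment> \<open>only the fluctuations of the moments have to be small rather than bounded, which needs large \<open>n\<close>\<close>
    have "(\<lambda>n. 2 * KS / sqrt (real n)) \<longlonglongrightarrow> 0"
      by (intro tendsto_divide_0[OF tendsto_const] filterlim_at_top_imp_at_infinity
          filterlim_compose[OF sqrt_at_top filterlim_real_sequentially])
    then have ev: "\<forall>\<^sub>F n in sequentially. 2 * KS / sqrt (real n) < \<delta>"
      using \<delta> by (rule order_tendstoD(2))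
    show "\<exists>C>0. \<forall>\<^sub>F n in sequentially. \<exists>A\<in>sets M.
        {\<omega> \<in> space M. C * (1 / sqrt (real n)) < \<bar>moment_gap (ghat n \<omega>)\<bar>} \<subseteq> A \<and> measure M A \<le> \<epsilon>"
    proof (intro exI[of _ "C + 1"] conjI)
      show "0 < C + 1" using C by simp
      show "\<forall>\<^sub>F n in sequentially. \<exists>A\<in>sets M.
        {\<omega> \<in> space M. (C + 1) * (1 / sqrt (real n)) < \<bar>moment_gap (ghat n \<omega>)\<bar>} \<subseteq> A \<and> measure M A \<le> \<epsilon>"
        using ev eventually_ge_at_top[of 1]
      proof eventually_elim
        case (elim n)
        then have n: "1 \<le> n" by simp
        note [measurable] = Z1_meas[OF n] Z_meas[OF n]
        define z where "z = (K1 + 1) / (\<delta> * sqrt n)"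
        have z: "0 < z" using K1 \<delta> n by (simp add: z_def)
        obtain N where N: "{\<omega> \<in> space M. \<not> is_npmle B \<Theta> n (\<lambda>i. X i \<omega>) (ghat n \<omega>)} \<subseteq> N"
          "emeasure M N = 0" "N \<in> sets M"
          using AE_E[OF ghat[OF n]] by blast
        \<comment> \<open>too large: the fluctuation of \<open>rel_gap\<close>, the second factor of Cauchy-Schwarz, the fluctuations of the moments\<close>
        define A1 where "A1 = {\<omega> \<in> space M. ennreal z < Z1 n \<omega>}"
        define A2 where "A2 = {\<omega> \<in> space M. ennreal w < ennreal (emp_mean n \<omega> G)}"
        define A3 where "A3 = {\<omega> \<in> space M. ennreal (1 / 2) < (\<Sum>\<beta>\<in>?I. Z \<beta> n \<omega>)}"
        have sets: "A1 \<in> sets M" "A2 \<in> sets M" "A3 \<in> sets M"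
          unfolding A1_def A2_def A3_def by measurable
        have "prob A1 \<le> \<delta>"
        proof -
          have "prob A1 \<le> (K1 / sqrt n) / z"
            unfolding A1_def using K1 z by (intro prob_gt_le Z1_int n) auto
          also have "\<dots> = \<delta> * (K1 / (K1 + 1))"
            using n \<delta> K1 by (simp add: z_def)
          also have "\<dots> \<le> \<delta> * 1" using \<delta> K1 by (intro mult_left_mono) auto
          finally show ?thesis by simp
        qed
        moreover have "prob A2 \<le> \<delta>"
        proof -
          have "prob A2 \<le> KG / w"
            unfolding A2_def using w KG expectation_emp_mean[OF G_meas G_exp G0 n]
            by (intro prob_gt_le) (auto simp: KG_def)
          also have "\<dots> = \<delta> * (KG / (KG + 1))"
            using \<delta> KG by (simp add: w_def)
          also have "\<dots> \<le> \<delta> * 1" using \<delta> KG by (intro mult_left_mono) auto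
          finally show ?thesis by simp
        qed
        moreover have "prob A3 \<le> \<delta>"
        proof -
          have "(\<integral>\<^sup>+\<omega>. (\<Sum>\<beta>\<in>?I. Z \<beta> n \<omega>) \<partial>M) \<le> (\<Sum>\<beta>\<in>?I. ennreal (K \<beta> / sqrt n))"
            by (subst nn_integral_sum) (auto intro!: sum_mono Z_int n Z_meas)
          also have "\<dots> = ennreal (KS / sqrt n)"
            using K by (subst sum_ennreal) (auto simp: KS_def sum_divide_distrib)
          finally have "prob A3 \<le> (KS / sqrt n) / (1 / 2)"
            unfolding A3_def using KS by (intro prob_gt_le) auto
          also have "\<dots> \<le> \<delta>" using elim(1) by (simp add: mult.commute)
          finally show ?thesis .
        qed
        moreover have "prob (A1 \<union> A2 \<union> A3 \<union> N) \<le> prob A1 + prob A2 + prob A3 + prob N"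
          using measure_Un_le[of "A1 \<union> A2 \<union> A3" M N] measure_Un_le[of "A1 \<union> A2" M A3] measure_Un_le[of A1 M A2]
            sets N(3) by simp
        moreover have "prob N = 0" using N(2) by (simp add: measure_def)
        ultimately have small: "prob (A1 \<union> A2 \<union> A3 \<union> N) \<le> \<epsilon>" by (simp add: \<delta>_def)
        have "{\<omega> \<in> space M. (C + 1) * (1 / sqrt (real n)) < \<bar>moment_gap (ghat n \<omega>)\<bar>} \<subseteq> A1 \<union> A2 \<union> A3 \<union> N"
        proof (intro subsetI, rule ccontr)
          fix \<omega> assume "\<omega> \<in> {\<omega> \<in> space M. (C + 1) * (1 / sqrt (real n)) < \<bar>moment_gap (ghat n \<omega>)\<bar>}"
            and not_in: "\<omega> \<notin> A1 \<union> A2 \<union> A3 \<union> N"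
          then have \<omega>: "\<omega> \<in> space M" and big: "(C + 1) * (1 / sqrt n) < moment_gap (ghat n \<omega>)"
            using moment_gap_nonneg by auto
          define g where "g = ghat n \<omega>"
          have "is_npmle B \<Theta> n (\<lambda>i. X i \<omega>) g" using N(1) \<omega> not_in by (auto simp: g_def)
          then have g: "g \<in> mixing_dists \<Theta>"
            and lik: "log_lik n (\<lambda>i. X i \<omega>) f0 \<le> log_lik n (\<lambda>i. X i \<omega>) (mix_density B g)"
            using g0 by (auto simp: is_npmle_def is_arg_max_def not_less)
          have from_ennreal: "a \<le> moment_gap g * b" if "ennreal \<bar>a\<bar> \<le> ennreal (moment_gap g) * c" "c \<le> ennreal b" "0 \<le> b"
            for a b c
          proof -
            have "ennreal \<bar>a\<bar> \<le> ennreal (moment_gap g) * ennreal b"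
              using that(1) mult_left_mono[OF that(2), of "ennreal (moment_gap g)"] by (auto intro: order.trans)
            also have "\<dots> = ennreal (moment_gap g * b)"
              using that(3) moment_gap_nonneg by (simp add: ennreal_mult)
            finally have "\<bar>a\<bar> \<le> moment_gap g * b"
              using that(3) moment_gap_nonneg[of g] by (subst (asm) ennreal_le_iff) auto
            then show ?thesis by simp
          qed
          have sumZ: "(\<Sum>\<beta>\<in>?I. Z \<beta> n \<omega>) \<le> ennreal (1 / 2)"
            using not_in \<omega> by (auto simp: A3_def not_less)
          define y where "y \<beta> = enn2real (Z \<beta> n \<omega>)" for \<beta>
          have fin: "Z \<beta> n \<omega> = ennreal (y \<beta>)" if "\<beta> \<in> ?I" for \<beta>
          proof -
            have "Z \<beta> n \<omega> \<le> (\<Sum>\<beta>\<in>?I. Z \<beta> n \<omega>)"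
              using that by (intro member_le_sum) auto
            also note sumZ
            also have "ennreal (1 / 2) < top" by (rule ennreal_less_top)
            finally show ?thesis by (simp add: y_def)
          qed
          have y_sum: "(\<Sum>\<beta>\<in>?I. y \<beta>) \<le> 1 / 2"
          proof -
            have "(\<Sum>\<beta>\<in>?I. Z \<beta> n \<omega>) = (\<Sum>\<beta>\<in>?I. ennreal (y \<beta>))" by (intro sum.cong fin) auto
            also have "\<dots> = ennreal (\<Sum>\<beta>\<in>?I. y \<beta>)" by (intro sum_ennreal) (auto simp: y_def)
            finally have "ennreal (\<Sum>\<beta>\<in>?I. y \<beta>) \<le> ennreal (1 / 2)" using sumZ by simp
            then show ?thesis by (subst (asm) ennreal_le_iff) auto
          qed
          have "moment_gap g \<le> 16 * (real (card ?I))\<^sup>2 * z * w"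
          proof (rule npmle_moment_gap_le[where T = T and y = y, OF g n lik])
            have "Z1 n \<omega> \<le> ennreal z" using not_in \<omega> by (auto simp: A1_def not_less)
            then show "emp_mean n \<omega> (rel_gap g) \<le> moment_gap g * z"
              by (rule from_ennreal[OF Z1_dev[OF n g]]) (use z in auto)
            show "\<bar>discrepancy g (monomial \<beta>) - emp_mean n \<omega> (\<lambda>x. T \<beta> x * rel_gap g x)\<bar> \<le> moment_gap g * y \<beta>"
              if "\<beta> \<in> ?I" for \<beta>
            proof (rule from_ennreal[of _ "Z \<beta> n \<omega>"])
              show "ennreal \<bar>\<bar>discrepancy g (monomial \<beta>) - emp_mean n \<omega> (\<lambda>x. T \<beta> x * rel_gap g x)\<bar>\<bar>
                  \<le> ennreal (moment_gap g) * Z \<beta> n \<omega>"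
                using Z_dev[OF n g, of \<omega> \<beta>] by (simp add: abs_minus_commute)
              show "Z \<beta> n \<omega> \<le> ennreal (y \<beta>)" using fin[OF that] by simp
              show "0 \<le> y \<beta>" by (simp add: y_def)
            qed
            show "emp_mean n \<omega> (\<lambda>x. (T \<beta> x)\<^sup>2 * (1 + \<bar>rel_gap g x\<bar>)) \<le> w" if \<beta>: "\<beta> \<in> ?I" for \<beta>
            proof -
              have "emp_mean n \<omega> (\<lambda>x. (T \<beta> x)\<^sup>2 * (1 + \<bar>rel_gap g x\<bar>)) \<le> emp_mean n \<omega> G"
                unfolding emp_mean_def
              proof (intro divide_right_mono sum_mono)
                fix i
                let ?x = "X i \<omega>"
                have "(T \<beta> ?x)\<^sup>2 * (1 + \<bar>rel_gap g ?x\<bar>) \<le> (T \<beta> ?x)\<^sup>2 * (1 + V ?x * L)"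
                  using rel_le[OF g] by (intro mult_left_mono) auto
                also have "\<dots> \<le> G ?x"
                  unfolding G_def using \<beta> V(2) L0
                  by (intro member_le_sum[where f = "\<lambda>\<beta>. (T \<beta> ?x)\<^sup>2 * (1 + V ?x * L)"]) auto
                finally show "(T \<beta> ?x)\<^sup>2 * (1 + \<bar>rel_gap g ?x\<bar>) \<le> G ?x" .
              qed simp
              also have "\<dots> \<le> w"
                using not_in \<omega> w by (auto simp: A2_def not_less ennreal_le_iff)
              finally show ?thesis .
            qed
          qed (use z w y_sum in auto)
          also have "\<dots> = C * (1 / sqrt n)"
            using \<delta> n by (simp add: C_def z_def)
          also have "\<dots> \<le> (C + 1) * (1 / sqrt n)" by (intro mult_right_mono) auto
          finally show False using big by (simp add: g_def)
        qed
        with small sets N(3) show ?case by (intro bexI[of _ "A1 \<union> A2 \<union> A3 \<union> N"]) auto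
      qed
    qed
  qed
qed

end

section \<open>The posterior mean of the maximum likelihood estimator\<close>

theorem corollary2p2:
  fixes B :: "'d::finite set"
    and \<Theta> :: "(real ^ 'd) set"
    and g0 :: "(real ^ 'd) measure"
    and M :: "'a measure"
    and X :: "nat \<Rightarrow> 'a \<Rightarrow> real ^ 'd"
    and ghat :: "nat \<Rightarrow> 'a \<Rightarrow> (real ^ 'd) measure"
  assumes "\<Theta> \<subseteq> param_space B"
    and "bounded \<Theta>"
    and "g0 \<in> mixing_dists \<Theta>"
    and "finitely_discrete g0"
    and "prob_space M"
    and "prob_space.indep_vars M (\<lambda>_. borel) X {1..}"
    and "\<And>i. i \<ge> 1 \<Longrightarrow> distributed M (base_measure B) (X i) (\<lambda>x. ennreal (mix_density B g0 x))"
    and "\<And>n. n \<ge> 1 \<Longrightarrow> AE \<omega> in M. is_npmle B \<Theta> n (\<lambda>i. X i \<omega>) (ghat n \<omega>)"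
  shows "bigo_in_prob M
           (\<lambda>n \<omega>. \<integral>x. (norm (post_mean B (ghat n \<omega>) x - post_mean B g0 x))\<^sup>2 * mix_density B g0 x
                    \<partial>base_measure B)
           (\<lambda>n. 1 / real n)
       \<and> (B = {} \<or> B = UNIV \<longrightarrow>
           (\<forall>x\<in>sample_space B.
              bigo_in_prob M (\<lambda>n \<omega>. norm (post_mean B (ghat n \<omega>) x - post_mean B g0 x))
                (\<lambda>n. 1 / sqrt (real n))))"
proof -
  obtain S where S: "finite S" "S \<subseteq> space g0" "AE \<theta> in g0. \<theta> \<in> S"
    using assms(4) by (auto simp: finitely_discrete_def)
  obtain R0 where R0: "\<And>\<theta>. \<theta> \<in> \<Theta> \<Longrightarrow> norm \<theta> \<le> R0"
    using assms(2) by (auto simp: bounded_iff)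
  define R where "R = max 1 R0"
  have radius: "\<bar>\<theta> $ l\<bar> \<le> R" if "\<theta> \<in> \<Theta>" for \<theta> l
    using order.trans[OF component_le_norm_cart R0[OF that], of l] by (simp add: R_def)
  have law: "distr M borel (X i) = density (base_measure B) (\<lambda>x. ennreal (mix_density B g0 x))"
    if "i \<ge> 1" for i
  proof -
    have "distr M borel (X i) = distr M (base_measure B) (X i)" by (rule distr_cong) auto
    then show ?thesis using assms(7)[OF that] by (simp add: distributed_def)
  qed
  interpret npmle_sample B \<Theta> g0 S R M X
    unfolding npmle_sample_def npmle_sample_axioms_def finite_mixture_def
    using assms S radius law by (auto simp: R_def mixing_dists_space[OF assms(3)])
  obtain V where V: "V \<in> borel_measurable borel" "exp_bounded V" "\<And>x. 0 \<le> V x"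
    "\<And>g x. g \<in> mixing_dists \<Theta> \<Longrightarrow> norm (post_mean B g x - post_mean B g0 x) \<le> V x * moment_gap g"
    by (rule post_mean_diff_le) blast
  have gap: "bigo_in_prob M (\<lambda>n \<omega>. moment_gap (ghat n \<omega>)) (\<lambda>n. 1 / sqrt (real n))"
    by (rule moment_gap_bigo[OF assms(8)])
  have mixing: "AE \<omega> in M. ghat n \<omega> \<in> mixing_dists \<Theta>" if "n \<ge> 1" for n
    using assms(8)[OF that] by eventually_elim (simp add: is_npmle_def is_arg_max_def)
  have "bigo_in_prob M
      (\<lambda>n \<omega>. \<integral>x. (norm (post_mean B (ghat n \<omega>) x - post_mean B g0 x))\<^sup>2 * f0 x \<partial>base_measure B)
      (\<lambda>n. (1 / sqrt (real n)) ^ 2)"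
  proof (rule bigo_in_prob_transfer[OF gap, where c = "\<integral>x. (V x * V x) * f0 x \<partial>base_measure B"])
    show "0 \<le> (\<integral>x. (V x * V x) * f0 x \<partial>base_measure B)"
      by (intro integral_nonneg_AE AE_I2 mult_nonneg_nonneg V less_imp_le[OF f0_pos])
    fix n :: nat assume "n \<ge> 1"
    from mixing[OF this]
    show "AE \<omega> in M. \<bar>\<integral>x. (norm (post_mean B (ghat n \<omega>) x - post_mean B g0 x))\<^sup>2 * f0 x \<partial>base_measure B\<bar>
        \<le> (\<integral>x. (V x * V x) * f0 x \<partial>base_measure B) * \<bar>moment_gap (ghat n \<omega>)\<bar> ^ 2"
    proof eventually_elim
      case (elim \<omega>)
      let ?g = "ghat n \<omega>"
      let ?d = "\<lambda>x. (norm (post_mean B ?g x - post_mean B g0 x))\<^sup>2 * f0 x"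
      have "(\<integral>x. ?d x \<partial>base_measure B) \<le> (\<integral>x. (V x * V x * f0 x) * (moment_gap ?g)\<^sup>2 \<partial>base_measure B)"
      proof (rule integral_mono_AE')
        show "integrable (base_measure B) (\<lambda>x. (V x * V x * f0 x) * (moment_gap ?g)\<^sup>2)"
          using V(1) by (intro integrable_mult_left integrable_exp_bounded_f0 exp_bounded_mult V) measurable
        have "?d x \<le> (V x * V x * f0 x) * (moment_gap ?g)\<^sup>2" for x
        proof -
          have "(norm (post_mean B ?g x - post_mean B g0 x))\<^sup>2 \<le> (V x * moment_gap ?g)\<^sup>2"
            by (intro power_mono V(4) elim) auto
          from mult_right_mono[OF this less_imp_le[OF f0_pos[of x]]]
          show ?thesis by (simp add: power2_eq_square mult_ac)
        qed
        then show "AE x in base_measure B. ?d x \<le> (V x * V x * f0 x) * (moment_gap ?g)\<^sup>2" by simp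
        show "AE x in base_measure B. 0 \<le> (V x * V x * f0 x) * (moment_gap ?g)\<^sup>2"
          using V(3) less_imp_le[OF f0_pos] by simp
      qed
      moreover have "0 \<le> (\<integral>x. ?d x \<partial>base_measure B)"
        by (intro integral_nonneg_AE AE_I2 mult_nonneg_nonneg less_imp_le[OF f0_pos]) auto
      ultimately show ?case by simp
    qed
  qed auto
  also have "(\<lambda>n. (1 / sqrt (real n)) ^ 2) = (\<lambda>n. 1 / real n)"
    by (simp add: power_divide)
  finally have integrated: "bigo_in_prob M
      (\<lambda>n \<omega>. \<integral>x. (norm (post_mean B (ghat n \<omega>) x - post_mean B g0 x))\<^sup>2 * f0 x \<partial>base_measure B)
      (\<lambda>n. 1 / real n)" .
  have pointwise: "bigo_in_prob M (\<lambda>n \<omega>. norm (post_mean B (ghat n \<omega>) x - post_mean B g0 x)) (\<lambda>n. 1 / sqrt (real n))"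
    for x
  proof -
    have "bigo_in_prob M (\<lambda>n \<omega>. norm (post_mean B (ghat n \<omega>) x - post_mean B g0 x)) (\<lambda>n. (1 / sqrt (real n)) ^ 1)"
    proof (rule bigo_in_prob_transfer[OF gap, where c = "V x"])
      fix n :: nat assume "n \<ge> 1"
      from mixing[OF this]
      show "AE \<omega> in M. \<bar>norm (post_mean B (ghat n \<omega>) x - post_mean B g0 x)\<bar> \<le> V x * \<bar>moment_gap (ghat n \<omega>)\<bar> ^ 1"
        by eventually_elim (use V(4) in \<open>simp add: moment_gap_nonneg\<close>)
    qed (use V(3) in auto)
    then show ?thesis by simp
  qed
  show ?thesis using integrated pointwise by blast
qed

end
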